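(* Let $\epsilon\in\{-1,1\}$ and let $(M^{2n},\mathcal J^\epsilon,g)$ be a maximal totally $\epsilon$-complex submanifold of a para-quaternionic Kähler manifold $(\widetilde M^{4n},Q,\widetilde g)$ with $\nu\neq0$. Let $(J_\alpha)$ be an adapted basis of $(M^{2n},\mathcal J^\epsilon)$, $C=J_2h$ the shape tensor, and $$P_{XY}:=(\nabla_XC)_Y+\epsilon\,\omega(X)\,\mathcal J^\epsilon\circ C_Y\ \in S_{\mathcal J^\epsilon}.$$ Then the Gauss–Codazzi–Ricci equations can be written, for $X,Y\in TM$, as (1) $R^{TT}_{XY}=R_{XY}+[C_X,C_Y]$; (2) $J_2R^{\perp\perp}_{XY}J_2=R^N_{XY}+[C_X,C_Y]=R_{XY}+[C_X,C_Y]-\epsilon\,d\omega(X,Y)\mathcal J^\epsilon$; (3) $J_2R^{\perp T}_{XY}=P_{XY}-P_{YX}$.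
   Context: An almost para-quaternionic structure on $\widetilde M$ is a rank 3 subbundle $Q\subset \mathrm{End}\,T\widetilde M$ locally generated by three anticommuting fields of endomorphisms $J_1,J_2,J_3=J_1J_2$ with $J_\alpha^2=\epsilon_\alpha Id$, where $(\epsilon_1,\epsilon_2,\epsilon_3)$ is a permutation of $(-1,1,1)$. A para-quaternionic Kähler manifold $(\widetilde M^{4n},Q,\widetilde g)$ is a pseudo-Riemannian manifold (of dimension $4n$, neutral signature) with such a $Q$ consisting of $\widetilde g$-skew-symmetric endomorphisms and preserved by the Levi-Civita connection $\widetilde\nabla$; in dimension 4 ($n=1$) one requires in addition that $\widetilde R=\nu R_0+W$, with $R_0(X,Y)=\frac12\sum_\alpha\epsilon_\alpha\widetilde g(J_\alpha X,Y)J_\alpha+\frac14(X\wedge Y-\sum_\alpha\epsilon_\alpha J_\alpha X\wedge J_\alpha Y)$, $(X\wedge Y)Z=\widetilde g(Y,Z)X-\widetilde g(X,Z)Y$, and $W$ a trace-free $Q$-invariant algebraic curvature tensor. $\nu=scal/(4n(n+2))$ is the reduced scalar curvature. A $\widetilde g$-non-degenerate submanifold $M\subset\widetilde M$ is an almost $\epsilon$-Hermitian submanifold if there is a section $J^\epsilon:M\to Q|_M$ with $J^\epsilon TM=TM$ and $(J^\epsilon)^2=\epsilon Id$; put $g=\widetilde g|_M$, $\mathcal J^\epsilon=J^\epsilon|_{TM}$. An adapted basis is a local frame $(J_1,J_2,J_3)$ of $Q$ with $J_1|_M=J^\epsilon$, $J_1^2=\epsilon Id$, $J_2^2=Id$,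 $J_3=J_1J_2=-J_2J_1$ (so $(\epsilon_1,\epsilon_2,\epsilon_3)=(\epsilon,1,-\epsilon)$), assumed defined on a neighbourhood of $M$. $M$ is totally $\epsilon$-complex if $J_2T_xM\perp T_xM$ for all $x\in M$; maximal means $\dim M=2n$, so $T_x\widetilde M=T_xM\oplus J_2T_xM$ and $J_2$ exchanges $TM$ and $T^\perp M$. (When $\nu\ne0$, maximal totally $\epsilon$-complex submanifolds are the objects called maximal $\epsilon$-Kähler submanifolds, $\epsilon$-Kähler meaning that $F=g\circ\mathcal J^\epsilon$ is parallel.) The 1-forms $\omega_\alpha$ are defined by $\widetilde\nabla J_\alpha=-\epsilon_\beta\omega_\gamma\otimes J_\beta+\epsilon_\gamma\omega_\beta\otimes J_\gamma$, $(\alpha,\beta,\gamma)$ cyclic, $\omega=\omega_1|_{TM}$, and $\omega_2|_{TM}=\omega_3|_{TM}=0$. $h$ is the second fundamental form, $C_XY=J_2h(X,Y)$, $\nabla$ the Levi-Civita connection of $g$ with curvature $R$, $\nabla^\perp$ the normal connection, $\nabla^N=J_2\circ\nabla^\perp\circ J_2$ the corresponding connection on $TM$, with curvature $R^N$. $\widetilde R_{XY}=[\widetilde\nabla_X,\widetilde\nabla_Y]-\widetilde\nabla_{[X,Y]}$, and for $X,Y\in TM$ one decomposes $\widetilde R_{XY}=R^{TT}_{XY}+R^{\perp T}_{XY}+R^{T\perp}_{XY}+R^{\perp\perp}_{XY}$ according to $\mathrm{End}(T\widetilde M)=\mathrm{End}(TM)+\mathrm{Hom}(TM,T^\perp M)+\mathrm{Hom}(T^\perp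 M,TM)+\mathrm{End}(T^\perp M)$. $S_{\mathcal J^\epsilon}=\{A\in\mathrm{End}\,TM:\ A\mathcal J^\epsilon+\mathcal J^\epsilon A=0,\ g(AX,Y)=g(X,AY)\}$; $d\omega(X,Y)=X\omega(Y)-Y\omega(X)-\omega([X,Y])$.
   Formalization: The sign in P is corrected to P_XY = (∇_X C)_Y − ε ω(X) J∘C_Y; with the stated conventions ∇^N = ∇ − εω J, so the printed plus sign makes (3) false for a generic adapted basis unless C = 0. *)

theory Defs
  imports "HOL-Analysis.Analysis"
begin

text \<open>
  Manifolds are given by an atlas \<open>A\<close> on a topological space \<open>'p\<close>, with a Euclidean model space
  \<open>'e\<close>. The tangent space at a point \<open>p\<close> is the model space \<open>'e\<close> itself, a tangent vector being
  identified with its components in one chart \<open>chart_at A p\<close> chosen for that point; its components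
  in an arbitrary chart are given by \<open>components\<close>. A vector field is thus a function \<open>'p \<Rightarrow> 'e\<close>,
  and smoothness is always tested on the components in the charts.

  Most notions carry a submanifold \<open>S\<close> as a parameter. The case \<open>S = UNIV\<close> is the ambient manifold.
\<close>

section \<open>Smooth functions between Euclidean spaces\<close>

primrec k_times_differentiable_on ::
  "nat \<Rightarrow> 'a::real_normed_vector set \<Rightarrow> ('a \<Rightarrow> 'b::real_normed_vector) \<Rightarrow> bool" where
  "k_times_differentiable_on 0 U f = continuous_on U f"
| "k_times_differentiable_on (Suc k) U f =
     ((\<forall>x\<in>U. f differentiable (at x)) \<and>
      (\<forall>v. k_times_differentiable_on k U (\<lambda>x. frechet_derivative f (at x) v)))"

text \<open>Only used for open \<open>U\<close>.\<close>

definition smooth_on :: "'a::real_normed_vector set \<Rightarrow> ('a \<Rightarrow> 'b::real_normed_vector) \<Rightarrow> bool" where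
  "smooth_on U f \<longleftrightarrow> (\<forall>k. k_times_differentiable_on k U f)"

section \<open>Manifolds, tangent vectors, smooth fields\<close>

type_synonym ('p, 'e) chart = "'p set \<times> ('p \<Rightarrow> 'e)"

definition is_chart :: "('p::topological_space, 'e::euclidean_space) chart \<Rightarrow> bool" where
  "is_chart c \<longleftrightarrow> open (fst c) \<and> open (snd c ` fst c) \<and>
     homeomorphism (fst c) (snd c ` fst c) (snd c) (inv_into (fst c) (snd c))"

definition transition :: "('p, 'e) chart \<Rightarrow> ('p, 'e) chart \<Rightarrow> 'e \<Rightarrow> 'e" where
  "transition c d = snd d \<circ> inv_into (fst c) (snd c)"

definition compatible ::
  "('p::topological_space, 'e::euclidean_space) chart \<Rightarrow> ('p, 'e) chart \<Rightarrow> bool" where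
  "compatible c d \<longleftrightarrow> smooth_on (snd c ` (fst c \<inter> fst d)) (transition c d) \<and>
                      smooth_on (snd d ` (fst c \<inter> fst d)) (transition d c)"

definition smooth_atlas :: "('p::topological_space, 'e::euclidean_space) chart set \<Rightarrow> bool" where
  "smooth_atlas A \<longleftrightarrow> (\<forall>c\<in>A. is_chart c) \<and> (\<Union>c\<in>A. fst c) = UNIV \<and> (\<forall>c\<in>A. \<forall>d\<in>A. compatible c d)"

definition chart_at :: "('p, 'e) chart set \<Rightarrow> 'p \<Rightarrow> ('p, 'e) chart" where
  "chart_at A p = (SOME c. c \<in> A \<and> p \<in> fst c)"

definition components ::
  "('p, 'e::euclidean_space) chart set \<Rightarrow> ('p, 'e) chart \<Rightarrow> 'p \<Rightarrow> 'e \<Rightarrow> 'e" where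
  "components A c p v =
     frechet_derivative (transition (chart_at A p) c) (at (snd (chart_at A p) p)) v"

definition smooth_function ::
  "('p::topological_space, 'e::euclidean_space) chart set \<Rightarrow> 'p set \<Rightarrow> ('p \<Rightarrow> real) \<Rightarrow> bool" where
  "smooth_function A U f \<longleftrightarrow>
     (\<forall>c\<in>A. smooth_on (snd c ` (fst c \<inter> U)) (\<lambda>x. f (inv_into (fst c) (snd c) x)))"

definition smooth_field ::
  "('p::topological_space, 'e::euclidean_space) chart set \<Rightarrow> 'p set \<Rightarrow> ('p \<Rightarrow> 'e) \<Rightarrow> bool" where
  "smooth_field A U X \<longleftrightarrow>
     (\<forall>c\<in>A. smooth_on (snd c ` (fst c \<inter> U))
        (\<lambda>x. let q = inv_into (fst c) (snd c) x in components A c q (X q)))"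

definition smooth_endo ::
  "('p::topological_space, 'e::euclidean_space) chart set \<Rightarrow> 'p set \<Rightarrow> ('p \<Rightarrow> 'e \<Rightarrow> 'e) \<Rightarrow> bool" where
  "smooth_endo A U J \<longleftrightarrow> (\<forall>q\<in>U. linear (J q)) \<and>
     (\<forall>V X. open V \<longrightarrow> V \<subseteq> U \<longrightarrow> smooth_field A V X \<longrightarrow> smooth_field A V (\<lambda>q. J q (X q)))"

section \<open>Submanifolds\<close>

definition submanifold ::
  "('p::topological_space, 'e::euclidean_space) chart set \<Rightarrow> nat \<Rightarrow> 'p set \<Rightarrow> bool" where
  "submanifold A k S \<longleftrightarrow>
     (\<forall>p\<in>S. \<exists>c V. is_chart c \<and> (\<forall>d\<in>A. compatible c d) \<and> p \<in> fst c \<and>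
        subspace V \<and> dim V = k \<and> snd c ` (fst c \<inter> S) = snd c ` fst c \<inter> V)"

text \<open>Smooth curves in \<open>S\<close> with position \<open>p\<close> and velocity \<open>v\<close> at time 0.\<close>

definition curve_through ::
  "('p, 'e::euclidean_space) chart set \<Rightarrow> 'p set \<Rightarrow> 'p \<Rightarrow> 'e \<Rightarrow> (real \<Rightarrow> 'p) \<Rightarrow> bool" where
  "curve_through A S p v \<gamma> \<longleftrightarrow> \<gamma> 0 = p \<and>
     (\<exists>d>0. (\<forall>t\<in>{-d<..<d}. \<gamma> t \<in> S \<inter> fst (chart_at A p)) \<and>
            smooth_on {-d<..<d} (snd (chart_at A p) \<circ> \<gamma>)) \<and>
     ((snd (chart_at A p) \<circ> \<gamma>) has_vector_derivative v) (at 0)"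

definition tangent_space :: "('p, 'e::euclidean_space) chart set \<Rightarrow> 'p set \<Rightarrow> 'p \<Rightarrow> 'e set" where
  "tangent_space A S p = {v. \<exists>\<gamma>. curve_through A S p v \<gamma>}"

text \<open>Germs at \<open>p\<close> of smooth functions on \<open>S\<close>, of smooth sections of the ambient tangent bundle
  along \<open>S\<close>, and of smooth vector fields tangent to \<open>S\<close>. Smooth means locally the restriction
  of something smooth on an open subset of the ambient manifold.\<close>

definition function_near ::
  "('p::topological_space, 'e::euclidean_space) chart set \<Rightarrow> 'p set \<Rightarrow> 'p \<Rightarrow> ('p \<Rightarrow> real) \<Rightarrow> bool" where
  "function_near A S p f \<longleftrightarrow>
     (\<exists>U F. open U \<and> p \<in> U \<and> smooth_function A U F \<and> (\<forall>q\<in>S \<inter> U. f q = F q))"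

definition section_near ::
  "('p::topological_space, 'e::euclidean_space) chart set \<Rightarrow> 'p set \<Rightarrow> 'p \<Rightarrow> ('p \<Rightarrow> 'e) \<Rightarrow> bool" where
  "section_near A S p X \<longleftrightarrow>
     (\<exists>U F. open U \<and> p \<in> U \<and> smooth_field A U F \<and> (\<forall>q\<in>S \<inter> U. X q = F q))"

definition field_near ::
  "('p::topological_space, 'e::euclidean_space) chart set \<Rightarrow> 'p set \<Rightarrow> 'p \<Rightarrow> ('p \<Rightarrow> 'e) \<Rightarrow> bool" where
  "field_near A S p X \<longleftrightarrow> section_near A S p X \<and>
     (\<exists>U. open U \<and> p \<in> U \<and> (\<forall>q\<in>S \<inter> U. X q \<in> tangent_space A S q))"

text \<open>Some local vector field tangent to \<open>S\<close> with value \<open>v\<close> at \<open>p\<close>. It is only used to evaluate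
  tensorial expressions, whose value does not depend on the choice.\<close>

definition extend ::
  "('p::topological_space, 'e::euclidean_space) chart set \<Rightarrow> 'p set \<Rightarrow> 'p \<Rightarrow> 'e \<Rightarrow> 'p \<Rightarrow> 'e" where
  "extend A S p v = (SOME X. field_near A S p X \<and> X p = v)"

text \<open>The derivative \<open>v f\<close> of a function \<open>f\<close> on \<open>S\<close> along \<open>v\<close> in \<open>T\<^sub>pS\<close>.\<close>

definition dir_deriv ::
  "('p, 'e::euclidean_space) chart set \<Rightarrow> 'p set \<Rightarrow> 'p \<Rightarrow> 'e \<Rightarrow> ('p \<Rightarrow> real) \<Rightarrow> real" where
  "dir_deriv A S p v f = deriv (f \<circ> (SOME \<gamma>. curve_through A S p v \<gamma>)) 0"

definition is_lie_bracket ::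
  "('p::topological_space, 'e::euclidean_space) chart set \<Rightarrow> 'p set \<Rightarrow> 'p \<Rightarrow>
   ('p \<Rightarrow> 'e) \<Rightarrow> ('p \<Rightarrow> 'e) \<Rightarrow> 'e \<Rightarrow> bool" where
  "is_lie_bracket A S p X Y u \<longleftrightarrow> u \<in> tangent_space A S p \<and>
     (\<forall>f. function_near A S p f \<longrightarrow>
        dir_deriv A S p u f = dir_deriv A S p (X p) (\<lambda>q. dir_deriv A S q (Y q) f)
                            - dir_deriv A S p (Y p) (\<lambda>q. dir_deriv A S q (X q) f))"

definition lie_bracket ::
  "('p::topological_space, 'e::euclidean_space) chart set \<Rightarrow> 'p set \<Rightarrow>
   ('p \<Rightarrow> 'e) \<Rightarrow> ('p \<Rightarrow> 'e) \<Rightarrow> 'p \<Rightarrow> 'e" where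
  "lie_bracket A S X Y p = (THE u. is_lie_bracket A S p X Y u)"

definition ext_deriv1 ::
  "('p::topological_space, 'e::euclidean_space) chart set \<Rightarrow> 'p set \<Rightarrow> ('p \<Rightarrow> 'e \<Rightarrow> real) \<Rightarrow>
   'p \<Rightarrow> 'e \<Rightarrow> 'e \<Rightarrow> real" where
  "ext_deriv1 A S w p x y =
     (let X = extend A S p x; Y = extend A S p y
      in dir_deriv A S p x (\<lambda>q. w q (Y q)) - dir_deriv A S p y (\<lambda>q. w q (X q))
         - w p (lie_bracket A S X Y p))"

section \<open>Metrics, connections, curvature\<close>

type_synonym ('p, 'e) metric = "'p \<Rightarrow> 'e \<Rightarrow> 'e \<Rightarrow> real"

definition neutral_metric ::
  "('p::topological_space, 'e::euclidean_space) chart set \<Rightarrow> ('p, 'e) metric \<Rightarrow> bool" where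
  "neutral_metric A g \<longleftrightarrow>
     (\<forall>p. bilinear (g p) \<and> (\<forall>v w. g p v w = g p w v) \<and>
        (\<exists>V W. subspace V \<and> subspace W \<and> 2 * dim V = DIM('e) \<and> 2 * dim W = DIM('e) \<and>
           (\<forall>v\<in>V - {0}. g p v v > 0) \<and> (\<forall>w\<in>W - {0}. g p w w < 0))) \<and>
     (\<forall>U X Y. open U \<longrightarrow> smooth_field A U X \<longrightarrow> smooth_field A U Y \<longrightarrow>
        smooth_function A U (\<lambda>q. g q (X q) (Y q)))"

definition nondegenerate_on :: "('e::euclidean_space \<Rightarrow> 'e \<Rightarrow> real) \<Rightarrow> 'e set \<Rightarrow> bool" where
  "nondegenerate_on b T \<longleftrightarrow> (\<forall>v\<in>T. (\<forall>w\<in>T. b v w = 0) \<longrightarrow> v = 0)"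

text \<open>\<open>D p v Y\<close> is the covariant derivative at \<open>p\<close>, in direction \<open>v\<close>, of a vector field \<open>Y\<close> defined
  near \<open>p\<close>. As \<open>function_near\<close> imposes nothing away from \<open>p\<close>, the Leibniz rule, applied to
  indicator functions, implies that \<open>D p v Y\<close> depends only on the germ of \<open>Y\<close> on \<open>S\<close>.\<close>

type_synonym ('p, 'e) connection = "'p \<Rightarrow> 'e \<Rightarrow> ('p \<Rightarrow> 'e) \<Rightarrow> 'e"

definition connection_on ::
  "('p::topological_space, 'e::euclidean_space) chart set \<Rightarrow> 'p set \<Rightarrow> ('p, 'e) connection \<Rightarrow> bool" where
  "connection_on A S D \<longleftrightarrow> (\<forall>p\<in>S. let T = tangent_space A S p in
     (\<forall>Y v. field_near A S p Y \<longrightarrow> v \<in> T \<longrightarrow> D p v Y \<in> T) \<and>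
     (\<forall>Y v w a b. field_near A S p Y \<longrightarrow> v \<in> T \<longrightarrow> w \<in> T \<longrightarrow>
        D p (a *\<^sub>R v + b *\<^sub>R w) Y = a *\<^sub>R D p v Y + b *\<^sub>R D p w Y) \<and>
     (\<forall>Y Z v. field_near A S p Y \<longrightarrow> field_near A S p Z \<longrightarrow> v \<in> T \<longrightarrow>
        D p v (\<lambda>q. Y q + Z q) = D p v Y + D p v Z) \<and>
     (\<forall>f Y v. function_near A S p f \<longrightarrow> field_near A S p Y \<longrightarrow> v \<in> T \<longrightarrow>
        D p v (\<lambda>q. f q *\<^sub>R Y q) = dir_deriv A S p v f *\<^sub>R Y p + f p *\<^sub>R D p v Y) \<and>
     (\<forall>X Y. field_near A S p X \<longrightarrow> field_near A S p Y \<longrightarrow>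
        field_near A S p (\<lambda>q. D q (X q) Y)))"

definition levi_civita ::
  "('p::topological_space, 'e::euclidean_space) chart set \<Rightarrow> 'p set \<Rightarrow> ('p, 'e) metric \<Rightarrow>
   ('p, 'e) connection \<Rightarrow> bool" where
  "levi_civita A S g D \<longleftrightarrow> connection_on A S D \<and>
     (\<forall>p\<in>S. \<forall>X Y. field_near A S p X \<longrightarrow> field_near A S p Y \<longrightarrow>
        is_lie_bracket A S p X Y (D p (X p) Y - D p (Y p) X) \<and>
        (\<forall>v\<in>tangent_space A S p.
           dir_deriv A S p v (\<lambda>q. g q (X q) (Y q)) = g p (D p v X) (Y p) + g p (X p) (D p v Y)))"

definition curvature ::
  "('p::topological_space, 'e::euclidean_space) chart set \<Rightarrow> 'p set \<Rightarrow> ('p, 'e) connection \<Rightarrow>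
   'p \<Rightarrow> 'e \<Rightarrow> 'e \<Rightarrow> 'e \<Rightarrow> 'e" where
  "curvature A S D p x y z =
     (let X = extend A S p x; Y = extend A S p y; Z = extend A S p z
      in D p x (\<lambda>q. D q (Y q) Z) - D p y (\<lambda>q. D q (X q) Z) - D p (lie_bracket A S X Y p) Z)"

definition cov_deriv_endo ::
  "('p::topological_space, 'e::euclidean_space) chart set \<Rightarrow> 'p set \<Rightarrow> ('p, 'e) connection \<Rightarrow>
   ('p \<Rightarrow> 'e \<Rightarrow> 'e) \<Rightarrow> 'p \<Rightarrow> 'e \<Rightarrow> 'e \<Rightarrow> 'e" where
  "cov_deriv_endo A S D J p x z =
     (let Z = extend A S p z in D p x (\<lambda>q. J q (Z q)) - J p (D p x Z))"

text \<open>\<open>(\<nabla>\<^sub>x C)\<^sub>y z\<close> for a field \<open>C\<close> of bilinear maps.\<close>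

definition cov_deriv_bilinear ::
  "('p::topological_space, 'e::euclidean_space) chart set \<Rightarrow> 'p set \<Rightarrow> ('p, 'e) connection \<Rightarrow>
   ('p \<Rightarrow> 'e \<Rightarrow> 'e \<Rightarrow> 'e) \<Rightarrow> 'p \<Rightarrow> 'e \<Rightarrow> 'e \<Rightarrow> 'e \<Rightarrow> 'e" where
  "cov_deriv_bilinear A S D C p x y z =
     (let Y = extend A S p y; Z = extend A S p z
      in D p x (\<lambda>q. C q (Y q) (Z q)) - C p (D p x Y) z - C p y (D p x Z))"

definition trace_endo :: "('e::euclidean_space \<Rightarrow> 'e) \<Rightarrow> real" where
  "trace_endo L = (\<Sum>b\<in>Basis. L b \<bullet> b)"

definition ricci ::
  "('p::topological_space, 'e::euclidean_space) chart set \<Rightarrow> ('p, 'e) connection \<Rightarrow>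
   'p \<Rightarrow> 'e \<Rightarrow> 'e \<Rightarrow> real" where
  "ricci A D p y z = trace_endo (\<lambda>x. curvature A UNIV D p x y z)"

text \<open>The metric trace of the Ricci tensor, i.e. the trace of the endomorphism \<open>y \<mapsto> u\<close> with
  \<open>g(u, z) = Ric(y, z)\<close> for all \<open>z\<close>.\<close>

definition scalar_curvature ::
  "('p::topological_space, 'e::euclidean_space) chart set \<Rightarrow> ('p, 'e) metric \<Rightarrow>
   ('p, 'e) connection \<Rightarrow> 'p \<Rightarrow> real" where
  "scalar_curvature A g D p = trace_endo (\<lambda>y. THE u. \<forall>z. g p u z = ricci A D p y z)"

definition reduced_scalar_curvature ::
  "('p::topological_space, 'e::euclidean_space) chart set \<Rightarrow> nat \<Rightarrow> ('p, 'e) metric \<Rightarrow>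
   ('p, 'e) connection \<Rightarrow> 'p \<Rightarrow> real" where
  "reduced_scalar_curvature A n g D p = scalar_curvature A g D p / (4 * real n * (real n + 2))"

section \<open>Para-quaternionic Kaehler manifolds\<close>

text \<open>Indices are the natural numbers 1, 2, 3.\<close>

definition pq_basis ::
  "('e::euclidean_space \<Rightarrow> 'e) set \<Rightarrow> (nat \<Rightarrow> real) \<Rightarrow> (nat \<Rightarrow> 'e \<Rightarrow> 'e) \<Rightarrow> bool" where
  "pq_basis Qp e J \<longleftrightarrow>
     (e 1, e 2, e 3) \<in> {(-1, 1, 1), (1, -1, 1), (1, 1, -1)} \<and>
     (\<forall>\<alpha>\<in>{1, 2, 3}. linear (J \<alpha>) \<and> (\<forall>v. J \<alpha> (J \<alpha> v) = e \<alpha> *\<^sub>R v)) \<and>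
     (\<forall>\<alpha>\<in>{1, 2, 3}. \<forall>\<beta>\<in>{1, 2, 3}. \<alpha> \<noteq> \<beta> \<longrightarrow> (\<forall>v. J \<alpha> (J \<beta> v) = - J \<beta> (J \<alpha> v))) \<and>
     (\<forall>v. J 3 v = J 1 (J 2 v)) \<and>
     Qp = {L. \<exists>c :: nat \<Rightarrow> real. L = (\<lambda>v. \<Sum>\<alpha>\<in>{1, 2, 3}. c \<alpha> *\<^sub>R J \<alpha> v)}"

definition almost_para_quaternionic ::
  "('p::topological_space, 'e::euclidean_space) chart set \<Rightarrow> ('p \<Rightarrow> ('e \<Rightarrow> 'e) set) \<Rightarrow> bool" where
  "almost_para_quaternionic A Q \<longleftrightarrow>
     (\<forall>p. \<exists>U e J. open U \<and> p \<in> U \<and> (\<forall>\<alpha>\<in>{1, 2, 3}. smooth_endo A U (J \<alpha>)) \<and>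
        (\<forall>q\<in>U. pq_basis (Q q) e (\<lambda>\<alpha>. J \<alpha> q)))"

definition wedge :: "('e::euclidean_space \<Rightarrow> 'e \<Rightarrow> real) \<Rightarrow> 'e \<Rightarrow> 'e \<Rightarrow> 'e \<Rightarrow> 'e" where
  "wedge b x y z = b y z *\<^sub>R x - b x z *\<^sub>R y"

definition R0 ::
  "('e::euclidean_space \<Rightarrow> 'e \<Rightarrow> real) \<Rightarrow> (nat \<Rightarrow> real) \<Rightarrow> (nat \<Rightarrow> 'e \<Rightarrow> 'e) \<Rightarrow> 'e \<Rightarrow> 'e \<Rightarrow> 'e \<Rightarrow> 'e" where
  "R0 b e J x y z =
     (1/2) *\<^sub>R (\<Sum>\<alpha>\<in>{1, 2, 3}. (e \<alpha> * b (J \<alpha> x) y) *\<^sub>R J \<alpha> z) +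
     (1/4) *\<^sub>R (wedge b x y z - (\<Sum>\<alpha>\<in>{1, 2, 3}. e \<alpha> *\<^sub>R wedge b (J \<alpha> x) (J \<alpha> y) z))"

definition algebraic_curvature_tensor ::
  "('e::euclidean_space \<Rightarrow> 'e \<Rightarrow> real) \<Rightarrow> ('e \<Rightarrow> 'e \<Rightarrow> 'e \<Rightarrow> 'e) \<Rightarrow> bool" where
  "algebraic_curvature_tensor b W \<longleftrightarrow>
     (\<forall>y z. linear (\<lambda>x. W x y z)) \<and> (\<forall>x z. linear (\<lambda>y. W x y z)) \<and> (\<forall>x y. linear (W x y)) \<and>
     (\<forall>x y z. W x y z = - W y x z) \<and>
     (\<forall>x y z w. b (W x y z) w = - b z (W x y w)) \<and>
     (\<forall>x y z. W x y z + W y z x + W z x y = 0)"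

text \<open>Invariance under the Lie algebra \<open>Qp\<close>, acting on tensors by derivations.\<close>

definition Q_invariant :: "('e::euclidean_space \<Rightarrow> 'e) set \<Rightarrow> ('e \<Rightarrow> 'e \<Rightarrow> 'e \<Rightarrow> 'e) \<Rightarrow> bool" where
  "Q_invariant Qp W \<longleftrightarrow>
     (\<forall>L\<in>Qp. \<forall>x y z. L (W x y z) - W (L x) y z - W x (L y) z - W x y (L z) = 0)"

definition para_quaternionic_kaehler ::
  "('p::topological_space, 'e::euclidean_space) chart set \<Rightarrow> nat \<Rightarrow> ('p \<Rightarrow> ('e \<Rightarrow> 'e) set) \<Rightarrow>
   ('p, 'e) metric \<Rightarrow> ('p, 'e) connection \<Rightarrow> bool" where
  "para_quaternionic_kaehler A n Q g D \<longleftrightarrow>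
     n \<ge> 1 \<and> DIM('e) = 4 * n \<and> smooth_atlas A \<and>
     neutral_metric A g \<and> levi_civita A UNIV g D \<and>
     almost_para_quaternionic A Q \<and>
     (\<forall>p. \<forall>L\<in>Q p. \<forall>v w. g p (L v) w = - g p v (L w)) \<and>
     (\<forall>U J. open U \<longrightarrow> smooth_endo A U J \<longrightarrow> (\<forall>q\<in>U. J q \<in> Q q) \<longrightarrow>
        (\<forall>p\<in>U. \<forall>x. cov_deriv_endo A UNIV D J p x \<in> Q p)) \<and>
     (n = 1 \<longrightarrow>
        (\<forall>p. \<exists>e J W. pq_basis (Q p) e J \<and>
           algebraic_curvature_tensor (g p) W \<and> Q_invariant (Q p) W \<and>
           (\<forall>y z. trace_endo (\<lambda>x. W x y z) = 0) \<and>
           (\<forall>x y z. curvature A UNIV D p x y z =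
              reduced_scalar_curvature A n g D p *\<^sub>R R0 (g p) e J x y z + W x y z)))"

section \<open>Submanifolds of a para-quaternionic Kaehler manifold\<close>

definition almost_eps_hermitian ::
  "('p::topological_space, 'e::euclidean_space) chart set \<Rightarrow> nat \<Rightarrow> ('p \<Rightarrow> ('e \<Rightarrow> 'e) set) \<Rightarrow>
   ('p, 'e) metric \<Rightarrow> real \<Rightarrow> 'p set \<Rightarrow> ('p \<Rightarrow> 'e \<Rightarrow> 'e) \<Rightarrow> bool" where
  "almost_eps_hermitian A k Q g \<epsilon> M Jeps \<longleftrightarrow>
     submanifold A k M \<and>
     (\<forall>p\<in>M. nondegenerate_on (g p) (tangent_space A M p)) \<and>
     (\<forall>p\<in>M. \<exists>U J. open U \<and> p \<in> U \<and> smooth_endo A U J \<and> (\<forall>q\<in>M \<inter> U. Jeps q = J q)) \<and>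
     (\<forall>p\<in>M. Jeps p \<in> Q p \<and> Jeps p ` tangent_space A M p = tangent_space A M p \<and>
        (\<forall>v. Jeps p (Jeps p v) = \<epsilon> *\<^sub>R v))"

definition adapted_sign :: "real \<Rightarrow> nat \<Rightarrow> real" where
  "adapted_sign \<epsilon> \<alpha> = (if \<alpha> = 1 then \<epsilon> else if \<alpha> = 2 then 1 else - \<epsilon>)"

definition adapted_basis ::
  "('p::topological_space, 'e::euclidean_space) chart set \<Rightarrow> ('p \<Rightarrow> ('e \<Rightarrow> 'e) set) \<Rightarrow> real \<Rightarrow>
   'p set \<Rightarrow> ('p \<Rightarrow> 'e \<Rightarrow> 'e) \<Rightarrow> 'p set \<Rightarrow> (nat \<Rightarrow> 'p \<Rightarrow> 'e \<Rightarrow> 'e) \<Rightarrow> bool" where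
  "adapted_basis A Q \<epsilon> M Jeps N J \<longleftrightarrow>
     open N \<and> M \<subseteq> N \<and> (\<forall>\<alpha>\<in>{1, 2, 3}. smooth_endo A N (J \<alpha>)) \<and>
     (\<forall>q\<in>N. pq_basis (Q q) (adapted_sign \<epsilon>) (\<lambda>\<alpha>. J \<alpha> q)) \<and>
     (\<forall>q\<in>M. J 1 q = Jeps q)"

definition totally_eps_complex ::
  "('p::topological_space, 'e::euclidean_space) chart set \<Rightarrow> ('p, 'e) metric \<Rightarrow> 'p set \<Rightarrow>
   (nat \<Rightarrow> 'p \<Rightarrow> 'e \<Rightarrow> 'e) \<Rightarrow> bool" where
  "totally_eps_complex A g M J \<longleftrightarrow>
     (\<forall>p\<in>M. \<forall>v\<in>tangent_space A M p. \<forall>w\<in>tangent_space A M p. g p (J 2 p v) w = 0)"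

text \<open>The 1-forms of \<open>D\<close> on \<open>Q\<close> with respect to the adapted basis \<open>J\<close> on \<open>N\<close>.\<close>

definition connection_forms ::
  "('p::topological_space, 'e::euclidean_space) chart set \<Rightarrow> ('p, 'e) connection \<Rightarrow> real \<Rightarrow>
   'p set \<Rightarrow> (nat \<Rightarrow> 'p \<Rightarrow> 'e \<Rightarrow> 'e) \<Rightarrow> (nat \<Rightarrow> 'p \<Rightarrow> 'e \<Rightarrow> real) \<Rightarrow> bool" where
  "connection_forms A D \<epsilon> N J \<omega> \<longleftrightarrow>
     (\<forall>(\<alpha>, \<beta>, \<gamma>)\<in>{(1, 2, 3), (2, 3, 1), (3, 1, 2)}. \<forall>p\<in>N. \<forall>x z.
        cov_deriv_endo A UNIV D (J \<alpha>) p x z =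
          - (adapted_sign \<epsilon> \<beta> * \<omega> \<gamma> p x) *\<^sub>R J \<beta> p z + (adapted_sign \<epsilon> \<gamma> * \<omega> \<beta> p x) *\<^sub>R J \<gamma> p z)"

definition tan_part ::
  "('p, 'e::euclidean_space) chart set \<Rightarrow> ('p, 'e) metric \<Rightarrow> 'p set \<Rightarrow> 'p \<Rightarrow> 'e \<Rightarrow> 'e" where
  "tan_part A g M p v =
     (THE u. u \<in> tangent_space A M p \<and> (\<forall>w\<in>tangent_space A M p. g p (v - u) w = 0))"

definition nor_part ::
  "('p, 'e::euclidean_space) chart set \<Rightarrow> ('p, 'e) metric \<Rightarrow> 'p set \<Rightarrow> 'p \<Rightarrow> 'e \<Rightarrow> 'e" where
  "nor_part A g M p v = v - tan_part A g M p v"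

text \<open>The derivative, in a direction \<open>x\<close> tangent to \<open>M\<close>, of a section \<open>\<xi>\<close> of the ambient tangent
  bundle along \<open>M\<close>, computed from any local extension of \<open>\<xi>\<close>.\<close>

definition along ::
  "('p::topological_space, 'e::euclidean_space) chart set \<Rightarrow> 'p set \<Rightarrow> ('p, 'e) connection \<Rightarrow>
   ('p, 'e) connection" where
  "along A M D p x \<xi> =
     D p x (SOME X. section_near A UNIV p X \<and> (\<exists>U. open U \<and> p \<in> U \<and> (\<forall>q\<in>M \<inter> U. X q = \<xi> q)))"

definition second_fundamental_form ::
  "('p::topological_space, 'e::euclidean_space) chart set \<Rightarrow> ('p, 'e) metric \<Rightarrow>
   ('p, 'e) connection \<Rightarrow> 'p set \<Rightarrow> 'p \<Rightarrow> 'e \<Rightarrow> 'e \<Rightarrow> 'e" where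
  "second_fundamental_form A g D M p x y = nor_part A g M p (along A M D p x (extend A M p y))"

definition normal_connection ::
  "('p::topological_space, 'e::euclidean_space) chart set \<Rightarrow> ('p, 'e) metric \<Rightarrow>
   ('p, 'e) connection \<Rightarrow> 'p set \<Rightarrow> ('p, 'e) connection" where
  "normal_connection A g D M p x \<xi> = nor_part A g M p (along A M D p x \<xi>)"

definition shape_tensor ::
  "('p::topological_space, 'e::euclidean_space) chart set \<Rightarrow> ('p, 'e) metric \<Rightarrow>
   ('p, 'e) connection \<Rightarrow> 'p set \<Rightarrow> (nat \<Rightarrow> 'p \<Rightarrow> 'e \<Rightarrow> 'e) \<Rightarrow> 'p \<Rightarrow> 'e \<Rightarrow> 'e \<Rightarrow> 'e" where
  "shape_tensor A g D M J p x y = J 2 p (second_fundamental_form A g D M p x y)"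

text \<open>The connection \<open>\<nabla>\<^sup>N = J\<^sub>2 \<circ> \<nabla>\<^sup>\<bottom> \<circ> J\<^sub>2\<close> on the tangent bundle of \<open>M\<close>.\<close>

definition N_connection ::
  "('p::topological_space, 'e::euclidean_space) chart set \<Rightarrow> ('p, 'e) metric \<Rightarrow>
   ('p, 'e) connection \<Rightarrow> 'p set \<Rightarrow> (nat \<Rightarrow> 'p \<Rightarrow> 'e \<Rightarrow> 'e) \<Rightarrow> ('p, 'e) connection" where
  "N_connection A g D M J p x Z = J 2 p (normal_connection A g D M p x (\<lambda>q. J 2 q (Z q)))"

text \<open>\<open>P\<^sub>x\<^sub>y z\<close>, where \<open>D\<close> is the Levi-Civita connection of \<open>M\<close> and \<open>C\<close> the shape tensor. Given
  \<open>\<nabla>J\<^sub>\<alpha> = - \<epsilon>\<^sub>\<beta> \<omega>\<^sub>\<gamma> \<otimes> J\<^sub>\<beta> + \<epsilon>\<^sub>\<gamma> \<omega>\<^sub>\<beta> \<otimes> J\<^sub>\<gamma>\<close>, one has \<open>\<nabla>\<^sup>N = \<nabla> - \<epsilon> \<omega> \<otimes> J\<^sub>1\<close> on the tangent bundle of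
  \<open>M\<close>. This fixes the sign of the second summand, which is printed as \<open>+\<close> in the source. Since \<open>C\<close>
  anticommutes with \<open>J\<^sub>1\<close>, the summand equals \<open>+ \<epsilon> \<omega>(x) C\<^sub>y \<circ> J\<^sub>1\<close>.\<close>

definition P_tensor ::
  "('p::topological_space, 'e::euclidean_space) chart set \<Rightarrow> ('p, 'e) connection \<Rightarrow> real \<Rightarrow>
   'p set \<Rightarrow> (nat \<Rightarrow> 'p \<Rightarrow> 'e \<Rightarrow> 'e) \<Rightarrow> (nat \<Rightarrow> 'p \<Rightarrow> 'e \<Rightarrow> real) \<Rightarrow> ('p \<Rightarrow> 'e \<Rightarrow> 'e \<Rightarrow> 'e) \<Rightarrow>
   'p \<Rightarrow> 'e \<Rightarrow> 'e \<Rightarrow> 'e \<Rightarrow> 'e" where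
  "P_tensor A D \<epsilon> M J \<omega> C p x y z =
     cov_deriv_bilinear A M D C p x y z - (\<epsilon> * \<omega> 1 p x) *\<^sub>R J 1 p (C p y z)"

text \<open>An endomorphism of \<open>T\<^sub>pM\<close> is represented by a function on all of \<open>'e\<close>, of which only the
  restriction to \<open>T\<^sub>pM\<close> matters.\<close>

definition S_J ::
  "('p, 'e::euclidean_space) chart set \<Rightarrow> ('p, 'e) metric \<Rightarrow> 'p set \<Rightarrow> ('p \<Rightarrow> 'e \<Rightarrow> 'e) \<Rightarrow>
   'p \<Rightarrow> ('e \<Rightarrow> 'e) set" where
  "S_J A g M Jeps p = {L. let T = tangent_space A M p in
     L ` T \<subseteq> T \<and>
     (\<forall>v\<in>T. \<forall>w\<in>T. \<forall>a b. L (a *\<^sub>R v + b *\<^sub>R w) = a *\<^sub>R L v + b *\<^sub>R L w) \<and>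
     (\<forall>v\<in>T. L (Jeps p v) + Jeps p (L v) = 0) \<and>
     (\<forall>v\<in>T. \<forall>w\<in>T. g p (L v) w = g p v (L w))}"

end

theory Submission
  imports Defs
begin

text \<open>
  Along \<open>M\<close> the ambient tangent bundle splits as \<open>T \<oplus> J\<^sub>2 T\<close>: total complexity makes \<open>J\<^sub>2 T\<close> orthogonal
  to \<open>T\<close>, and maximality makes it the whole normal space (\<open>decomposition\<close>). Identifying the normal bundle
  with \<open>T\<close> by \<open>J\<^sub>2\<close>, the ambient connection becomes a block matrix (\<open>along_split\<close>). Its diagonal consists
  of the Levi-Civita connection \<open>D\<close> of \<open>M\<close> and of the transported normal connection \<open>DN\<close>, and both
  off-diagonal entries are the shape tensor \<open>C\<close>. The three equations are the blocks of the curvature of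
  such a matrix: the diagonal blocks are the curvatures of \<open>D\<close> and \<open>DN\<close>, each increased by \<open>[C\<^sub>X, C\<^sub>Y]\<close>,
  and the off-diagonal block is the alternation of the derivative of \<open>C\<close> formed with \<open>D\<close> on the arguments
  and \<open>DN\<close> on the values (\<open>curvature_tangent_section\<close>, \<open>curvature_normal_section\<close>).

  To identify the entries one needs that only \<open>\<omega> = \<omega>\<^sub>1\<close> survives on \<open>M\<close>. Differentiating
  \<open>g (J\<^sub>2 Y) Z = 0\<close> shows that the trilinear form \<open>g (C\<^sub>X Y) Z\<close>, symmetric in \<open>X\<close> and \<open>Y\<close>, fails to be totally
  symmetric by \<open>\<omega>\<^sub>3 \<otimes> F\<close>, with \<open>F\<close> the fundamental 2-form. This forces \<open>\<omega>\<^sub>3 \<and> F = 0\<close>, hence \<open>\<omega>\<^sub>3 = 0\<close> if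
  \<open>dim M > 2\<close> (\<open>symmetry_defect_vanishes\<close>); the same argument with \<open>J\<^sub>1 C\<close> gives \<open>\<omega>\<^sub>2 = 0\<close>. Then \<open>J\<^sub>1\<close> is
  parallel on \<open>M\<close>, \<open>C\<^sub>X\<close> is self-adjoint and anticommutes with \<open>J\<^sub>1\<close>, and \<open>DN = D - \<epsilon> \<omega> \<otimes> J\<^sub>1\<close>
  (\<open>normal_derivative\<close>). Consequently the derivative of \<open>C\<close> above is the tensor \<open>P\<close>, which has its values in
  \<open>S\<^sub>J\<close>, and the curvatures of \<open>DN\<close> and \<open>D\<close> differ by \<open>\<epsilon> d\<omega> \<otimes> J\<^sub>1\<close> (\<open>normal_riemann_eq\<close>).

  The tensors in the statement are evaluated on arbitrarily chosen local extensions of vectors, and their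
  independence of the choice has to be proved. Local frames are avoided: by metric compatibility,
  \<open>g (D\<^sub>v Y) Z = v (g Y Z) - g Y (D\<^sub>v Z)\<close>, a derivative paired with \<open>Z\<close> is expressed through values of \<open>Y\<close>, and
  the metric is non-degenerate. This gives locality of the connections, the well-defined derivative along \<open>M\<close>
  (\<open>along_eq\<close>), and the tensor property of covariant derivatives of endomorphisms and, using the pair
  symmetry, of the curvature (\<open>riemann_tensorial\<close>). Likewise Lie brackets are handled only through their
  action on functions and the vanishing of the torsion (\<open>lie_bracket_eq\<close>, \<open>along_bracket\<close>).
\<close>

section \<open>Smooth maps between Euclidean spaces\<close>

lemma differentiable_cong_open:
  assumes "open U" "x \<in> U" "\<And>x. x \<in> U \<Longrightarrow> f x = g x" "f differentiable (at x)"
  shows "g differentiable (at x)" "frechet_derivative f (at x) = frechet_derivative g (at x)"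
proof -
  have f: "(f has_derivative frechet_derivative f (at x)) (at x)"
    using assms(4) frechet_derivative_works by blast
  then have g: "(g has_derivative frechet_derivative f (at x)) (at x)"
    using assms has_derivative_transform_within_open by blast
  show "g differentiable (at x)" using g differentiable_def by blast
  show "frechet_derivative f (at x) = frechet_derivative g (at x)"
    using g by (rule frechet_derivative_at)
qed

lemma k_times_cong:
  assumes "open U" "\<And>x. x \<in> U \<Longrightarrow> f x = g x" "k_times_differentiable_on k U f"
  shows "k_times_differentiable_on k U g"
  using assms(2,3)
proof (induction k arbitrary: f g)
  case 0
  then show ?case by (metis continuous_on_cong k_times_differentiable_on.simps(1))
next
  case (Suc k)
  have d: "f differentiable (at x)" if "x \<in> U" for x using Suc.prems that by simp
  have "k_times_differentiable_on k U (\<lambda>x. frechet_derivative g (at x) v)" for v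
  proof (rule Suc.IH)
    show "k_times_differentiable_on k U (\<lambda>x. frechet_derivative f (at x) v)"
      using Suc.prems by simp
    show "frechet_derivative f (at x) v = frechet_derivative g (at x) v" if "x \<in> U" for x
      using differentiable_cong_open(2)[OF \<open>open U\<close> that Suc.prems(1) d[OF that]] by simp
  qed
  then show ?case
    using differentiable_cong_open(1)[OF \<open>open U\<close> _ Suc.prems(1) d] by simp
qed

lemma k_times_subset:
  "k_times_differentiable_on k U f \<Longrightarrow> V \<subseteq> U \<Longrightarrow> k_times_differentiable_on k V f"
  by (induction k arbitrary: f) (auto intro: continuous_on_subset)

lemma k_times_Suc_imp:
  "k_times_differentiable_on (Suc k) U f \<Longrightarrow> k_times_differentiable_on k U f"
proof (induction k arbitrary: f)
  case 0
  then show ?case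
    unfolding k_times_differentiable_on.simps
    by (blast intro: differentiable_imp_continuous_within continuous_at_imp_continuous_on)
next
  case (Suc k)
  show ?case unfolding k_times_differentiable_on.simps(2)[of k]
    using Suc.prems Suc.IH by (subst (asm) k_times_differentiable_on.simps(2)) blast
qed

text \<open>The closure properties below are proved by induction on the order of differentiability: a
  derivative of a composite is again composed, by operations already treated, of the given
  functions and of their derivatives, to which the induction hypothesis applies.\<close>

lemma k_times_SucI:
  assumes "open U" "\<And>x. x \<in> U \<Longrightarrow> (f has_derivative f' x) (at x)"
    "\<And>v. k_times_differentiable_on k U (\<lambda>x. f' x v)"
  shows "k_times_differentiable_on (Suc k) U f"
proof -
  have "frechet_derivative f (at x) = f' x" if "x \<in> U" for x
    using assms(2)[OF that] frechet_derivative_at by metis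
  then have "k_times_differentiable_on k U (\<lambda>x. frechet_derivative f (at x) v)" for v
    using k_times_cong[OF assms(1) _ assms(3)] by simp
  then show ?thesis using assms(2) differentiable_def by fastforce
qed

lemma k_times_SucD:
  assumes "k_times_differentiable_on (Suc k) U f"
  shows "x \<in> U \<Longrightarrow> (f has_derivative frechet_derivative f (at x)) (at x)"
    "k_times_differentiable_on k U (\<lambda>x. frechet_derivative f (at x) v)"
  using assms frechet_derivative_works by auto

lemma k_times_const: "open U \<Longrightarrow> k_times_differentiable_on k U (\<lambda>x. c)"
proof (induction k arbitrary: c)
  case (Suc k)
  show ?case by (rule k_times_SucI[where f' = "\<lambda>x v. 0"]) (auto intro: Suc)
qed simp

lemma k_times_linear:
  assumes "open U" "bounded_linear L"
  shows "k_times_differentiable_on k U L"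
proof (cases k)
  case 0
  then show ?thesis using assms by (simp add: linear_continuous_on)
next
  case (Suc k)
  show ?thesis unfolding Suc
    by (rule k_times_SucI[where f' = "\<lambda>x. L"])
      (auto intro: assms k_times_const bounded_linear_imp_has_derivative)
qed

lemma k_times_add:
  assumes "open U" "k_times_differentiable_on k U f" "k_times_differentiable_on k U g"
  shows "k_times_differentiable_on k U (\<lambda>x. f x + g x)"
  using assms(2,3)
proof (induction k arbitrary: f g)
  case 0
  then show ?case by (simp add: continuous_on_add)
next
  case (Suc k)
  show ?case
    by (rule k_times_SucI[OF assms(1) has_derivative_add[OF k_times_SucD(1)[OF Suc.prems(1)] k_times_SucD(1)[OF Suc.prems(2)]]])
      (assumption | rule Suc.IH[OF k_times_SucD(2)[OF Suc.prems(1)] k_times_SucD(2)[OF Suc.prems(2)]])+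
qed

lemma k_times_bilinear:
  assumes "bounded_bilinear p" "open U"
    "k_times_differentiable_on k U f" "k_times_differentiable_on k U g"
  shows "k_times_differentiable_on k U (\<lambda>x. p (f x) (g x))"
  using assms(3,4)
proof (induction k arbitrary: f g)
  case 0
  then show ?case by (simp add: bounded_bilinear.continuous_on[OF assms(1)])
next
  case (Suc k)
  show ?case
    by (rule k_times_SucI[OF assms(2) bounded_bilinear.FDERIV[OF assms(1) k_times_SucD(1)[OF Suc.prems(1)] k_times_SucD(1)[OF Suc.prems(2)]]])
      (assumption | rule k_times_add[OF assms(2)
         Suc.IH[OF k_times_Suc_imp[OF Suc.prems(1)] k_times_SucD(2)[OF Suc.prems(2)]]
         Suc.IH[OF k_times_SucD(2)[OF Suc.prems(1)] k_times_Suc_imp[OF Suc.prems(2)]]])+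
qed

lemma k_times_sum:
  assumes "open U" "\<And>i. i \<in> I \<Longrightarrow> k_times_differentiable_on k U (f i)"
  shows "k_times_differentiable_on k U (\<lambda>x. \<Sum>i\<in>I. f i x)"
  using assms(2)
  by (induction I rule: infinite_finite_induct) (auto intro: k_times_add k_times_const assms(1))

lemma linear_basis_expansion:
  fixes f' :: "'a::euclidean_space \<Rightarrow> 'b::real_normed_vector"
  assumes "linear f'"
  shows "f' v = (\<Sum>b\<in>Basis. (v \<bullet> b) *\<^sub>R f' b)"
proof -
  have "f' v = f' (\<Sum>b\<in>Basis. (v \<bullet> b) *\<^sub>R b)" by (simp add: euclidean_representation)
  also have "\<dots> = (\<Sum>b\<in>Basis. (v \<bullet> b) *\<^sub>R f' b)"
    by (simp add: linear_sum[OF assms] linear_cmul[OF assms])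
  finally show ?thesis .
qed

text \<open>The recursion controls derivatives in fixed directions only, whereas the chain rule yields the
  derivative of \<open>f\<close> in the varying direction \<open>t' v\<close>. Expanding that direction in the standard basis
  gives a finite sum to which the induction hypothesis applies.\<close>

lemma k_times_compose:
  fixes t :: "'a::real_normed_vector \<Rightarrow> 'b::euclidean_space"
  assumes "open U" "open V" "t ` U \<subseteq> V"
    "k_times_differentiable_on k U t" "k_times_differentiable_on k V f"
  shows "k_times_differentiable_on k U (\<lambda>x. f (t x))"
  using assms(4,5)
proof (induction k arbitrary: f)
  case 0
  show ?case
    using continuous_on_compose2[OF _ _ assms(3), of f] 0 unfolding k_times_differentiable_on.simps
    by blast
next
  case (Suc k)
  note t = k_times_SucD[OF Suc.prems(1)] and f = k_times_SucD[OF Suc.prems(2)]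
  have d: "((\<lambda>x. f (t x)) has_derivative
      (\<lambda>v. \<Sum>b\<in>Basis. (frechet_derivative t (at x) v \<bullet> b) *\<^sub>R frechet_derivative f (at (t x)) b)) (at x)"
    if "x \<in> U" for x
  proof -
    have tx: "t x \<in> V" using that assms(3) by blast
    have eq: "(\<lambda>v. frechet_derivative f (at (t x)) (frechet_derivative t (at x) v)) =
        (\<lambda>v. \<Sum>b\<in>Basis. (frechet_derivative t (at x) v \<bullet> b) *\<^sub>R frechet_derivative f (at (t x)) b)"
      by (rule ext) (rule linear_basis_expansion[OF has_derivative_linear[OF f(1)[OF tx]]])
    show ?thesis
      using has_derivative_compose[OF t(1)[OF that] f(1)[OF tx]] unfolding eq .
  qed
  show ?case
  proof (rule k_times_SucI[OF assms(1) d])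
    fix v
    show "k_times_differentiable_on k U (\<lambda>x. \<Sum>b\<in>Basis.
      (frechet_derivative t (at x) v \<bullet> b) *\<^sub>R frechet_derivative f (at (t x)) b)"
    proof (rule k_times_sum[OF assms(1)])
      fix b :: 'b
      have "k_times_differentiable_on k U (\<lambda>x. frechet_derivative f (at (t x)) b)"
        using Suc.IH[OF k_times_Suc_imp[OF Suc.prems(1)] f(2)] .
      moreover have "k_times_differentiable_on k U (\<lambda>x. frechet_derivative t (at x) v \<bullet> b)"
        using k_times_bilinear[OF bounded_bilinear_inner assms(1) t(2) k_times_const[OF assms(1)]] .
      ultimately show "k_times_differentiable_on k U (\<lambda>x.
        (frechet_derivative t (at x) v \<bullet> b) *\<^sub>R frechet_derivative f (at (t x)) b)"
        using k_times_bilinear[OF bounded_bilinear_scaleR assms(1)] by blast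
    qed
  qed
qed

lemma k_times_inverse:
  fixes f :: "'a::real_normed_vector \<Rightarrow> real"
  assumes "open U" "\<And>x. x \<in> U \<Longrightarrow> f x \<noteq> 0" "k_times_differentiable_on k U f"
  shows "k_times_differentiable_on k U (\<lambda>x. inverse (f x))"
  using assms(3)
proof (induction k)
  case 0
  then show ?case using assms(2) by (simp add: continuous_on_inverse)
next
  case (Suc k)
  note f = k_times_SucD[OF Suc.prems]
  note IH = Suc.IH[OF k_times_Suc_imp[OF Suc.prems]]
  note m = k_times_bilinear[OF bounded_bilinear_mult assms(1)]
  show ?case
  proof (rule k_times_SucI[OF assms(1) Deriv.has_derivative_inverse[OF assms(2) f(1)]])
    fix v
    have "k_times_differentiable_on k U
        (\<lambda>x. (-1) * (inverse (f x) * frechet_derivative f (at x) v * inverse (f x)))"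
      by (intro m k_times_const IH f(2) assms(1))
    then show "k_times_differentiable_on k U
        (\<lambda>x. - (inverse (f x) * frechet_derivative f (at x) v * inverse (f x)))"
      by simp
  qed auto
qed

lemma smooth_on_cong:
  "smooth_on U f \<Longrightarrow> open U \<Longrightarrow> (\<And>x. x \<in> U \<Longrightarrow> f x = g x) \<Longrightarrow> smooth_on U g"
  unfolding smooth_on_def using k_times_cong by metis

lemma smooth_on_subset: "smooth_on U f \<Longrightarrow> V \<subseteq> U \<Longrightarrow> smooth_on V f"
  unfolding smooth_on_def using k_times_subset by blast

lemma smooth_on_const: "open U \<Longrightarrow> smooth_on U (\<lambda>x. c)"
  unfolding smooth_on_def using k_times_const by blast

lemma smooth_on_linear: "open U \<Longrightarrow> bounded_linear L \<Longrightarrow> smooth_on U L"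
  unfolding smooth_on_def using k_times_linear by blast

lemma smooth_on_add:
  "open U \<Longrightarrow> smooth_on U f \<Longrightarrow> smooth_on U g \<Longrightarrow> smooth_on U (\<lambda>x. f x + g x)"
  unfolding smooth_on_def using k_times_add by blast

lemma smooth_on_mult:
  fixes f g :: "'a::real_normed_vector \<Rightarrow> real"
  shows "open U \<Longrightarrow> smooth_on U f \<Longrightarrow> smooth_on U g \<Longrightarrow> smooth_on U (\<lambda>x. f x * g x)"
  unfolding smooth_on_def using k_times_bilinear[OF bounded_bilinear_mult] by blast

lemma smooth_on_scaleR:
  "open U \<Longrightarrow> smooth_on U f \<Longrightarrow> smooth_on U g \<Longrightarrow> smooth_on U (\<lambda>x. f x *\<^sub>R g x)"
  unfolding smooth_on_def using k_times_bilinear[OF bounded_bilinear_scaleR] by blast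

lemma smooth_on_compose:
  fixes t :: "'a::real_normed_vector \<Rightarrow> 'b::euclidean_space"
  shows "open U \<Longrightarrow> open V \<Longrightarrow> t ` U \<subseteq> V \<Longrightarrow> smooth_on U t \<Longrightarrow> smooth_on V f \<Longrightarrow>
    smooth_on U (\<lambda>x. f (t x))"
  unfolding smooth_on_def using k_times_compose by blast

lemma smooth_on_inverse:
  fixes f :: "'a::real_normed_vector \<Rightarrow> real"
  shows "open U \<Longrightarrow> (\<And>x. x \<in> U \<Longrightarrow> f x \<noteq> 0) \<Longrightarrow> smooth_on U f \<Longrightarrow> smooth_on U (\<lambda>x. inverse (f x))"
  unfolding smooth_on_def using k_times_inverse by blast

lemma smooth_on_has_derivative:
  "smooth_on U f \<Longrightarrow> x \<in> U \<Longrightarrow> (f has_derivative frechet_derivative f (at x)) (at x)"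
  unfolding smooth_on_def using k_times_SucD(1) by blast

lemma smooth_on_continuous: "smooth_on U f \<Longrightarrow> continuous_on U f"
  unfolding smooth_on_def using k_times_differentiable_on.simps(1) by blast

lemma smooth_on_frechet_derivative:
  fixes f :: "'a::euclidean_space \<Rightarrow> 'b::real_normed_vector" and v :: "'a \<Rightarrow> 'a"
  assumes "open U" "smooth_on U f" "smooth_on U v"
  shows "smooth_on U (\<lambda>x. frechet_derivative f (at x) (v x))"
proof -
  have "k_times_differentiable_on k U (\<lambda>x. frechet_derivative f (at x) (v x))" for k
  proof (rule k_times_cong[OF assms(1)])
    have b: "k_times_differentiable_on k U (\<lambda>x. frechet_derivative f (at x) b)" for b
      using assms(2) k_times_SucD(2) unfolding smooth_on_def by blast
    have "k_times_differentiable_on k U v" using assms(3) unfolding smooth_on_def by blast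
    then have "k_times_differentiable_on k U (\<lambda>x. v x \<bullet> b)" for b
      using k_times_bilinear[OF bounded_bilinear_inner assms(1) _ k_times_const[OF assms(1)]] by blast
    then show "k_times_differentiable_on k U
        (\<lambda>x. \<Sum>b\<in>Basis. (v x \<bullet> b) *\<^sub>R frechet_derivative f (at x) b)"
      by (intro k_times_sum[OF assms(1)] k_times_bilinear[OF bounded_bilinear_scaleR assms(1)] b)
    show "(\<Sum>b\<in>Basis. (v x \<bullet> b) *\<^sub>R frechet_derivative f (at x) b) = frechet_derivative f (at x) (v x)"
      if "x \<in> U" for x
      using linear_basis_expansion[OF has_derivative_linear[OF smooth_on_has_derivative[OF assms(2) that]]]
      by (rule sym)
  qed
  then show ?thesis unfolding smooth_on_def by blast
qed

section \<open>Charts and change of coordinates\<close>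

abbreviation chart_inv :: "('p, 'e) chart \<Rightarrow> 'e \<Rightarrow> 'p" where
  "chart_inv c \<equiv> inv_into (fst c) (snd c)"

text \<open>Tangent vectors transform between charts by the derivative of the transition map.\<close>

definition transition_deriv :: "('p, 'e::euclidean_space) chart \<Rightarrow> ('p, 'e) chart \<Rightarrow> 'p \<Rightarrow> 'e \<Rightarrow> 'e" where
  "transition_deriv c d q = frechet_derivative (transition c d) (at (snd c q))"

lemma chart_inv_left: "is_chart c \<Longrightarrow> q \<in> fst c \<Longrightarrow> chart_inv c (snd c q) = q"
  unfolding is_chart_def homeomorphism_def by blast

lemma chart_inv_right:
  assumes "is_chart c" "x \<in> snd c ` fst c"
  shows "chart_inv c x \<in> fst c" "snd c (chart_inv c x) = x"
  using assms unfolding is_chart_def homeomorphism_def by blast+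

lemma chart_open_image:
  assumes "is_chart c" "open W"
  shows "open (snd c ` (fst c \<inter> W))"
proof -
  have "continuous_on (snd c ` fst c) (chart_inv c)" "open (snd c ` fst c)"
    using assms(1) unfolding is_chart_def homeomorphism_def by blast+
  then have "open (snd c ` fst c \<inter> chart_inv c -` W)"
    using continuous_open_preimage assms(2) by blast
  moreover have "snd c ` fst c \<inter> chart_inv c -` W = snd c ` (fst c \<inter> W)"
    using chart_inv_left[OF assms(1)] chart_inv_right[OF assms(1)] by force
  ultimately show ?thesis by simp
qed

lemma chart_mem_image:
  assumes "is_chart c" "q \<in> fst c" "snd c q \<in> snd c ` (fst c \<inter> W)"
  shows "q \<in> W"
proof -
  from assms(3) obtain r where r: "r \<in> fst c" "r \<in> W" "snd c q = snd c r" by blast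
  then have "q = r" using chart_inv_left[OF assms(1,2)] chart_inv_left[OF assms(1) r(1)] by metis
  then show ?thesis using r(2) by simp
qed

lemma chart_inv_image:
  assumes "is_chart c" "x \<in> snd c ` (fst c \<inter> W)"
  shows "chart_inv c x \<in> fst c" "chart_inv c x \<in> W" "snd c (chart_inv c x) = x"
proof -
  from assms(2) obtain q where q: "q \<in> fst c" "q \<in> W" "x = snd c q" by blast
  then have "chart_inv c x = q" using chart_inv_left[OF assms(1)] by simp
  then show "chart_inv c x \<in> fst c" "chart_inv c x \<in> W" "snd c (chart_inv c x) = x"
    using q by auto
qed

lemma transition_apply: "is_chart c \<Longrightarrow> q \<in> fst c \<Longrightarrow> transition c d (snd c q) = snd d q"
  unfolding transition_def by (simp add: chart_inv_left)

definition smooth_pair ::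
  "('p::topological_space, 'e::euclidean_space) chart \<Rightarrow> ('p, 'e) chart \<Rightarrow> bool" where
  "smooth_pair c d \<longleftrightarrow> is_chart c \<and> is_chart d \<and> compatible c d"

lemma smooth_pair_sym: "smooth_pair c d \<Longrightarrow> smooth_pair d c"
  unfolding smooth_pair_def compatible_def by (simp add: Int_commute)

lemma smooth_pair_transition:
  "smooth_pair c d \<Longrightarrow> smooth_on (snd c ` (fst c \<inter> fst d)) (transition c d)"
  unfolding smooth_pair_def compatible_def by simp

lemma transition_deriv_has_derivative:
  assumes "smooth_pair c d" "q \<in> fst c" "q \<in> fst d"
  shows "(transition c d has_derivative transition_deriv c d q) (at (snd c q))"
  unfolding transition_deriv_def
  using smooth_on_has_derivative[OF smooth_pair_transition[OF assms(1)]] assms(2,3) by blast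

lemma transition_deriv_linear:
  assumes "smooth_pair c d" "q \<in> fst c" "q \<in> fst d"
  shows "linear (transition_deriv c d q)"
  using has_derivative_linear[OF transition_deriv_has_derivative[OF assms]] .

lemma transition_deriv_cocycle:
  assumes cd: "smooth_pair c d" and de: "smooth_pair d e"
    and q: "q \<in> fst c" "q \<in> fst d" "q \<in> fst e"
  shows "transition_deriv d e q (transition_deriv c d q v) = transition_deriv c e q v"
proof -
  have c: "is_chart c" and d: "is_chart d" and e: "is_chart e"
    using cd de unfolding smooth_pair_def by auto
  have dq: "transition c d (snd c q) = snd d q" using transition_apply[OF c q(1)] .
  have "((\<lambda>x. transition d e (transition c d x)) has_derivative
      (\<lambda>v. transition_deriv d e q (transition_deriv c d q v))) (at (snd c q))"
    using has_derivative_compose[OF transition_deriv_has_derivative[OF cd q(1,2)]]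
      transition_deriv_has_derivative[OF de q(2,3)] dq by metis
  then have "(transition c e has_derivative (\<lambda>v. transition_deriv d e q (transition_deriv c d q v))) (at (snd c q))"
  proof (rule has_derivative_transform_within_open)
    have "open (fst d)" using d unfolding is_chart_def by simp
    then show "open (snd c ` (fst c \<inter> fst d))" by (rule chart_open_image[OF c])
    show "snd c q \<in> snd c ` (fst c \<inter> fst d)" using q by blast
    show "transition d e (transition c d x) = transition c e x"
      if "x \<in> snd c ` (fst c \<inter> fst d)" for x
      using that c d by (auto simp: transition_apply)
  qed
  then have "(\<lambda>v. transition_deriv d e q (transition_deriv c d q v)) = transition_deriv c e q"
    unfolding transition_deriv_def[of c e] by (rule frechet_derivative_at)
  then show ?thesis by metis
qed

lemma transition_deriv_id:
  assumes "is_chart c" "q \<in> fst c"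
  shows "transition_deriv c c q v = v"
proof -
  have "((\<lambda>x. x) has_derivative (\<lambda>v. v)) (at (snd c q))" by simp
  then have "(transition c c has_derivative (\<lambda>v. v)) (at (snd c q))"
  proof (rule has_derivative_transform_within_open)
    show "open (snd c ` fst c)" using assms(1) unfolding is_chart_def by blast
    show "snd c q \<in> snd c ` fst c" using assms(2) by blast
    show "x = transition c c x" if "x \<in> snd c ` fst c" for x
      using that by (auto simp: transition_apply[OF assms(1)])
  qed
  then have "(\<lambda>v. v) = transition_deriv c c q"
    unfolding transition_deriv_def by (rule frechet_derivative_at)
  then show ?thesis by metis
qed

text \<open>The charts adapted to a submanifold are compatible with the atlas, but need not belong to it.\<close>

definition admissible ::
  "('p::topological_space, 'e::euclidean_space) chart set \<Rightarrow> ('p, 'e) chart \<Rightarrow> bool" where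
  "admissible A c \<longleftrightarrow> (\<forall>d\<in>A. smooth_pair c d)"

text \<open>Tangent vectors are identified with their components in the preferred chart, hence this is the
  derivative of \<open>F\<close> in that chart.\<close>

definition differential ::
  "('p, 'e::euclidean_space) chart set \<Rightarrow> ('p \<Rightarrow> real) \<Rightarrow> 'p \<Rightarrow> 'e \<Rightarrow> real" where
  "differential A F q =
     frechet_derivative (\<lambda>x. F (chart_inv (chart_at A q) x)) (at (snd (chart_at A q) q))"

lemma components_eq: "components A c q v = transition_deriv (chart_at A q) c q v"
  unfolding components_def transition_deriv_def by simp

locale smooth_manifold =
  fixes A :: "('p::topological_space, 'e::euclidean_space) chart set"
  assumes atlas: "smooth_atlas A"
begin

lemma atlas_pair: "c \<in> A \<Longrightarrow> d \<in> A \<Longrightarrow> smooth_pair c d"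
  using atlas unfolding smooth_atlas_def smooth_pair_def by blast

lemma atlas_admissible: "c \<in> A \<Longrightarrow> admissible A c"
  unfolding admissible_def using atlas_pair by blast

lemma chart_at: "chart_at A p \<in> A" "p \<in> fst (chart_at A p)"
proof -
  have "\<exists>c. c \<in> A \<and> p \<in> fst c" using atlas unfolding smooth_atlas_def by blast
  then have "chart_at A p \<in> A \<and> p \<in> fst (chart_at A p)"
    unfolding chart_at_def by (rule someI_ex)
  then show "chart_at A p \<in> A" "p \<in> fst (chart_at A p)" by auto
qed

lemma admissible_pair:
  "admissible A c \<Longrightarrow> smooth_pair c (chart_at A p)" "admissible A c \<Longrightarrow> smooth_pair (chart_at A p) c"
  unfolding admissible_def using chart_at(1) smooth_pair_sym by blast+

lemma admissible_chart: "admissible A c \<Longrightarrow> is_chart c"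
  using admissible_pair(1) unfolding smooth_pair_def by blast

lemma atlas_chart: "c \<in> A \<Longrightarrow> is_chart c"
  using atlas_pair unfolding smooth_pair_def by blast

lemma components_linear: "c \<in> A \<Longrightarrow> q \<in> fst c \<Longrightarrow> linear (components A c q)"
  using transition_deriv_linear[OF atlas_pair[OF chart_at(1)] chart_at(2)]
  unfolding components_eq[abs_def] by blast

lemma smooth_function_in_chart:
  assumes "smooth_function A U F" "c \<in> A"
  shows "smooth_on (snd c ` (fst c \<inter> U)) (\<lambda>x. F (chart_inv c x))"
  using assms unfolding smooth_function_def by blast

lemma smooth_field_in_chart:
  assumes "smooth_field A U X" "c \<in> A"
  shows "smooth_on (snd c ` (fst c \<inter> U)) (\<lambda>x. components A c (chart_inv c x) (X (chart_inv c x)))"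
  using assms unfolding smooth_field_def Let_def by blast

lemma smooth_functionI:
  assumes "\<And>c. c \<in> A \<Longrightarrow> smooth_on (snd c ` (fst c \<inter> U)) (\<lambda>x. F (chart_inv c x))"
  shows "smooth_function A U F"
  using assms unfolding smooth_function_def by blast

lemma smooth_fieldI:
  assumes "\<And>c. c \<in> A \<Longrightarrow>
    smooth_on (snd c ` (fst c \<inter> U)) (\<lambda>x. components A c (chart_inv c x) (X (chart_inv c x)))"
  shows "smooth_field A U X"
  using assms unfolding smooth_field_def Let_def by blast

lemma smooth_function_subset: "smooth_function A U F \<Longrightarrow> V \<subseteq> U \<Longrightarrow> smooth_function A V F"
  unfolding smooth_function_def
  by (intro ballI, erule ballE, erule smooth_on_subset) auto

lemma smooth_field_subset: "smooth_field A U X \<Longrightarrow> V \<subseteq> U \<Longrightarrow> smooth_field A V X"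
  unfolding smooth_field_def
  by (intro ballI, erule ballE, erule smooth_on_subset) auto

lemma smooth_function_const: "open U \<Longrightarrow> smooth_function A U (\<lambda>q. a)"
  by (rule smooth_functionI, rule smooth_on_const, rule chart_open_image, rule atlas_chart)

lemma smooth_function_add:
  "open U \<Longrightarrow> smooth_function A U F \<Longrightarrow> smooth_function A U G \<Longrightarrow> smooth_function A U (\<lambda>q. F q + G q)"
  by (rule smooth_functionI, rule smooth_on_add)
    (assumption | rule chart_open_image atlas_chart smooth_function_in_chart)+

lemma smooth_function_mult:
  "open U \<Longrightarrow> smooth_function A U F \<Longrightarrow> smooth_function A U G \<Longrightarrow> smooth_function A U (\<lambda>q. F q * G q)"
  by (rule smooth_functionI, rule smooth_on_mult)
    (assumption | rule chart_open_image atlas_chart smooth_function_in_chart)+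

lemma smooth_function_inverse:
  assumes "open U" "smooth_function A U F" "\<And>q. q \<in> U \<Longrightarrow> F q \<noteq> 0"
  shows "smooth_function A U (\<lambda>q. inverse (F q))"
proof (rule smooth_functionI)
  fix c assume c: "c \<in> A"
  show "smooth_on (snd c ` (fst c \<inter> U)) (\<lambda>x. inverse (F (chart_inv c x)))"
    using chart_inv_image(2)[OF atlas_chart[OF c]] assms(3)
    by (intro smooth_on_inverse chart_open_image[OF atlas_chart[OF c]] assms(1)
        smooth_function_in_chart[OF assms(2) c]) blast
qed

lemma smooth_field_add:
  assumes "open U" "smooth_field A U X" "smooth_field A U Y"
  shows "smooth_field A U (\<lambda>q. X q + Y q)"
proof (rule smooth_fieldI)
  fix c assume c: "c \<in> A"
  note o = chart_open_image[OF atlas_chart[OF c] assms(1)]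
  show "smooth_on (snd c ` (fst c \<inter> U))
      (\<lambda>x. components A c (chart_inv c x) (X (chart_inv c x) + Y (chart_inv c x)))"
    using smooth_on_add[OF o smooth_field_in_chart[OF assms(2) c] smooth_field_in_chart[OF assms(3) c]] o
    by (rule smooth_on_cong)
      (simp add: linear_add[OF components_linear[OF c]] chart_inv_image(1)[OF atlas_chart[OF c]])
qed

lemma smooth_field_scaleR:
  assumes "open U" "smooth_function A U F" "smooth_field A U Y"
  shows "smooth_field A U (\<lambda>q. F q *\<^sub>R Y q)"
proof (rule smooth_fieldI)
  fix c assume c: "c \<in> A"
  note o = chart_open_image[OF atlas_chart[OF c] assms(1)]
  show "smooth_on (snd c ` (fst c \<inter> U))
      (\<lambda>x. components A c (chart_inv c x) (F (chart_inv c x) *\<^sub>R Y (chart_inv c x)))"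
    using smooth_on_scaleR[OF o smooth_function_in_chart[OF assms(2) c] smooth_field_in_chart[OF assms(3) c]] o
    by (rule smooth_on_cong)
      (simp add: linear_cmul[OF components_linear[OF c]] chart_inv_image(1)[OF atlas_chart[OF c]])
qed

lemma transition_maps:
  assumes "smooth_pair d c" "open U"
  shows "transition d c ` (snd d ` (fst d \<inter> (fst c \<inter> U))) \<subseteq> snd c ` (fst c \<inter> (fst d \<inter> U))"
    "smooth_on (snd d ` (fst d \<inter> (fst c \<inter> U))) (transition d c)"
    "open (snd d ` (fst d \<inter> (fst c \<inter> U)))" "open (snd c ` (fst c \<inter> (fst d \<inter> U)))"
proof -
  have d: "is_chart d" "is_chart c" using assms(1) unfolding smooth_pair_def by auto
  then have o: "open (fst d)" "open (fst c)" unfolding is_chart_def by auto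
  show "transition d c ` (snd d ` (fst d \<inter> (fst c \<inter> U))) \<subseteq> snd c ` (fst c \<inter> (fst d \<inter> U))"
    by (auto simp: transition_apply[OF d(1)])
  show "smooth_on (snd d ` (fst d \<inter> (fst c \<inter> U))) (transition d c)"
    by (rule smooth_on_subset[OF smooth_pair_transition[OF assms(1)]]) auto
  show "open (snd d ` (fst d \<inter> (fst c \<inter> U)))"
    using chart_open_image[OF d(1)] o(2) assms(2) by blast
  show "open (snd c ` (fst c \<inter> (fst d \<inter> U)))"
    using chart_open_image[OF d(2)] o(1) assms(2) by blast
qed

text \<open>As transition maps are smooth, a single chart containing the domain suffices to check smoothness.\<close>

lemma smooth_function_from_chart:
  assumes c: "admissible A c" and U: "open U" "U \<subseteq> fst c"
    and F: "smooth_on (snd c ` U) (\<lambda>x. F (chart_inv c x))"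
  shows "smooth_function A U F"
proof (rule smooth_functionI)
  fix d assume d: "d \<in> A"
  have dc: "smooth_pair d c" using c d smooth_pair_sym unfolding admissible_def by blast
  note t = transition_maps[OF dc U(1)]
  have ch: "is_chart d" "is_chart c" using dc unfolding smooth_pair_def by auto
  have "smooth_on (snd c ` (fst c \<inter> (fst d \<inter> U))) (\<lambda>x. F (chart_inv c x))"
    by (rule smooth_on_subset[OF F]) auto
  then have "smooth_on (snd d ` (fst d \<inter> (fst c \<inter> U))) (\<lambda>x. F (chart_inv c (transition d c x)))"
    using smooth_on_compose[OF t(3,4,1,2)] by blast
  then have "smooth_on (snd d ` (fst d \<inter> (fst c \<inter> U))) (\<lambda>x. F (chart_inv d x))"
    using t(3) by (rule smooth_on_cong) (auto simp: transition_apply ch chart_inv_left)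
  moreover have "fst c \<inter> U = U" using U(2) by blast
  ultimately show "smooth_on (snd d ` (fst d \<inter> U)) (\<lambda>x. F (chart_inv d x))" by simp
qed

text \<open>With constant components in one chart, such fields supply the local extensions of tangent vectors.\<close>

lemma smooth_field_from_chart:
  assumes c: "admissible A c" and U: "open U" "U \<subseteq> fst c"
    and w: "smooth_on (snd c ` U) w"
  shows "smooth_field A U (\<lambda>q. transition_deriv c (chart_at A q) q (w (snd c q)))"
proof (rule smooth_fieldI)
  fix d assume d: "d \<in> A"
  have dc: "smooth_pair d c" using c d smooth_pair_sym unfolding admissible_def by blast
  note cd = smooth_pair_sym[OF dc]
  note t = transition_maps[OF dc U(1)]
  have ch: "is_chart d" "is_chart c" using dc unfolding smooth_pair_def by auto
  have "smooth_on (snd c ` (fst c \<inter> (fst d \<inter> U)))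
      (\<lambda>x. frechet_derivative (transition c d) (at x) (w x))"
  proof (rule smooth_on_frechet_derivative[OF t(4)])
    show "smooth_on (snd c ` (fst c \<inter> (fst d \<inter> U))) (transition c d)"
      by (rule smooth_on_subset[OF smooth_pair_transition[OF cd]]) auto
    show "smooth_on (snd c ` (fst c \<inter> (fst d \<inter> U))) w"
      by (rule smooth_on_subset[OF w]) auto
  qed
  then have "smooth_on (snd d ` (fst d \<inter> (fst c \<inter> U)))
      (\<lambda>x. frechet_derivative (transition c d) (at (transition d c x)) (w (transition d c x)))"
    using smooth_on_compose[OF t(3,4,1,2)] by blast
  then have "smooth_on (snd d ` (fst d \<inter> (fst c \<inter> U)))
      (\<lambda>x. let q = chart_inv d x in components A d q (transition_deriv c (chart_at A q) q (w (snd c q))))"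
    using t(3)
  proof (rule smooth_on_cong)
    fix x assume "x \<in> snd d ` (fst d \<inter> (fst c \<inter> U))"
    then obtain q where q: "q \<in> fst d" "q \<in> fst c" "x = snd d q" by blast
    have "components A d q (transition_deriv c (chart_at A q) q v) = transition_deriv c d q v" for v
      unfolding components_eq
      using transition_deriv_cocycle[OF admissible_pair(1)[OF c] atlas_pair[OF chart_at(1) d] q(2) chart_at(2) q(1)] .
    then show "frechet_derivative (transition c d) (at (transition d c x)) (w (transition d c x)) =
        (let q = chart_inv d x in components A d q (transition_deriv c (chart_at A q) q (w (snd c q))))"
      using q by (simp add: transition_apply ch chart_inv_left Let_def transition_deriv_def)
  qed
  moreover have "fst c \<inter> U = U" using U(2) by blast
  ultimately show "smooth_on (snd d ` (fst d \<inter> U)) (\<lambda>x. components A d (chart_inv d x)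
     (transition_deriv c (chart_at A (chart_inv d x)) (chart_inv d x) (w (snd c (chart_inv d x)))))"
    by (simp add: Let_def)
qed

text \<open>The preferred chart varies with the point, without any continuity. Smooth dependence of the
  differential on the point becomes visible in a fixed chart.\<close>

lemma differential_in_chart:
  assumes F: "open U" "smooth_function A U F" and q: "q \<in> U" "q \<in> fst c" and c: "c \<in> A"
  shows "differential A F q v =
    frechet_derivative (\<lambda>x. F (chart_inv c x)) (at (snd c q)) (components A c q v)"
proof -
  let ?k = "chart_at A q"
  have kc: "smooth_pair ?k c" using atlas_pair[OF chart_at(1) c] .
  have ch: "is_chart ?k" "is_chart c" using kc unfolding smooth_pair_def by auto
  have "snd c q \<in> snd c ` (fst c \<inter> U)" using q by blast
  then have "((\<lambda>x. F (chart_inv c x)) has_derivative frechet_derivative (\<lambda>x. F (chart_inv c x)) (at (snd c q)))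
      (at (transition ?k c (snd ?k q)))"
    unfolding transition_apply[OF ch(1) chart_at(2)]
    by (rule smooth_on_has_derivative[OF smooth_function_in_chart[OF F(2) c]])
  then have "((\<lambda>x. F (chart_inv c (transition ?k c x))) has_derivative
      (\<lambda>v. frechet_derivative (\<lambda>x. F (chart_inv c x)) (at (snd c q)) (transition_deriv ?k c q v))) (at (snd ?k q))"
    by (rule has_derivative_compose[OF transition_deriv_has_derivative[OF kc chart_at(2) q(2)]])
  then have "((\<lambda>x. F (chart_inv ?k x)) has_derivative
      (\<lambda>v. frechet_derivative (\<lambda>x. F (chart_inv c x)) (at (snd c q)) (transition_deriv ?k c q v))) (at (snd ?k q))"
  proof (rule has_derivative_transform_within_open)
    show "open (snd ?k ` (fst ?k \<inter> (fst c \<inter> U)))" using transition_maps(3)[OF kc F(1)] .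
    show "snd ?k q \<in> snd ?k ` (fst ?k \<inter> (fst c \<inter> U))" using chart_at(2) q by blast
    show "F (chart_inv c (transition ?k c x)) = F (chart_inv ?k x)"
      if "x \<in> snd ?k ` (fst ?k \<inter> (fst c \<inter> U))" for x
      using that by (auto simp: transition_apply ch chart_inv_left)
  qed
  then have "(\<lambda>v. frechet_derivative (\<lambda>x. F (chart_inv c x)) (at (snd c q)) (transition_deriv ?k c q v)) =
      differential A F q"
    unfolding differential_def by (rule frechet_derivative_at)
  then show ?thesis unfolding components_eq by (rule fun_cong[symmetric])
qed

lemma differential_has_derivative:
  assumes "smooth_function A U F" "q \<in> U"
  shows "((\<lambda>x. F (chart_inv (chart_at A q) x)) has_derivative differential A F q)
    (at (snd (chart_at A q) q))"
proof -
  have "snd (chart_at A q) q \<in> snd (chart_at A q) ` (fst (chart_at A q) \<inter> U)"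
    using chart_at(2) assms(2) by blast
  then show ?thesis
    unfolding differential_def
    by (rule smooth_on_has_derivative[OF smooth_function_in_chart[OF assms(1) chart_at(1)]])
qed

lemma differential_linear:
  assumes "smooth_function A U F" "q \<in> U"
  shows "linear (differential A F q)"
  using has_derivative_linear[OF differential_has_derivative[OF assms]] .

lemma differential_diff:
  assumes "open U" "smooth_function A U F" "smooth_function A U G" "q \<in> U"
  shows "differential A (\<lambda>q. F q - G q) q v = differential A F q v - differential A G q v"
  unfolding differential_def[of _ "\<lambda>q. F q - G q"]
  by (subst frechet_derivative_at[OF has_derivative_diff[OF differential_has_derivative[OF assms(2,4)]
        differential_has_derivative[OF assms(3,4)]], symmetric]) simp

lemma smooth_function_differential:
  assumes "open U" "smooth_function A U F" "smooth_field A U X"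
  shows "smooth_function A U (\<lambda>q. differential A F q (X q))"
proof (rule smooth_functionI)
  fix c assume c: "c \<in> A"
  note o = chart_open_image[OF atlas_chart[OF c] assms(1)]
  show "smooth_on (snd c ` (fst c \<inter> U))
      (\<lambda>x. differential A F (chart_inv c x) (X (chart_inv c x)))"
    using smooth_on_frechet_derivative[OF o smooth_function_in_chart[OF assms(2) c]
        smooth_field_in_chart[OF assms(3) c]] o
  proof (rule smooth_on_cong)
    fix x assume x: "x \<in> snd c ` (fst c \<inter> U)"
    note i = chart_inv_image[OF atlas_chart[OF c] x]
    show "frechet_derivative (\<lambda>x. F (chart_inv c x)) (at x)
        (components A c (chart_inv c x) (X (chart_inv c x))) =
      differential A F (chart_inv c x) (X (chart_inv c x))"
      using differential_in_chart[OF assms(1,2) i(2,1) c] i(3) by simp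
  qed
qed

end

section \<open>Curves, tangent spaces and local extensions\<close>

text \<open>The component of the curve orthogonal to \<open>V\<close> is constantly zero, so that its derivative
  vanishes.\<close>

lemma velocity_in_subspace:
  fixes x :: "real \<Rightarrow> 'a::euclidean_space"
  assumes x: "(x has_vector_derivative w) (at 0)" and V: "subspace V" "\<forall>\<^sub>F t in nhds 0. x t \<in> V"
  shows "w \<in> V"
proof -
  obtain y z where y: "y \<in> span V" and z: "\<And>u. u \<in> span V \<Longrightarrow> orthogonal z u" and w: "w = y + z"
    using orthogonal_subspace_decomp_exists[of V w] by blast
  have sV: "span V = V" using V(1) by (simp add: span_eq_iff)
  have "((\<lambda>t. x t \<bullet> z) has_real_derivative w \<bullet> z) (at 0)"
    using has_derivative_inner_left[OF x[unfolded has_vector_derivative_def], of z]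
    unfolding has_field_derivative_def by (simp add: mult_commute_abs)
  moreover have "\<forall>\<^sub>F t in nhds 0. x t \<bullet> z = 0"
    using V(2) by eventually_elim (use z sV in \<open>metis inner_commute orthogonal_def\<close>)
  then have "((\<lambda>t. x t \<bullet> z) has_real_derivative 0) (at 0)"
    by (subst DERIV_cong_ev[OF refl _ refl]) auto
  ultimately have "w \<bullet> z = 0" by (rule DERIV_unique)
  moreover have "y \<bullet> z = 0" using z[OF y] by (simp add: orthogonal_def inner_commute)
  ultimately have "z \<bullet> z = 0" using w by (simp add: inner_add_left)
  then show ?thesis using w y sV by simp
qed

context smooth_manifold
begin

lemma curve_eventually_in:
  assumes "curve_through A S p v \<gamma>" "open W" "p \<in> W"
  shows "\<forall>\<^sub>F t in nhds 0. \<gamma> t \<in> S \<inter> fst (chart_at A p) \<inter> W"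
proof -
  let ?k = "chart_at A p"
  note k = atlas_chart[OF chart_at(1)]
  from assms(1) obtain d where g0: "\<gamma> 0 = p" and d: "d > 0"
    "\<And>t. t \<in> {-d<..<d} \<Longrightarrow> \<gamma> t \<in> S \<inter> fst ?k"
    and der: "((snd ?k \<circ> \<gamma>) has_vector_derivative v) (at 0)"
    unfolding curve_through_def by blast
  have "isCont (snd ?k \<circ> \<gamma>) 0" using has_vector_derivative_continuous[OF der] .
  then have "((snd ?k \<circ> \<gamma>) \<longlongrightarrow> snd ?k p) (nhds 0)"
    unfolding isCont_def tendsto_at_iff_tendsto_nhds using g0 by simp
  moreover have "snd ?k p \<in> snd ?k ` (fst ?k \<inter> W)" using chart_at(2) assms(3) by blast
  ultimately have "\<forall>\<^sub>F t in nhds 0. (snd ?k \<circ> \<gamma>) t \<in> snd ?k ` (fst ?k \<inter> W)"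
    using chart_open_image[OF k assms(2)] topological_tendstoD by blast
  moreover have "\<forall>\<^sub>F t in nhds 0. t \<in> {-d<..<d}"
    using d(1) by (intro eventually_nhds_in_open) auto
  ultimately show ?thesis
  proof eventually_elim
    case (elim t)
    then show ?case using d(2)[OF elim(2)] chart_mem_image[OF k] by auto
  qed
qed

text \<open>A curve is required to be smooth in a chart only, so it has to be shown first that it stays in \<open>U\<close>
  for a short time (\<open>curve_eventually_in\<close>); then the chain rule applies.\<close>

lemma curve_differential:
  assumes \<gamma>: "curve_through A S p v \<gamma>" and U: "open U" "p \<in> U"
    and F: "smooth_function A U F" and f: "\<And>q. q \<in> S \<inter> U \<Longrightarrow> f q = F q"
  shows "((f \<circ> \<gamma>) has_real_derivative differential A F p v) (at 0)"
proof -
  let ?k = "chart_at A p"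
  note k = atlas_chart[OF chart_at(1)]
  from \<gamma> have g0: "\<gamma> 0 = p" and der: "((snd ?k \<circ> \<gamma>) has_vector_derivative v) (at 0)"
    unfolding curve_through_def by blast+
  let ?G = "\<lambda>x. F (chart_inv ?k x)"
  have G: "(?G has_derivative differential A F p) (at (snd ?k p))"
    using differential_has_derivative[OF F U(2)] .
  have "(snd ?k \<circ> \<gamma> has_derivative (\<lambda>t. t *\<^sub>R v)) (at 0)"
    using der unfolding has_vector_derivative_def .
  then have "((\<lambda>t. ?G ((snd ?k \<circ> \<gamma>) t)) has_derivative (\<lambda>t. differential A F p (t *\<^sub>R v))) (at 0)"
    by (rule has_derivative_compose) (use G g0 in simp)
  then have D: "((\<lambda>t. ?G ((snd ?k \<circ> \<gamma>) t)) has_real_derivative differential A F p v) (at 0)"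
    unfolding has_field_derivative_def
    by (simp add: linear_cmul[OF differential_linear[OF F U(2)]] mult_commute_abs)
  have ev: "\<forall>\<^sub>F t in nhds 0. ?G ((snd ?k \<circ> \<gamma>) t) = (f \<circ> \<gamma>) t"
    using curve_eventually_in[OF \<gamma> U]
    by eventually_elim (simp add: chart_inv_left[OF k] f)
  show ?thesis by (rule DERIV_cong_ev[OF refl ev refl, THEN iffD1, OF D])
qed

text \<open>Directional derivatives are defined by an arbitrary choice of curve. They do not depend on it, and
  are given by the differential of any local extension of the function.\<close>

lemma dir_deriv_eq:
  assumes "v \<in> tangent_space A S p" "open U" "p \<in> U" "smooth_function A U F"
    "\<And>q. q \<in> S \<inter> U \<Longrightarrow> f q = F q"
  shows "dir_deriv A S p v f = differential A F p v"
proof -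
  have "curve_through A S p v (SOME \<gamma>. curve_through A S p v \<gamma>)"
    using assms(1) unfolding tangent_space_def using someI_ex[of "curve_through A S p v"] by blast
  then show ?thesis
    unfolding dir_deriv_def using curve_differential[OF _ assms(2-5)] DERIV_imp_deriv by blast
qed

lemma line_smooth: "smooth_on {-d<..<(d::real)} (\<lambda>t. (a::'e) + t *\<^sub>R w)"
  by (intro smooth_on_add smooth_on_const smooth_on_linear bounded_linear_scaleR_left) auto

text \<open>In an adapted chart the submanifold is flat. Velocities of curves in it are therefore in \<open>V\<close>, and
  conversely straight lines in \<open>V\<close> realise all vectors of \<open>V\<close>.\<close>

lemma tangent_space_in_chart:
  assumes c: "admissible A c" and V: "subspace V" and S: "snd c ` (fst c \<inter> S) = snd c ` fst c \<inter> V"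
    and p: "p \<in> fst c" "p \<in> S"
  shows "tangent_space A S p = {v. transition_deriv (chart_at A p) c p v \<in> V}"
proof (intro equalityI subsetI CollectI)
  let ?k = "chart_at A p"
  have kc: "smooth_pair ?k c" using admissible_pair(2)[OF c] .
  have ch: "is_chart ?k" "is_chart c" using kc unfolding smooth_pair_def by auto
  have oc: "open (fst c)" "open (fst ?k)" using ch unfolding is_chart_def by auto
  {
    fix v assume "v \<in> tangent_space A S p"
    then obtain \<gamma> where \<gamma>: "curve_through A S p v \<gamma>" unfolding tangent_space_def by blast
    then have g0: "\<gamma> 0 = p" and der: "((snd ?k \<circ> \<gamma>) has_derivative (\<lambda>t. t *\<^sub>R v)) (at 0)"
      unfolding curve_through_def has_vector_derivative_def by blast+
    have "((\<lambda>t. transition ?k c ((snd ?k \<circ> \<gamma>) t)) has_derivative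
        (\<lambda>t. transition_deriv ?k c p (t *\<^sub>R v))) (at 0)"
      by (rule has_derivative_compose[OF der])
        (use transition_deriv_has_derivative[OF kc chart_at(2) p(1)] g0 in simp)
    then have d: "((\<lambda>t. transition ?k c ((snd ?k \<circ> \<gamma>) t)) has_vector_derivative transition_deriv ?k c p v) (at 0)"
      unfolding has_vector_derivative_def
      by (simp add: linear_cmul[OF transition_deriv_linear[OF kc chart_at(2) p(1)]])
    have "\<forall>\<^sub>F t in nhds 0. transition ?k c ((snd ?k \<circ> \<gamma>) t) \<in> V"
      using curve_eventually_in[OF \<gamma> oc(1) p(1)]
    proof eventually_elim
      case (elim t)
      then have "snd c (\<gamma> t) \<in> V" using S by blast
      then show ?case using elim by (simp add: transition_apply[OF ch(1)])
    qed
    then show "transition_deriv ?k c p v \<in> V" by (rule velocity_in_subspace[OF d V])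
  next
    fix v assume "v \<in> {v. transition_deriv ?k c p v \<in> V}"
    define w where "w = transition_deriv ?k c p v"
    have w: "w \<in> V" using \<open>v \<in> _\<close> unfolding w_def by simp
    have v: "v = transition_deriv c ?k p w"
      unfolding w_def using transition_deriv_cocycle[OF kc smooth_pair_sym[OF kc] chart_at(2) p(1) chart_at(2)]
        transition_deriv_id[OF ch(1) chart_at(2)] by simp
    let ?O = "snd c ` (fst c \<inter> fst ?k)"
    let ?x = "\<lambda>t::real. snd c p + t *\<^sub>R w"
    define \<gamma> where "\<gamma> t = chart_inv c (?x t)" for t
    have "open ?O" using chart_open_image[OF ch(2) oc(2)] .
    moreover have "snd c p \<in> ?O" using p(1) chart_at(2) by blast
    ultimately obtain e where e: "e > 0" "ball (snd c p) e \<subseteq> ?O" using open_contains_ball by blast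
    \<comment> \<open>with this \<open>d\<close>, \<open>\<bar>t\<bar> < d\<close> keeps the line in the ball of radius \<open>e\<close>, also when \<open>w = 0\<close>\<close>
    define d where "d = e / (norm w + 1)"
    have nw: "norm w + 1 > 0" by (simp add: add_nonneg_pos)
    have d: "d > 0" unfolding d_def using e(1) nw by simp
    have xO: "?x t \<in> ?O" if "t \<in> {-d<..<d}" for t
    proof -
      have "\<bar>t\<bar> * norm w \<le> \<bar>t\<bar> * (norm w + 1)" by (intro mult_left_mono) auto
      also have "\<dots> < d * (norm w + 1)" using that nw by (intro mult_strict_right_mono) auto
      also have "\<dots> = e" unfolding d_def using nw by simp
      finally have "?x t \<in> ball (snd c p) e" by (simp add: dist_norm)
      then show ?thesis using e(2) by blast
    qed
    have \<gamma>t: "\<gamma> t \<in> S \<inter> fst ?k" "snd ?k (\<gamma> t) = transition c ?k (?x t)" if "t \<in> {-d<..<d}" for t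
    proof -
      note i = chart_inv_image[OF ch(2) xO[OF that]]
      have "snd c p \<in> V" using S p by blast
      then have "?x t \<in> snd c ` fst c \<inter> V"
        using xO[OF that] w V by (auto intro: subspace_add subspace_scale)
      then have "?x t \<in> snd c ` (fst c \<inter> S)" using S by simp
      then show "\<gamma> t \<in> S \<inter> fst ?k" using chart_inv_image(2)[OF ch(2)] i(2) unfolding \<gamma>_def by blast
      show "snd ?k (\<gamma> t) = transition c ?k (?x t)"
        using transition_apply[OF ch(2) i(1), of ?k] i(3) unfolding \<gamma>_def by simp
    qed
    have "curve_through A S p v \<gamma>"
      unfolding curve_through_def
    proof (intro conjI exI[of _ d] d ballI)
      show "\<gamma> 0 = p" unfolding \<gamma>_def using chart_inv_left[OF ch(2) p(1)] by simp
      show "\<gamma> t \<in> S \<inter> fst ?k" if "t \<in> {-d<..<d}" for t using \<gamma>t(1)[OF that] .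
      have "smooth_on {-d<..<d} (\<lambda>t. transition c ?k (?x t))"
        by (rule smooth_on_compose[OF _ \<open>open ?O\<close> _ line_smooth
              smooth_pair_transition[OF smooth_pair_sym[OF kc]]]) (use xO in auto)
      then show "smooth_on {-d<..<d} (snd ?k \<circ> \<gamma>)"
        by (rule smooth_on_cong) (use \<gamma>t(2) in auto)
      have x: "(?x has_derivative (\<lambda>t. t *\<^sub>R w)) (at 0)" by (auto intro!: derivative_eq_intros)
      have "((\<lambda>t. transition c ?k (?x t)) has_derivative (\<lambda>t. transition_deriv c ?k p (t *\<^sub>R w))) (at 0)"
        by (rule has_derivative_compose[OF x])
          (use transition_deriv_has_derivative[OF smooth_pair_sym[OF kc] p(1) chart_at(2)] in simp)
      then have "((\<lambda>t. transition c ?k (?x t)) has_vector_derivative v) (at 0)"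
        unfolding has_vector_derivative_def v
        by (simp add: linear_cmul[OF transition_deriv_linear[OF smooth_pair_sym[OF kc] p(1) chart_at(2)]])
      then show "((snd ?k \<circ> \<gamma>) has_vector_derivative v) (at 0)"
        by (rule has_vector_derivative_transform_within_open[of _ _ _ "{-d<..<d}"])
          (use d \<gamma>t(2) in auto)
    qed
    then show "v \<in> tangent_space A S p" unfolding tangent_space_def by blast
  }
qed

lemma submanifold_chart:
  assumes "submanifold A k S" "p \<in> S"
  obtains c V where "admissible A c" "subspace V" "dim V = k" "p \<in> fst c"
    "\<And>q. q \<in> fst c \<Longrightarrow> q \<in> S \<Longrightarrow> tangent_space A S q = {v. transition_deriv (chart_at A q) c q v \<in> V}"
proof -
  from assms obtain c V where c: "is_chart c" "\<forall>d\<in>A. compatible c d" "p \<in> fst c"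
    "subspace V" "dim V = k" "snd c ` (fst c \<inter> S) = snd c ` fst c \<inter> V"
    unfolding submanifold_def by blast
  have a: "admissible A c" unfolding admissible_def smooth_pair_def using c atlas_chart by blast
  show ?thesis using that[OF a c(4,5,3) tangent_space_in_chart[OF a c(4,6)]] by blast
qed

lemma tangent_space_subspace:
  assumes "submanifold A k S" "p \<in> S"
  shows "subspace (tangent_space A S p)" "dim (tangent_space A S p) = k"
proof -
  obtain c V where c: "admissible A c" "subspace V" "dim V = k" "p \<in> fst c"
    and T: "tangent_space A S p = {v. transition_deriv (chart_at A p) c p v \<in> V}"
    using submanifold_chart[OF assms] assms(2) by metis
  let ?L = "transition_deriv (chart_at A p) c p" and ?L' = "transition_deriv c (chart_at A p) p"
  note kc = admissible_pair(2)[OF c(1), of p] and ck = admissible_pair(1)[OF c(1), of p]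
  have l: "linear ?L" "linear ?L'"
    using transition_deriv_linear[OF kc chart_at(2) c(4)] transition_deriv_linear[OF ck c(4) chart_at(2)] by auto
  have inv: "?L (?L' w) = w" "?L' (?L w) = w" for w
    using transition_deriv_cocycle[OF ck kc c(4) chart_at(2) c(4)] transition_deriv_id[OF admissible_chart[OF c(1)] c(4)]
      transition_deriv_cocycle[OF kc ck chart_at(2) c(4) chart_at(2)]
      transition_deriv_id[OF atlas_chart[OF chart_at(1)] chart_at(2)] by auto
  show "subspace (tangent_space A S p)"
    unfolding T using linear_subspace_vimage[OF l(1) c(2)] by (simp add: vimage_def)
  have "tangent_space A S p = ?L' ` V" 
  proof (intro equalityI subsetI)
    show "v \<in> ?L' ` V" if "v \<in> tangent_space A S p" for v
      using that inv(2)[of v] unfolding T by (metis image_eqI mem_Collect_eq)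
    show "v \<in> tangent_space A S p" if "v \<in> ?L' ` V" for v
      using that inv(1) unfolding T by auto
  qed
  moreover have "inj ?L'" using inv(1) by (metis injI)
  ultimately show "dim (tangent_space A S p) = k"
    using dim_image_eq[OF l(2)] c(3) by (metis inj_on_subset subset_UNIV)
qed

lemma submanifold_UNIV: "submanifold A DIM('e) UNIV"
  unfolding submanifold_def
proof
  fix p
  have "is_chart (chart_at A p)" "\<forall>d\<in>A. compatible (chart_at A p) d"
    using atlas_pair[OF chart_at(1)] atlas_chart[OF chart_at(1)] unfolding smooth_pair_def by auto
  then show "\<exists>c V. is_chart c \<and> (\<forall>d\<in>A. compatible c d) \<and> p \<in> fst c \<and> subspace V \<and>
      dim V = DIM('e) \<and> snd c ` (fst c \<inter> UNIV) = snd c ` fst c \<inter> V"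
    using chart_at(2) by (intro exI[of _ "chart_at A p"] exI[of _ "UNIV"]) (auto simp: dim_UNIV)
qed

lemma tangent_space_UNIV: "tangent_space A UNIV p = UNIV"
  using tangent_space_subspace[OF submanifold_UNIV, of p] by (metis UNIV_I dim_eq_full span_eq_iff)

text \<open>The field with constant components in an adapted chart.\<close>

lemma extend_exists:
  assumes "submanifold A k S" "p \<in> S" "v \<in> tangent_space A S p"
  shows "\<exists>X. field_near A S p X \<and> X p = v"
proof -
  obtain c V where c: "admissible A c" "subspace V" "p \<in> fst c"
    and T: "\<And>q. q \<in> fst c \<Longrightarrow> q \<in> S \<Longrightarrow> tangent_space A S q = {v. transition_deriv (chart_at A q) c q v \<in> V}"
    using submanifold_chart[OF assms(1,2)] by metis
  define w where "w = transition_deriv (chart_at A p) c p v"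
  have w: "w \<in> V" using T[OF c(3) assms(2)] assms(3) unfolding w_def by blast
  let ?X = "\<lambda>q. transition_deriv c (chart_at A q) q w"
  note ck = admissible_pair(1)[OF c(1)] and kc = admissible_pair(2)[OF c(1)]
  have o: "open (fst c)" "open (snd c ` fst c)"
    using admissible_chart[OF c(1)] unfolding is_chart_def by auto
  have "smooth_field A (fst c) ?X"
    using smooth_field_from_chart[OF c(1) o(1) order_refl smooth_on_const[OF o(2)]] .
  then have "section_near A S p ?X" unfolding section_near_def using o(1) c(3) by blast
  moreover have "?X q \<in> tangent_space A S q" if "q \<in> S \<inter> fst c" for q
    using that T transition_deriv_cocycle[OF ck kc _ chart_at(2)] transition_deriv_id[OF admissible_chart[OF c(1)]] w
    by auto
  ultimately have "field_near A S p ?X" unfolding field_near_def using o(1) c(3) by blast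
  moreover have "?X p = v"
    unfolding w_def using transition_deriv_cocycle[OF kc ck chart_at(2) c(3) chart_at(2)]
      transition_deriv_id[OF atlas_chart[OF chart_at(1)] chart_at(2)] by simp
  ultimately show ?thesis by blast
qed

lemma extend:
  assumes "submanifold A k S" "p \<in> S" "v \<in> tangent_space A S p"
  shows "field_near A S p (extend A S p v)" "extend A S p v p = v"
  using someI_ex[OF extend_exists[OF assms]] unfolding extend_def by auto

end

section \<open>Germs of functions and sections\<close>

context smooth_manifold
begin

lemma function_near_cong:
  assumes "function_near A S p f" "open W" "p \<in> W" "\<And>q. q \<in> S \<inter> W \<Longrightarrow> f q = f' q"
  shows "function_near A S p f'"
proof -
  from assms(1) obtain U F where "open U" "p \<in> U" "smooth_function A U F" "\<forall>q\<in>S \<inter> U. f q = F q"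
    unfolding function_near_def by blast
  then show ?thesis
    unfolding function_near_def using assms(2-4) smooth_function_subset[of U F "U \<inter> W"]
    by (intro exI[of _ "U \<inter> W"] exI[of _ F]) (auto simp flip: assms(4))
qed

lemma section_near_cong:
  assumes "section_near A S p X" "open W" "p \<in> W" "\<And>q. q \<in> S \<inter> W \<Longrightarrow> X q = X' q"
  shows "section_near A S p X'"
proof -
  from assms(1) obtain U F where "open U" "p \<in> U" "smooth_field A U F" "\<forall>q\<in>S \<inter> U. X q = F q"
    unfolding section_near_def by blast
  then show ?thesis
    unfolding section_near_def using assms(2-4) smooth_field_subset[of U F "U \<inter> W"]
    by (intro exI[of _ "U \<inter> W"] exI[of _ F]) (auto simp flip: assms(4))
qed

lemma function_near2:
  assumes "function_near A S p f" "function_near A S p g"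
  obtains U F G where "open U" "p \<in> U" "smooth_function A U F" "smooth_function A U G"
    "\<forall>q\<in>S \<inter> U. f q = F q" "\<forall>q\<in>S \<inter> U. g q = G q"
proof -
  from assms obtain U F V G where
    "open U" "p \<in> U" "smooth_function A U F" "\<forall>q\<in>S \<inter> U. f q = F q"
    "open V" "p \<in> V" "smooth_function A V G" "\<forall>q\<in>S \<inter> V. g q = G q"
    unfolding function_near_def by blast
  then show ?thesis
    using that[of "U \<inter> V" F G] smooth_function_subset[of U F "U \<inter> V"] smooth_function_subset[of V G "U \<inter> V"]
    by auto
qed

lemma section_near2:
  assumes "section_near A S p X" "section_near A S p Y"
  obtains U F G where "open U" "p \<in> U" "smooth_field A U F" "smooth_field A U G"
    "\<forall>q\<in>S \<inter> U. X q = F q" "\<forall>q\<in>S \<inter> U. Y q = G q"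
proof -
  from assms obtain U F V G where
    "open U" "p \<in> U" "smooth_field A U F" "\<forall>q\<in>S \<inter> U. X q = F q"
    "open V" "p \<in> V" "smooth_field A V G" "\<forall>q\<in>S \<inter> V. Y q = G q"
    unfolding section_near_def by blast
  then show ?thesis
    using that[of "U \<inter> V" F G] smooth_field_subset[of U F "U \<inter> V"] smooth_field_subset[of V G "U \<inter> V"]
    by auto
qed

lemma function_section_near:
  assumes "function_near A S p f" "section_near A S p Y"
  obtains U F G where "open U" "p \<in> U" "smooth_function A U F" "smooth_field A U G"
    "\<forall>q\<in>S \<inter> U. f q = F q" "\<forall>q\<in>S \<inter> U. Y q = G q"
proof -
  from assms obtain U F V G where
    "open U" "p \<in> U" "smooth_function A U F" "\<forall>q\<in>S \<inter> U. f q = F q"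
    "open V" "p \<in> V" "smooth_field A V G" "\<forall>q\<in>S \<inter> V. Y q = G q"
    unfolding function_near_def section_near_def by blast
  then show ?thesis
    using that[of "U \<inter> V" F G] smooth_function_subset[of U F "U \<inter> V"] smooth_field_subset[of V G "U \<inter> V"]
    by auto
qed

lemma function_nearI:
  "open U \<Longrightarrow> p \<in> U \<Longrightarrow> smooth_function A U F \<Longrightarrow> (\<And>q. q \<in> S \<inter> U \<Longrightarrow> f q = F q) \<Longrightarrow> function_near A S p f"
  unfolding function_near_def by blast

lemma section_nearI:
  "open U \<Longrightarrow> p \<in> U \<Longrightarrow> smooth_field A U F \<Longrightarrow> (\<And>q. q \<in> S \<inter> U \<Longrightarrow> X q = F q) \<Longrightarrow> section_near A S p X"
  unfolding section_near_def by blast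

lemma function_near_const: "function_near A S p (\<lambda>q. a)"
  by (rule function_nearI[OF open_UNIV UNIV_I smooth_function_const[OF open_UNIV]]) (rule refl)

lemma function_near_add:
  assumes "function_near A S p f" "function_near A S p g"
  shows "function_near A S p (\<lambda>q. f q + g q)"
proof -
  obtain U F G where "open U" "p \<in> U" "smooth_function A U F"
    "smooth_function A U G" "\<forall>q\<in>S \<inter> U. f q = F q" "\<forall>q\<in>S \<inter> U. g q = G q"
    by (rule function_near2[OF assms])
  then show ?thesis using function_nearI[OF _ _ smooth_function_add[of U F G]] by simp
qed

lemma function_near_mult:
  assumes "function_near A S p f" "function_near A S p g"
  shows "function_near A S p (\<lambda>q. f q * g q)"
proof -
  obtain U F G where "open U" "p \<in> U" "smooth_function A U F"
    "smooth_function A U G" "\<forall>q\<in>S \<inter> U. f q = F q" "\<forall>q\<in>S \<inter> U. g q = G q"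
    by (rule function_near2[OF assms])
  then show ?thesis using function_nearI[OF _ _ smooth_function_mult[of U F G]] by simp
qed

lemma function_near_diff:
  assumes "function_near A S p f" "function_near A S p g"
  shows "function_near A S p (\<lambda>q. f q - g q)"
  using function_near_add[OF assms(1) function_near_mult[OF function_near_const[of S p "-1"] assms(2)]] by simp

text \<open>By continuity, a smooth function that is non-zero at \<open>p\<close> is so on a neighbourhood.\<close>

lemma function_near_nonzero:
  assumes "function_near A S p f" "f p \<noteq> 0" "p \<in> S"
  obtains V F where "open V" "p \<in> V" "smooth_function A V F" "\<forall>q\<in>S \<inter> V. f q = F q" "\<forall>q\<in>V. F q \<noteq> 0"
proof -
  from assms(1) obtain U F where F: "open U" "p \<in> U" "smooth_function A U F" "\<forall>q\<in>S \<inter> U. f q = F q"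
    unfolding function_near_def by blast
  let ?c = "chart_at A p"
  note c = atlas_chart[OF chart_at(1)[of p]]
  let ?G = "\<lambda>x. F (chart_inv ?c x)"
  have o: "open (fst ?c \<inter> U)" using c F(1) unfolding is_chart_def by auto
  have "continuous_on (snd ?c ` (fst ?c \<inter> U)) ?G"
    using smooth_on_continuous[OF smooth_function_in_chart[OF F(3) chart_at(1)]] .
  then have "open (snd ?c ` (fst ?c \<inter> U) \<inter> ?G -` (- {0}))"
    by (rule continuous_open_preimage[OF _ chart_open_image[OF c F(1)]]) (simp add: open_Compl)
  moreover have "continuous_on (fst ?c) (snd ?c)"
    using c unfolding is_chart_def homeomorphism_def by (elim conjE) assumption
  then have "continuous_on (fst ?c \<inter> U) (snd ?c)" by (rule continuous_on_subset) (rule Int_lower1)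
  ultimately have op: "open (fst ?c \<inter> U \<inter> snd ?c -` (snd ?c ` (fst ?c \<inter> U) \<inter> ?G -` (- {0})))"
    using continuous_open_preimage o by metis
  define V where "V = {q \<in> fst ?c \<inter> U. F q \<noteq> 0}"
  have "V = fst ?c \<inter> U \<inter> snd ?c -` (snd ?c ` (fst ?c \<inter> U) \<inter> ?G -` (- {0}))"
    unfolding V_def
  proof (intro equalityI subsetI)
    fix q assume q: "q \<in> fst ?c \<inter> U \<inter> snd ?c -` (snd ?c ` (fst ?c \<inter> U) \<inter> ?G -` (- {0}))"
    then have "?G (snd ?c q) \<noteq> 0" by simp
    moreover have "?G (snd ?c q) = F q" using q chart_inv_left[OF c] by simp
    ultimately show "q \<in> {q \<in> fst ?c \<inter> U. F q \<noteq> 0}" using q by simp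
  qed (simp add: chart_inv_left[OF c])
  then have "open V" using op by simp
  moreover have "p \<in> V" unfolding V_def using chart_at(2) F(2,4) assms(2,3) by auto
  moreover have "smooth_function A V F"
    by (rule smooth_function_subset[OF F(3)]) (auto simp: V_def)
  ultimately show ?thesis by (rule that) (use F(4) V_def in auto)
qed

lemma function_near_inverse:
  assumes "function_near A S p f" "f p \<noteq> 0" "p \<in> S"
  shows "function_near A S p (\<lambda>q. inverse (f q))"
proof -
  obtain V F where V: "open V" "p \<in> V" "smooth_function A V F" "\<forall>q\<in>S \<inter> V. f q = F q" "\<forall>q\<in>V. F q \<noteq> 0"
    by (rule function_near_nonzero[OF assms])
  show ?thesis
    by (rule function_nearI[OF V(1,2) smooth_function_inverse[OF V(1,3)]]) (use V(4,5) in auto)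
qed

lemma section_near_add:
  assumes "section_near A S p X" "section_near A S p Y"
  shows "section_near A S p (\<lambda>q. X q + Y q)"
proof -
  obtain U F G where "open U" "p \<in> U" "smooth_field A U F"
    "smooth_field A U G" "\<forall>q\<in>S \<inter> U. X q = F q" "\<forall>q\<in>S \<inter> U. Y q = G q"
    by (rule section_near2[OF assms])
  then show ?thesis using section_nearI[OF _ _ smooth_field_add[of U F G]] by simp
qed

lemma section_near_scaleR:
  assumes "function_near A S p f" "section_near A S p Y"
  shows "section_near A S p (\<lambda>q. f q *\<^sub>R Y q)"
proof -
  obtain U F G where "open U" "p \<in> U" "smooth_function A U F"
    "smooth_field A U G" "\<forall>q\<in>S \<inter> U. f q = F q" "\<forall>q\<in>S \<inter> U. Y q = G q"
    by (rule function_section_near[OF assms])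
  then show ?thesis using section_nearI[OF _ _ smooth_field_scaleR[of U F G]] by simp
qed

lemma section_near_diff:
  assumes "section_near A S p X" "section_near A S p Y"
  shows "section_near A S p (\<lambda>q. X q - Y q)"
  using section_near_add[OF assms(1) section_near_scaleR[OF function_near_const[of S p "-1"] assms(2)]] by simp

lemma function_near_open:
  assumes "function_near A S p f"
  shows "\<exists>U. open U \<and> p \<in> U \<and> (\<forall>q\<in>U. function_near A S q f)"
  using assms unfolding function_near_def by blast

lemma section_near_open:
  assumes "section_near A S p X"
  shows "\<exists>U. open U \<and> p \<in> U \<and> (\<forall>q\<in>U. section_near A S q X)"
  using assms unfolding section_near_def by blast

lemma field_near_open:
  assumes "field_near A S p X"
  shows "\<exists>U. open U \<and> p \<in> U \<and> (\<forall>q\<in>U. field_near A S q X)"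
proof -
  from assms obtain V where "open V" "p \<in> V" "\<forall>q\<in>S \<inter> V. X q \<in> tangent_space A S q" "section_near A S p X"
    unfolding field_near_def by blast
  moreover obtain U where "open U" "p \<in> U" "\<forall>q\<in>U. section_near A S q X"
    using section_near_open[OF calculation(4)] by blast
  ultimately show ?thesis
    by (intro exI[of _ "U \<inter> V"]) (auto simp: field_near_def)
qed

lemma field_near_section: "field_near A S p X \<Longrightarrow> section_near A S p X"
  unfolding field_near_def by blast

lemma field_near_tangent: "field_near A S p X \<Longrightarrow> p \<in> S \<Longrightarrow> X p \<in> tangent_space A S p"
  unfolding field_near_def by blast

lemma field_nearI:
  assumes "section_near A S p X" "open U" "p \<in> U" "\<And>q. q \<in> S \<Longrightarrow> q \<in> U \<Longrightarrow> X q \<in> tangent_space A S q"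
  shows "field_near A S p X"
  using assms unfolding field_near_def by blast

lemma field_near_cong:
  assumes "field_near A S p X" "open W" "p \<in> W" "\<And>q. q \<in> S \<inter> W \<Longrightarrow> X q = X' q"
  shows "field_near A S p X'"
proof -
  from assms(1) obtain V where "open V" "p \<in> V" "\<forall>q\<in>S \<inter> V. X q \<in> tangent_space A S q"
    unfolding field_near_def by blast
  then show ?thesis
    using section_near_cong[OF field_near_section[OF assms(1)] assms(2-4)] assms(2-4)
    by (intro field_nearI[of _ _ _ "V \<inter> W"]) (auto simp flip: assms(4))
qed

lemma field_near_UNIV: "field_near A UNIV p X \<longleftrightarrow> section_near A UNIV p X"
  unfolding field_near_def tangent_space_UNIV by auto

lemma function_near_restrict: "function_near A UNIV p F \<Longrightarrow> function_near A S p F"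
  unfolding function_near_def by blast

lemma section_near_restrict: "section_near A UNIV p X \<Longrightarrow> section_near A S p X"
  unfolding section_near_def by blast

lemma section_near_lift:
  assumes "section_near A S p X"
  obtains F U where "section_near A UNIV p F" "open U" "p \<in> U" "\<And>q. q \<in> S \<inter> U \<Longrightarrow> X q = F q"
  using assms unfolding section_near_def by blast

text \<open>Directional derivatives only see the germ of the function on the submanifold, and agree with those
  of an extension to a larger submanifold.\<close>

lemma dir_deriv_cong:
  assumes "v \<in> tangent_space A S p" "v \<in> tangent_space A S' p" "S \<subseteq> S'" "function_near A S' p f'"
    "open W" "p \<in> W" "\<And>q. q \<in> S \<inter> W \<Longrightarrow> f q = f' q"
  shows "dir_deriv A S p v f = dir_deriv A S' p v f'"
proof -
  from assms(4) obtain U F where F: "open U" "p \<in> U" "smooth_function A U F" "\<forall>q\<in>S' \<inter> U. f' q = F q"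
    unfolding function_near_def by blast
  have "dir_deriv A S' p v f' = differential A F p v"
    using dir_deriv_eq[OF assms(2) F(1,2,3)] F(4) by blast
  moreover have "dir_deriv A S p v f = differential A F p v"
    by (rule dir_deriv_eq[OF assms(1) _ _ smooth_function_subset[OF F(3)], of "U \<inter> W"])
      (use F assms in auto)
  ultimately show ?thesis by simp
qed

lemma dir_deriv_const: "v \<in> tangent_space A S p \<Longrightarrow> dir_deriv A S p v (\<lambda>q. a) = 0"
  using dir_deriv_eq[of v S p UNIV "\<lambda>q. a", OF _ _ _ smooth_function_const]
  unfolding differential_def by simp

lemma dir_deriv_diff:
  assumes "v \<in> tangent_space A S p" "function_near A S p f" "function_near A S p g"
  shows "dir_deriv A S p v (\<lambda>q. f q - g q) = dir_deriv A S p v f - dir_deriv A S p v g"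
proof -
  obtain U F G where U: "open U" "p \<in> U" "smooth_function A U F"
    "smooth_function A U G" and e: "\<forall>q\<in>S \<inter> U. f q = F q" "\<forall>q\<in>S \<inter> U. g q = G q"
    by (rule function_near2[OF assms(2,3)])
  have "smooth_function A U (\<lambda>q. F q - G q)"
    using smooth_function_add[OF U(1,3) smooth_function_mult[OF U(1) smooth_function_const[OF U(1), of "-1"] U(4)]]
    by simp
  then have "dir_deriv A S p v (\<lambda>q. f q - g q) = differential A (\<lambda>q. F q - G q) p v"
    by (rule dir_deriv_eq[OF assms(1) U(1,2)]) (use e in auto)
  then show ?thesis
    using differential_diff[OF U(1,3,4,2)] dir_deriv_eq[OF assms(1) U(1,2,3) bspec[OF e(1)]]
      dir_deriv_eq[OF assms(1) U(1,2,4) bspec[OF e(2)]] by simp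
qed

lemma dir_deriv_add:
  assumes "v \<in> tangent_space A S p" "function_near A S p f" "function_near A S p g"
  shows "dir_deriv A S p v (\<lambda>q. f q + g q) = dir_deriv A S p v f + dir_deriv A S p v g"
  using dir_deriv_diff[OF assms(1) function_near_add[OF assms(2,3)] assms(3)] by simp

lemma dir_deriv_add_vector:
  assumes "submanifold A k S" "p \<in> S" "v \<in> tangent_space A S p" "w \<in> tangent_space A S p"
    "function_near A S p f"
  shows "dir_deriv A S p (v + w) f = dir_deriv A S p v f + dir_deriv A S p w f"
proof -
  from assms(5) obtain U F where F: "open U" "p \<in> U" "smooth_function A U F" "\<forall>q\<in>S \<inter> U. f q = F q"
    unfolding function_near_def by blast
  have "v + w \<in> tangent_space A S p"
    using subspace_add[OF tangent_space_subspace(1)[OF assms(1,2)] assms(3,4)] .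
  then show ?thesis
    using dir_deriv_eq[OF _ F(1-3) bspec[OF F(4)]] assms(3,4) linear_add[OF differential_linear[OF F(3,2)]] by metis
qed

lemma function_near_dir_deriv:
  assumes "function_near A S p f" "field_near A S p Y"
  shows "function_near A S p (\<lambda>q. dir_deriv A S q (Y q) f)"
proof -
  obtain U F G where
    U: "open U" "p \<in> U" "smooth_function A U F" "smooth_field A U G" and
    e: "\<forall>q\<in>S \<inter> U. f q = F q" "\<forall>q\<in>S \<inter> U. Y q = G q"
    by (rule function_section_near[OF assms(1) field_near_section[OF assms(2)]])
  from assms(2) obtain V where V: "open V" "p \<in> V" "\<forall>q\<in>S \<inter> V. Y q \<in> tangent_space A S q"
    unfolding field_near_def by blast
  have s: "smooth_function A (U \<inter> V) (\<lambda>q. differential A F q (G q))"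
    using smooth_function_differential[OF U(1,3,4)] by (rule smooth_function_subset) auto
  show ?thesis
  proof (rule function_nearI[OF _ _ s])
    show "open (U \<inter> V)" "p \<in> U \<inter> V" using U V by auto
    fix q assume q: "q \<in> S \<inter> (U \<inter> V)"
    then have "Y q \<in> tangent_space A S q" "q \<in> U" using V(3) by auto
    from dir_deriv_eq[OF this(1) U(1) this(2) U(3) bspec[OF e(1)]]
    show "dir_deriv A S q (Y q) f = differential A F q (G q)"
      using e(2) q by simp
  qed
qed

text \<open>The coordinate functions of a chart already distinguish tangent vectors. Hence a Lie bracket is
  determined by its action on functions.\<close>

lemma dir_deriv_separates:
  assumes "u \<in> tangent_space A S p" "v \<in> tangent_space A S p"
    "\<And>f. function_near A UNIV p f \<Longrightarrow> dir_deriv A S p u f = dir_deriv A S p v f"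
  shows "u = v"
proof (rule euclidean_eqI)
  fix b :: 'e
  let ?c = "chart_at A p"
  note c = atlas_chart[OF chart_at(1)[of p]]
  have o: "open (fst ?c)" "open (snd ?c ` fst ?c)" using c unfolding is_chart_def by auto
  let ?F = "\<lambda>q. snd ?c q \<bullet> b"
  have ceq: "x \<bullet> b = ?F (chart_inv ?c x)" if "x \<in> snd ?c ` fst ?c" for x
    using that by (auto simp: chart_inv_left[OF c])
  have "smooth_on (snd ?c ` fst ?c) (\<lambda>x. x \<bullet> b)"
    using o(2) bounded_linear_inner_left by (rule smooth_on_linear)
  then have "smooth_on (snd ?c ` fst ?c) (\<lambda>x. ?F (chart_inv ?c x))"
    using o(2) ceq by (rule smooth_on_cong)
  then have F: "smooth_function A (fst ?c) ?F"
    by (rule smooth_function_from_chart[OF atlas_admissible[OF chart_at(1)] o(1) order_refl])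
  have "((\<lambda>x. x \<bullet> b) has_derivative (\<lambda>v. v \<bullet> b)) (at (snd ?c p))"
    using bounded_linear_inner_left by (rule bounded_linear_imp_has_derivative)
  then have "((\<lambda>x. ?F (chart_inv ?c x)) has_derivative (\<lambda>v. v \<bullet> b)) (at (snd ?c p))"
    using o(2) _ ceq by (rule has_derivative_transform_within_open) (use chart_at(2) in blast)
  then have d: "differential A ?F p = (\<lambda>v. v \<bullet> b)"
    unfolding differential_def by (rule frechet_derivative_at[symmetric])
  have n: "function_near A UNIV p ?F"
    by (rule function_nearI[OF o(1) chart_at(2) F]) simp
  show "u \<bullet> b = v \<bullet> b"
    using dir_deriv_eq[OF assms(1) o(1) chart_at(2) F refl] dir_deriv_eq[OF assms(2) o(1) chart_at(2) F refl]
      assms(3)[OF n] unfolding d by simp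
qed

end

section \<open>Levi-Civita connections and their curvature\<close>

text \<open>The algebraic pair symmetry of curvature tensors, restricted to arguments with property \<open>P\<close>: it
  is used for vector fields defined near a point.\<close>

lemma pair_symmetry:
  fixes r :: "'a \<Rightarrow> 'a \<Rightarrow> 'a \<Rightarrow> 'a \<Rightarrow> real"
  assumes "\<And>x y z w. P x \<Longrightarrow> P y \<Longrightarrow> P z \<Longrightarrow> P w \<Longrightarrow> r y x z w = - r x y z w"
    and "\<And>x y z w. P x \<Longrightarrow> P y \<Longrightarrow> P z \<Longrightarrow> P w \<Longrightarrow> r x y w z = - r x y z w"
    and "\<And>x y z w. P x \<Longrightarrow> P y \<Longrightarrow> P z \<Longrightarrow> P w \<Longrightarrow> r x y z w + r y z x w + r z x y w = 0"
    and P: "P x" "P y" "P z" "P w"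
  shows "r x y z w = r z w x y"
  using assms(3)[OF P(1,2,3,4)] assms(3)[OF P(2,3,4,1)] assms(3)[OF P(3,4,1,2)] assms(3)[OF P(4,1,2,3)]
    assms(1)[OF P(1,2,3,4)] assms(1)[OF P(1,2,4,3)] assms(1)[OF P(1,3,2,4)] assms(1)[OF P(1,3,4,2)]
    assms(1)[OF P(1,4,2,3)] assms(1)[OF P(1,4,3,2)] assms(1)[OF P(2,3,1,4)] assms(1)[OF P(2,3,4,1)]
    assms(1)[OF P(2,4,1,3)] assms(1)[OF P(2,4,3,1)] assms(1)[OF P(3,4,1,2)] assms(1)[OF P(3,4,2,1)]
    assms(2)[OF P(1,2,3,4)] assms(2)[OF P(1,3,2,4)] assms(2)[OF P(1,4,2,3)] assms(2)[OF P(2,3,1,4)]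
    assms(2)[OF P(2,4,1,3)] assms(2)[OF P(3,4,1,2)]
  by linarith

text \<open>A non-degenerate submanifold \<open>S\<close> with its Levi-Civita connection. The ambient manifold, \<open>S = UNIV\<close>,
  is the other instance used below.\<close>

locale levi_civita_manifold = smooth_manifold A
  for A :: "('p::topological_space, 'e::euclidean_space) chart set" +
  fixes k :: nat and S :: "'p set" and g :: "('p, 'e) metric" and D :: "('p, 'e) connection"
  assumes sub: "submanifold A k S"
    and g_bilinear: "bilinear (g p)"
    and g_sym: "g p v w = g p w v"
    and g_smooth: "open U \<Longrightarrow> smooth_field A U X \<Longrightarrow> smooth_field A U Y \<Longrightarrow>
      smooth_function A U (\<lambda>q. g q (X q) (Y q))"
    and nondeg: "p \<in> S \<Longrightarrow> nondegenerate_on (g p) (tangent_space A S p)"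
    and lc: "levi_civita A S g D"
begin

abbreviation T :: "'p \<Rightarrow> 'e set" where "T p \<equiv> tangent_space A S p"

lemma T_subspace: "p \<in> S \<Longrightarrow> subspace (T p)"
  using tangent_space_subspace(1)[OF sub] .

lemma T_closed:
  "p \<in> S \<Longrightarrow> v \<in> T p \<Longrightarrow> w \<in> T p \<Longrightarrow> v + w \<in> T p"
  "p \<in> S \<Longrightarrow> v \<in> T p \<Longrightarrow> w \<in> T p \<Longrightarrow> v - w \<in> T p"
  "p \<in> S \<Longrightarrow> v \<in> T p \<Longrightarrow> a *\<^sub>R v \<in> T p"
  "p \<in> S \<Longrightarrow> v \<in> T p \<Longrightarrow> - v \<in> T p"
  "p \<in> S \<Longrightarrow> 0 \<in> T p"
  using T_subspace subspace_add subspace_diff subspace_scale subspace_neg subspace_0 by metis+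

lemma g_simps:
  "g p (u + v) w = g p u w + g p v w" "g p u (v + w) = g p u v + g p u w"
  "g p (u - v) w = g p u w - g p v w" "g p u (v - w) = g p u v - g p u w"
  "g p (a *\<^sub>R u) w = a * g p u w" "g p u (a *\<^sub>R w) = a * g p u w"
  "g p (- u) w = - g p u w" "g p u (- w) = - g p u w"
  "g p 0 w = 0" "g p u 0 = 0"
  using g_bilinear[of p]
  by (simp_all add: bilinear_ladd bilinear_radd bilinear_lsub bilinear_rsub bilinear_lmul bilinear_rmul
      bilinear_lneg bilinear_rneg bilinear_lzero bilinear_rzero)

lemma tangent_eqI:
  assumes "p \<in> S" "u \<in> T p" "v \<in> T p" "\<And>w. w \<in> T p \<Longrightarrow> g p u w = g p v w"
  shows "u = v"
proof -
  have "u - v \<in> T p" using T_closed(2) assms by blast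
  moreover have "\<forall>w\<in>T p. g p (u - v) w = 0" using assms(4) by (simp add: g_simps)
  ultimately have "u - v = 0" using nondeg[OF assms(1)] unfolding nondegenerate_on_def by blast
  then show ?thesis by simp
qed

lemma function_near_metric:
  assumes "section_near A S' p X" "section_near A S' p Y"
  shows "function_near A S' p (\<lambda>q. g q (X q) (Y q))"
proof -
  obtain U F G where U: "open U" "p \<in> U" "smooth_field A U F" "smooth_field A U G"
    "\<forall>q\<in>S' \<inter> U. X q = F q" "\<forall>q\<in>S' \<inter> U. Y q = G q"
    by (rule section_near2[OF assms])
  show ?thesis by (rule function_nearI[OF U(1,2) g_smooth[OF U(1,3,4)]]) (use U in auto)
qed

lemma connection: "p \<in> S \<Longrightarrow> field_near A S p Y \<Longrightarrow> v \<in> T p \<Longrightarrow> D p v Y \<in> T p"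
  and D_linear: "p \<in> S \<Longrightarrow> field_near A S p Y \<Longrightarrow> v \<in> T p \<Longrightarrow> w \<in> T p \<Longrightarrow>
    D p (a *\<^sub>R v + b *\<^sub>R w) Y = a *\<^sub>R D p v Y + b *\<^sub>R D p w Y"
  and D_add: "p \<in> S \<Longrightarrow> field_near A S p Y \<Longrightarrow> field_near A S p Z \<Longrightarrow> v \<in> T p \<Longrightarrow>
    D p v (\<lambda>q. Y q + Z q) = D p v Y + D p v Z"
  and D_Leibniz: "p \<in> S \<Longrightarrow> function_near A S p f \<Longrightarrow> field_near A S p Y \<Longrightarrow> v \<in> T p \<Longrightarrow>
    D p v (\<lambda>q. f q *\<^sub>R Y q) = dir_deriv A S p v f *\<^sub>R Y p + f p *\<^sub>R D p v Y"
  and D_field: "p \<in> S \<Longrightarrow> field_near A S p X \<Longrightarrow> field_near A S p Y \<Longrightarrow>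
    field_near A S p (\<lambda>q. D q (X q) Y)"
  using lc unfolding levi_civita_def connection_on_def Let_def by blast+

lemma D_bracket: "p \<in> S \<Longrightarrow> field_near A S p X \<Longrightarrow> field_near A S p Y \<Longrightarrow>
    is_lie_bracket A S p X Y (D p (X p) Y - D p (Y p) X)"
  and D_metric: "p \<in> S \<Longrightarrow> field_near A S p X \<Longrightarrow> field_near A S p Y \<Longrightarrow> v \<in> T p \<Longrightarrow>
    dir_deriv A S p v (\<lambda>q. g q (X q) (Y q)) = g p (D p v X) (Y p) + g p (X p) (D p v Y)"
  using lc unfolding levi_civita_def by blast+

lemma D_scaleR_vector:
  "p \<in> S \<Longrightarrow> field_near A S p Y \<Longrightarrow> v \<in> T p \<Longrightarrow> D p (a *\<^sub>R v) Y = a *\<^sub>R D p v Y"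
  using D_linear[of p Y v v a 0] by simp

lemma field_near_add:
  assumes "field_near A S p X" "field_near A S p Y"
  shows "field_near A S p (\<lambda>q. X q + Y q)"
proof -
  obtain U where "open U" "p \<in> U" "\<forall>q\<in>U. field_near A S q X" using field_near_open[OF assms(1)] by blast
  moreover obtain V where "open V" "p \<in> V" "\<forall>q\<in>V. field_near A S q Y" using field_near_open[OF assms(2)] by blast
  ultimately show ?thesis
    using section_near_add[OF assms[THEN field_near_section]]
    by (intro field_nearI[of _ _ _ "U \<inter> V"]) (auto intro: T_closed field_near_tangent)
qed

lemma field_near_scaleR:
  assumes "function_near A S p f" "field_near A S p Y"
  shows "field_near A S p (\<lambda>q. f q *\<^sub>R Y q)"
proof -
  obtain V where "open V" "p \<in> V" "\<forall>q\<in>V. field_near A S q Y" using field_near_open[OF assms(2)] by blast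
  then show ?thesis
    using section_near_scaleR[OF assms(1) assms(2)[THEN field_near_section]]
    by (intro field_nearI[of _ _ _ V]) (auto intro: T_closed field_near_tangent)
qed

lemma field_near_diff:
  assumes "field_near A S p X" "field_near A S p Y"
  shows "field_near A S p (\<lambda>q. X q - Y q)"
  using field_near_add[OF assms(1) field_near_scaleR[OF function_near_const[of S p "-1"] assms(2)]] by simp

lemma D_scaleR:
  assumes "p \<in> S" "field_near A S p Y" "v \<in> T p"
  shows "D p v (\<lambda>q. a *\<^sub>R Y q) = a *\<^sub>R D p v Y"
  using D_Leibniz[OF assms(1) function_near_const[of S p a] assms(2,3)] dir_deriv_const[OF assms(3)] by simp

lemma D_diff:
  assumes "p \<in> S" "field_near A S p Y" "field_near A S p Z" "v \<in> T p"
  shows "D p v (\<lambda>q. Y q - Z q) = D p v Y - D p v Z"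
  using D_add[OF assms(1,2) field_near_scaleR[OF function_near_const[of S p "-1"] assms(3)] assms(4)]
    D_scaleR[OF assms(1,3,4), of "-1"] by simp

lemma extend_field:
  assumes "p \<in> S" "v \<in> T p"
  shows "field_near A S p (extend A S p v)" "extend A S p v p = v"
  using extend[OF sub assms] by auto

text \<open>Metric compatibility, \<open>g (D\<^sub>v Y) Z = v (g Y Z) - g Y (D\<^sub>v Z)\<close>, expresses the derivative through
  the values of \<open>Y\<close> near the point. As \<open>g\<close> is non-degenerate, \<open>D\<close> is local. The same device replaces
  arguments with local frames throughout.\<close>

lemma D_cong:
  assumes p: "p \<in> S" "v \<in> T p" and Y: "field_near A S p Y" and W: "open W" "p \<in> W"
    and eq: "\<And>q. q \<in> S \<inter> W \<Longrightarrow> Y q = Y' q"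
  shows "D p v Y = D p v Y'"
proof -
  have Y': "field_near A S p Y'" using field_near_cong[OF Y W eq] .
  show ?thesis
  proof (rule tangent_eqI[OF p(1) connection[OF p(1) Y p(2)] connection[OF p(1) Y' p(2)]])
    fix w assume w: "w \<in> T p"
    define Z where "Z = extend A S p w"
    have Z: "field_near A S p Z" "Z p = w" unfolding Z_def using extend_field[OF p(1) w] by auto
    have "dir_deriv A S p v (\<lambda>q. g q (Y q) (Z q)) = dir_deriv A S p v (\<lambda>q. g q (Y' q) (Z q))"
      by (rule dir_deriv_cong[OF p(2,2) order_refl function_near_metric[OF Y'[THEN field_near_section] Z(1)[THEN field_near_section]] W])
        (use eq in auto)
    moreover have "Y p = Y' p" using eq p W by auto
    ultimately show "g p (D p v Y) w = g p (D p v Y') w"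
      using D_metric[OF p(1) Y Z(1) p(2)] D_metric[OF p(1) Y' Z(1) p(2)] Z(2) by simp
  qed
qed

lemma lie_bracket_unique:
  assumes "is_lie_bracket A S p X Y u" "is_lie_bracket A S p X Y u'"
  shows "u = u'"
  by (rule dir_deriv_separates[of _ S p])
    (use assms function_near_restrict in \<open>auto simp: is_lie_bracket_def\<close>)

text \<open>Brackets are never computed in coordinates: a torsion free connection provides one, and it is
  unique.\<close>

lemma lie_bracket_eq:
  assumes "p \<in> S" "field_near A S p X" "field_near A S p Y"
  shows "lie_bracket A S X Y p = D p (X p) Y - D p (Y p) X"
  unfolding lie_bracket_def using D_bracket[OF assms] lie_bracket_unique by blast

lemma bracket_tangent:
  assumes "p \<in> S" "field_near A S p X" "field_near A S p Y"
  shows "D p (X p) Y - D p (Y p) X \<in> T p"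
  using D_bracket[OF assms] unfolding is_lie_bracket_def by blast

lemma bracket_dir_deriv:
  assumes "p \<in> S" "field_near A S p X" "field_near A S p Y" "function_near A S p f"
  shows "dir_deriv A S p (D p (X p) Y - D p (Y p) X) f =
    dir_deriv A S p (X p) (\<lambda>q. dir_deriv A S q (Y q) f) - dir_deriv A S p (Y p) (\<lambda>q. dir_deriv A S q (X q) f)"
  using D_bracket[OF assms(1-3)] assms(4) unfolding is_lie_bracket_def by blast

text \<open>The curvature for given fields, before it is known to be a tensor.\<close>

definition riemann :: "('p \<Rightarrow> 'e) \<Rightarrow> ('p \<Rightarrow> 'e) \<Rightarrow> ('p \<Rightarrow> 'e) \<Rightarrow> 'p \<Rightarrow> 'e" where
  "riemann X Y Z p = D p (X p) (\<lambda>q. D q (Y q) Z) - D p (Y p) (\<lambda>q. D q (X q) Z)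
     - D p (D p (X p) Y - D p (Y p) X) Z"

lemma curvature_riemann:
  assumes "p \<in> S" "x \<in> T p" "y \<in> T p"
  shows "curvature A S D p x y z = riemann (extend A S p x) (extend A S p y) (extend A S p z) p"
  unfolding curvature_def riemann_def Let_def
  using lie_bracket_eq[OF assms(1) extend_field(1)[OF assms(1,2)] extend_field(1)[OF assms(1,3)]]
    extend_field(2)[OF assms(1)] assms(2,3) by simp

lemma riemann_tangent:
  assumes "p \<in> S" "field_near A S p X" "field_near A S p Y" "field_near A S p Z"
  shows "riemann X Y Z p \<in> T p"
  unfolding riemann_def
  by (intro T_closed connection D_field bracket_tangent assms field_near_tangent)

lemma riemann_swap:
  assumes "p \<in> S" "field_near A S p X" "field_near A S p Y" "field_near A S p Z"
  shows "riemann Y X Z p = - riemann X Y Z p"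
  unfolding riemann_def
  using D_scaleR_vector[OF assms(1,4) bracket_tangent[OF assms(1-3)], of "-1"] by simp

text \<open>Expand the three terms of \<open>[X, Y] g(Z, W) = X Y g(Z, W) - Y X g(Z, W)\<close> by metric compatibility:
  the products of first derivatives cancel.\<close>

lemma riemann_skew:
  assumes p: "p \<in> S" and X: "field_near A S p X" and Y: "field_near A S p Y"
    and Z: "field_near A S p Z" and W: "field_near A S p W"
  shows "g p (riemann X Y Z p) (W p) = - g p (Z p) (riemann X Y W p)"
proof -
  note s = field_near_section and fm = function_near_metric[of S p]
  have second: "dir_deriv A S p (X p) (\<lambda>q. dir_deriv A S q (Y q) (\<lambda>r. g r (Z r) (W r))) =
      g p (D p (X p) (\<lambda>q. D q (Y q) Z)) (W p) + g p (D p (Y p) Z) (D p (X p) W)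
      + (g p (D p (X p) Z) (D p (Y p) W) + g p (Z p) (D p (X p) (\<lambda>q. D q (Y q) W)))"
    if X: "field_near A S p X" and Y: "field_near A S p Y" for X Y
  proof -
    obtain U1 where U1: "open U1" "p \<in> U1" "\<forall>q\<in>U1. field_near A S q Y" using field_near_open[OF Y] by blast
    obtain U2 where U2: "open U2" "p \<in> U2" "\<forall>q\<in>U2. field_near A S q Z" using field_near_open[OF Z] by blast
    obtain U3 where U3: "open U3" "p \<in> U3" "\<forall>q\<in>U3. field_near A S q W" using field_near_open[OF W] by blast
    note x = field_near_tangent[OF X p]
    note DZ = D_field[OF p Y Z] and DW = D_field[OF p Y W]
    have "dir_deriv A S p (X p) (\<lambda>q. dir_deriv A S q (Y q) (\<lambda>r. g r (Z r) (W r))) =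
        dir_deriv A S p (X p) (\<lambda>q. g q (D q (Y q) Z) (W q) + g q (Z q) (D q (Y q) W))"
    proof (rule dir_deriv_cong[OF x x order_refl])
      show "function_near A S p (\<lambda>q. g q (D q (Y q) Z) (W q) + g q (Z q) (D q (Y q) W))"
        by (intro function_near_add fm s DZ DW Z W)
      show "open (U1 \<inter> U2 \<inter> U3)" "p \<in> U1 \<inter> U2 \<inter> U3" using U1 U2 U3 by auto
      fix q assume "q \<in> S \<inter> (U1 \<inter> U2 \<inter> U3)"
      then show "dir_deriv A S q (Y q) (\<lambda>r. g r (Z r) (W r)) = g q (D q (Y q) Z) (W q) + g q (Z q) (D q (Y q) W)"
        using U1 U2 U3 by (intro D_metric field_near_tangent) auto
    qed
    also have "\<dots> = dir_deriv A S p (X p) (\<lambda>q. g q (D q (Y q) Z) (W q)) +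
        dir_deriv A S p (X p) (\<lambda>q. g q (Z q) (D q (Y q) W))"
      by (rule dir_deriv_add[OF x]; intro fm s DZ DW Z W)
    finally show ?thesis using D_metric[OF p DZ W x] D_metric[OF p Z DW x] by simp
  qed
  note b = bracket_tangent[OF p X Y]
  show ?thesis
    using bracket_dir_deriv[OF p X Y fm[OF s[OF Z] s[OF W]]] second[OF X Y] second[OF Y X]
      D_metric[OF p Z W b] g_sym
    unfolding riemann_def by (simp add: g_simps)
qed

text \<open>By torsion freeness the cyclic sum of the curvature is the cyclic sum of \<open>[X, [Y, Z]]\<close>, which is
  zero because its action on every function is.\<close>

lemma riemann_Bianchi:
  assumes p: "p \<in> S" and X: "field_near A S p X" and Y: "field_near A S p Y" and Z: "field_near A S p Z"
  shows "riemann X Y Z p + riemann Y Z X p + riemann Z X Y p = 0"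
proof -
  define B where "B X Y = (\<lambda>q. D q (X q) Y - D q (Y q) X)" for X Y
  have B: "field_near A S p (B X Y)" if "field_near A S p X" "field_near A S p Y" for X Y
    unfolding B_def by (intro field_near_diff D_field p that)
  note t = field_near_tangent[OF _ p]
  have DB: "D p (X p) (B Y Z) = D p (X p) (\<lambda>q. D q (Y q) Z) - D p (X p) (\<lambda>q. D q (Z q) Y)"
    if "field_near A S p X" "field_near A S p Y" "field_near A S p Z" for X Y Z
    unfolding B_def by (intro D_diff D_field p t that)
  define J where "J X Y Z = B X (B Y Z) p" for X Y Z
  have sum: "riemann X Y Z p + riemann Y Z X p + riemann Z X Y p = J X Y Z + J Y Z X + J Z X Y"
    unfolding riemann_def J_def B_def[of _ "B _ _"]
    using DB[OF X Y Z] DB[OF Y Z X] DB[OF Z X Y] by (simp add: B_def)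
  have JT: "J X Y Z \<in> T p" if "field_near A S p X" "field_near A S p Y" "field_near A S p Z" for X Y Z
    unfolding J_def by (intro t B that)
  let ?d = "\<lambda>X f q. dir_deriv A S q (X q) f"
  have Jd: "dir_deriv A S p (J X Y Z) f =
      dir_deriv A S p (X p) (?d Y (?d Z f)) - dir_deriv A S p (X p) (?d Z (?d Y f))
      - (dir_deriv A S p (Y p) (?d Z (?d X f)) - dir_deriv A S p (Z p) (?d Y (?d X f)))"
    if X: "field_near A S p X" and Y: "field_near A S p Y" and Z: "field_near A S p Z"
      and f: "function_near A S p f" for X Y Z f
  proof -
    obtain U1 where U1: "open U1" "p \<in> U1" "\<forall>q\<in>U1. field_near A S q Y" using field_near_open[OF Y] by blast
    obtain U2 where U2: "open U2" "p \<in> U2" "\<forall>q\<in>U2. field_near A S q Z" using field_near_open[OF Z] by blast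
    obtain U3 where U3: "open U3" "p \<in> U3" "\<forall>q\<in>U3. function_near A S q f" using function_near_open[OF f] by blast
    note fd = function_near_dir_deriv
    have "dir_deriv A S p (X p) (?d (B Y Z) f) = dir_deriv A S p (X p) (\<lambda>q. ?d Y (?d Z f) q - ?d Z (?d Y f) q)"
    proof (rule dir_deriv_cong[OF t[OF X] t[OF X] order_refl])
      show "function_near A S p (\<lambda>q. ?d Y (?d Z f) q - ?d Z (?d Y f) q)"
        by (intro function_near_diff fd f Y Z)
      show "open (U1 \<inter> U2 \<inter> U3)" "p \<in> U1 \<inter> U2 \<inter> U3" using U1 U2 U3 by auto
      fix q assume "q \<in> S \<inter> (U1 \<inter> U2 \<inter> U3)"
      then show "?d (B Y Z) f q = ?d Y (?d Z f) q - ?d Z (?d Y f) q"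
        using U1 U2 U3 bracket_dir_deriv[of q Y Z f] unfolding B_def by auto
    qed
    also have "\<dots> = dir_deriv A S p (X p) (?d Y (?d Z f)) - dir_deriv A S p (X p) (?d Z (?d Y f))"
      by (rule dir_deriv_diff[OF t[OF X]]; intro fd f Y Z)
    finally show ?thesis
      using bracket_dir_deriv[OF p X B[OF Y Z] f] bracket_dir_deriv[OF p Y Z fd[OF f X]]
      unfolding J_def B_def by simp
  qed
  have "J X Y Z + J Y Z X + J Z X Y = 0"
  proof (rule dir_deriv_separates[of _ S p])
    show "J X Y Z + J Y Z X + J Z X Y \<in> T p" by (intro T_closed p JT X Y Z)
    show "0 \<in> T p" using T_closed(5)[OF p] .
    fix f assume "function_near A UNIV p f"
    then have f: "function_near A S p f" by (rule function_near_restrict)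
    have zero: "dir_deriv A S p 0 f = 0"
      using dir_deriv_add_vector[OF sub p T_closed(5)[OF p] T_closed(5)[OF p] f] by simp
    note da = dir_deriv_add_vector[OF sub p]
    have "dir_deriv A S p (J X Y Z + J Y Z X + J Z X Y) f =
        dir_deriv A S p (J X Y Z) f + dir_deriv A S p (J Y Z X) f + dir_deriv A S p (J Z X Y) f"
      using da[OF T_closed(1)[OF p JT[OF X Y Z] JT[OF Y Z X]] JT[OF Z X Y] f]
        da[OF JT[OF X Y Z] JT[OF Y Z X] f] by simp
    then show "dir_deriv A S p (J X Y Z + J Y Z X + J Z X Y) f = dir_deriv A S p 0 f"
      using Jd[OF X Y Z f] Jd[OF Y Z X f] Jd[OF Z X Y f] zero by simp
  qed
  then show ?thesis using sum by simp
qed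

text \<open>\<open>g (R(X, Y) Z) W = - g Z (R(X, Y) W)\<close> involves \<open>Z\<close> and \<open>W\<close> only through their values, and pair
  symmetry transfers this to \<open>X\<close> and \<open>Y\<close>.\<close>

lemma riemann_tensorial:
  assumes p: "p \<in> S" and X: "field_near A S p X" "field_near A S p X'" "X p = X' p"
    and Y: "field_near A S p Y" "field_near A S p Y'" "Y p = Y' p"
    and Z: "field_near A S p Z" "field_near A S p Z'" "Z p = Z' p"
  shows "riemann X Y Z p = riemann X' Y' Z' p"
proof (rule tangent_eqI[OF p riemann_tangent[OF p X(1) Y(1) Z(1)] riemann_tangent[OF p X(2) Y(2) Z(2)]])
  let ?P = "\<lambda>X. field_near A S p X"
  define r where "r X Y Z W = g p (riemann X Y Z p) (W p)" for X Y Z W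
  have skew: "r X Y Z W = - g p (Z p) (riemann X Y W p)" if "?P X" "?P Y" "?P Z" "?P W" for X Y Z W
    unfolding r_def using riemann_skew[OF p that] .
  have sym: "r X Y Z W = r Z W X Y" if "?P X" "?P Y" "?P Z" "?P W" for X Y Z W
  proof (rule pair_symmetry[where P = ?P])
    show "r Y X Z W = - r X Y Z W" if "?P X" "?P Y" "?P Z" "?P W" for X Y Z W
      unfolding r_def using riemann_swap[OF p that(1-3)] by (simp add: g_simps)
    show "r X Y W Z = - r X Y Z W" if "?P X" "?P Y" "?P Z" "?P W" for X Y Z W
      using skew[OF that] g_sym unfolding r_def by simp
    show "r X Y Z W + r Y Z X W + r Z X Y W = 0" if "?P X" "?P Y" "?P Z" "?P W" for X Y Z W
      unfolding r_def using riemann_Bianchi[OF p that(1-3)] by (metis g_simps(1) g_simps(9))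
  qed fact+
  fix w assume w: "w \<in> T p"
  define W where "W = extend A S p w"
  have W: "?P W" "W p = w" unfolding W_def using extend_field[OF p w] by auto
  have "r X Y Z W = r X Y Z' W" using skew[OF X(1) Y(1) _ W(1)] Z by simp
  also have "\<dots> = r Z' W X Y" using sym[OF X(1) Y(1) Z(2) W(1)] .
  also have "\<dots> = r Z' W X' Y" using skew[OF Z(2) W(1) _ Y(1)] X by simp
  also have "\<dots> = r Z' W X' Y'" unfolding r_def using Y(3) by simp
  also have "\<dots> = r X' Y' Z' W" using sym[OF Z(2) W(1) X(2) Y(2)] .
  finally show "g p (riemann X Y Z p) w = g p (riemann X' Y' Z' p) w" unfolding r_def W(2) .
qed

end

section \<open>Differentiation along a submanifold\<close>

context smooth_manifold
begin

lemma section_near_endo: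
  assumes "smooth_endo A N J" "open N" "p \<in> N" "section_near A S p X"
  shows "section_near A S p (\<lambda>q. J q (X q))"
proof -
  from assms(4) obtain U F where U: "open U" "p \<in> U" "smooth_field A U F" "\<forall>q\<in>S \<inter> U. X q = F q"
    unfolding section_near_def by blast
  have "open (U \<inter> N)" "p \<in> U \<inter> N" using U(1,2) assms(2,3) by auto
  moreover have "smooth_field A (U \<inter> N) F" by (rule smooth_field_subset[OF U(3)]) auto
  then have "smooth_field A (U \<inter> N) (\<lambda>q. J q (F q))"
    using assms(1) \<open>open (U \<inter> N)\<close> unfolding smooth_endo_def by blast
  ultimately show ?thesis by (rule section_nearI) (use U(4) in auto)
qed

end

locale riemannian_submanifold =
  amb: levi_civita_manifold A "DIM('e)" UNIV g Dt + ind: levi_civita_manifold A k M g D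
  for A :: "('p::topological_space, 'e::euclidean_space) chart set"
    and k M and g :: "('p, 'e) metric" and Dt D :: "('p, 'e) connection"
begin

abbreviation T :: "'p \<Rightarrow> 'e set" where "T p \<equiv> tangent_space A M p"
abbreviation Dalong :: "('p, 'e) connection" where "Dalong \<equiv> along A M Dt"

lemma ambient_dir_deriv:
  assumes "v \<in> T p" "function_near A UNIV p f'" "open W" "p \<in> W" "\<And>q. q \<in> M \<inter> W \<Longrightarrow> f q = f' q"
  shows "dir_deriv A M p v f = dir_deriv A UNIV p v f'"
  by (rule amb.dir_deriv_cong[OF assms(1) _ _ assms(2-5)]) (auto simp: amb.tangent_space_UNIV)

text \<open>The ambient derivative in a direction tangent to \<open>M\<close> only sees the values on \<open>M\<close>: by metric
  compatibility it is expressed through a derivative of \<open>g(X, Z)\<close> in that direction.\<close>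

lemma Dt_determined:
  assumes p: "p \<in> M" "x \<in> T p" and X: "section_near A UNIV p X" "section_near A UNIV p X'"
    and W: "open W" "p \<in> W" "\<And>q. q \<in> M \<inter> W \<Longrightarrow> X q = X' q"
  shows "Dt p x X = Dt p x X'"
proof (rule amb.tangent_eqI[of p])
  show "p \<in> UNIV" "Dt p x X \<in> amb.T p" "Dt p x X' \<in> amb.T p" by (auto simp: amb.tangent_space_UNIV)
  fix w
  define Z where "Z = extend A UNIV p w"
  have Z: "field_near A UNIV p Z" "Z p = w"
    unfolding Z_def using amb.extend_field[of p w] by (auto simp: amb.tangent_space_UNIV)
  note f = X[folded amb.field_near_UNIV]
  have "dir_deriv A UNIV p x (\<lambda>q. g q (X q) (Z q)) = dir_deriv A UNIV p x (\<lambda>q. g q (X' q) (Z q))"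
    using ambient_dir_deriv[OF p(2) amb.function_near_metric[OF X(1) Z(1)[THEN amb.field_near_section]] W(1,2), of "\<lambda>q. g q (X q) (Z q)"]
      ambient_dir_deriv[OF p(2) amb.function_near_metric[OF X(2) Z(1)[THEN amb.field_near_section]] W(1,2), of "\<lambda>q. g q (X q) (Z q)"]
      W(3) by auto
  moreover have "X p = X' p" using W p by auto
  ultimately show "g p (Dt p x X) w = g p (Dt p x X') w"
    using amb.D_metric[OF UNIV_I f(1) Z(1), of x] amb.D_metric[OF UNIV_I f(2) Z(1), of x] Z(2)
    by (simp add: amb.tangent_space_UNIV)
qed

lemma along_eq:
  assumes "p \<in> M" "x \<in> T p" "section_near A UNIV p X" "open W" "p \<in> W" "\<And>q. q \<in> M \<inter> W \<Longrightarrow> \<xi> q = X q"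
  shows "Dalong p x \<xi> = Dt p x X"
proof -
  let ?P = "\<lambda>X. section_near A UNIV p X \<and> (\<exists>U. open U \<and> p \<in> U \<and> (\<forall>q\<in>M \<inter> U. X q = \<xi> q))"
  have "?P X" using assms(3-6) by auto
  then have "?P (SOME X. ?P X)" by (rule someI[of ?P])
  then obtain U where "section_near A UNIV p (SOME X. ?P X)" and
    U: "open U" "p \<in> U" "\<forall>q\<in>M \<inter> U. (SOME X. ?P X) q = \<xi> q" by blast
  then have "Dt p x (SOME X. ?P X) = Dt p x X"
    by (intro Dt_determined[of _ _ _ _ "U \<inter> W"] assms) (use assms in auto)
  then show ?thesis unfolding along_def .
qed

lemma along_cong:
  assumes "p \<in> M" "x \<in> T p" "section_near A M p \<xi>" "open W" "p \<in> W" "\<And>q. q \<in> M \<inter> W \<Longrightarrow> \<xi> q = \<eta> q"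
  shows "Dalong p x \<xi> = Dalong p x \<eta>"
proof -
  obtain X U where X: "section_near A UNIV p X" "open U" "p \<in> U" "\<And>q. q \<in> M \<inter> U \<Longrightarrow> \<xi> q = X q"
    by (rule amb.section_near_lift[OF assms(3)]) blast
  have "Dalong p x \<eta> = Dt p x X"
    by (rule along_eq[OF assms(1,2) X(1), of "U \<inter> W"]) (use X assms in \<open>auto simp flip: assms(6)\<close>)
  then show ?thesis using along_eq[OF assms(1,2) X] by simp
qed

lemma along_add:
  assumes p: "p \<in> M" "x \<in> T p" and \<xi>: "section_near A M p \<xi>" and \<eta>: "section_near A M p \<eta>"
  shows "Dalong p x (\<lambda>q. \<xi> q + \<eta> q) = Dalong p x \<xi> + Dalong p x \<eta>"
proof -
  obtain X U where X: "section_near A UNIV p X" "open U" "p \<in> U" "\<And>q. q \<in> M \<inter> U \<Longrightarrow> \<xi> q = X q"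
    by (rule amb.section_near_lift[OF \<xi>]) blast
  obtain Y V where Y: "section_near A UNIV p Y" "open V" "p \<in> V" "\<And>q. q \<in> M \<inter> V \<Longrightarrow> \<eta> q = Y q"
    by (rule amb.section_near_lift[OF \<eta>]) blast
  have "Dalong p x (\<lambda>q. \<xi> q + \<eta> q) = Dt p x (\<lambda>q. X q + Y q)"
    by (rule along_eq[OF p amb.section_near_add[OF X(1) Y(1)], of "U \<inter> V"]) (use X Y in auto)
  then show ?thesis
    using along_eq[OF p X] along_eq[OF p Y] amb.D_add[of p X Y x] X(1) Y(1)
    by (simp add: amb.field_near_UNIV amb.tangent_space_UNIV)
qed

lemma along_linear:
  assumes p: "p \<in> M" "x \<in> T p" "y \<in> T p" and \<xi>: "section_near A M p \<xi>"
  shows "Dalong p (a *\<^sub>R x + b *\<^sub>R y) \<xi> = a *\<^sub>R Dalong p x \<xi> + b *\<^sub>R Dalong p y \<xi>"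
proof -
  obtain X U where X: "section_near A UNIV p X" "open U" "p \<in> U" "\<And>q. q \<in> M \<inter> U \<Longrightarrow> \<xi> q = X q"
    by (rule amb.section_near_lift[OF \<xi>]) blast
  have "a *\<^sub>R x + b *\<^sub>R y \<in> T p" by (intro ind.T_closed p)
  then show ?thesis
    using along_eq[OF p(1) _ X] p amb.D_linear[of p X x y a b] X(1)
    by (simp add: amb.field_near_UNIV amb.tangent_space_UNIV)
qed

lemma along_metric:
  assumes p: "p \<in> M" "x \<in> T p" and \<xi>: "section_near A M p \<xi>" and \<eta>: "section_near A M p \<eta>"
  shows "dir_deriv A M p x (\<lambda>q. g q (\<xi> q) (\<eta> q)) = g p (Dalong p x \<xi>) (\<eta> p) + g p (\<xi> p) (Dalong p x \<eta>)"
proof -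
  obtain X U where X: "section_near A UNIV p X" "open U" "p \<in> U" "\<And>q. q \<in> M \<inter> U \<Longrightarrow> \<xi> q = X q"
    by (rule amb.section_near_lift[OF \<xi>]) blast
  obtain Y V where Y: "section_near A UNIV p Y" "open V" "p \<in> V" "\<And>q. q \<in> M \<inter> V \<Longrightarrow> \<eta> q = Y q"
    by (rule amb.section_near_lift[OF \<eta>]) blast
  have "dir_deriv A M p x (\<lambda>q. g q (\<xi> q) (\<eta> q)) = dir_deriv A UNIV p x (\<lambda>q. g q (X q) (Y q))"
    by (rule ambient_dir_deriv[OF p(2) amb.function_near_metric[OF X(1) Y(1)], of "U \<inter> V"]) (use X Y in auto)
  then show ?thesis
    using along_eq[OF p X] along_eq[OF p Y] amb.D_metric[of p X Y x] X Y p
    by (simp add: amb.field_near_UNIV amb.tangent_space_UNIV)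
qed

text \<open>The extensions of \<open>X\<close> and \<open>\<xi>\<close> from \<open>M\<close> chosen at one point serve for all points nearby.
  This allows iterating the derivative along \<open>M\<close>.\<close>

lemma along_lift:
  assumes X: "field_near A M p X" and \<xi>: "section_near A M p \<xi>"
    and X': "section_near A UNIV p X'" "open U" "p \<in> U" "\<And>q. q \<in> M \<inter> U \<Longrightarrow> X q = X' q"
    and \<xi>': "section_near A UNIV p \<xi>'" "open V" "p \<in> V" "\<And>q. q \<in> M \<inter> V \<Longrightarrow> \<xi> q = \<xi>' q"
  obtains W where "open W" "p \<in> W" "\<forall>q\<in>M \<inter> W. Dalong q (X q) \<xi> = Dt q (X' q) \<xi>'"
proof -
  obtain U1 where U1: "open U1" "p \<in> U1" "\<forall>q\<in>U1. field_near A M q X"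
    using amb.field_near_open[OF X] by blast
  obtain U2 where U2: "open U2" "p \<in> U2" "\<forall>q\<in>U2. section_near A UNIV q \<xi>'"
    using amb.section_near_open[OF \<xi>'(1)] by blast
  show ?thesis
  proof (rule that[of "U \<inter> V \<inter> U1 \<inter> U2"]; (intro ballI)?)
    fix q assume q: "q \<in> M \<inter> (U \<inter> V \<inter> U1 \<inter> U2)"
    then have "X q \<in> T q" using U1(3) amb.field_near_tangent by blast
    then have "Dalong q (X q) \<xi> = Dt q (X q) \<xi>'"
      by (intro along_eq[of _ _ _ V]) (use q U2(3) \<xi>' in auto)
    then show "Dalong q (X q) \<xi> = Dt q (X' q) \<xi>'" using X'(4) q by auto
  qed (use assms U1 U2 in auto)
qed

lemma along_section:
  assumes X: "field_near A M p X" and \<xi>: "section_near A M p \<xi>"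
  shows "section_near A M p (\<lambda>q. Dalong q (X q) \<xi>)"
proof -
  obtain X' U where X': "section_near A UNIV p X'" "open U" "p \<in> U" "\<And>q. q \<in> M \<inter> U \<Longrightarrow> X q = X' q"
    by (rule amb.section_near_lift[OF X[THEN amb.field_near_section]]) blast
  obtain \<xi>' V where \<xi>': "section_near A UNIV p \<xi>'" "open V" "p \<in> V" "\<And>q. q \<in> M \<inter> V \<Longrightarrow> \<xi> q = \<xi>' q"
    by (rule amb.section_near_lift[OF \<xi>]) blast
  obtain W where W: "open W" "p \<in> W" "\<forall>q\<in>M \<inter> W. Dalong q (X q) \<xi> = Dt q (X' q) \<xi>'"
    by (rule along_lift[OF X \<xi> X' \<xi>'])
  have "section_near A UNIV p (\<lambda>q. Dt q (X' q) \<xi>')"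
    using amb.D_field[of p X' \<xi>'] X'(1) \<xi>'(1) by (simp add: amb.field_near_UNIV)
  then have "section_near A M p (\<lambda>q. Dt q (X' q) \<xi>')" by (rule amb.section_near_restrict)
  then show ?thesis using W(1,2) by (rule amb.section_near_cong) (use W(3) in auto)
qed

text \<open>The bracket of two fields tangent to \<open>M\<close> is the restriction of the bracket of their extensions,
  since both act in the same way on restrictions of ambient functions.\<close>

lemma along_bracket:
  assumes p: "p \<in> M" and X: "field_near A M p X" and Y: "field_near A M p Y"
  shows "Dalong p (X p) Y - Dalong p (Y p) X = D p (X p) Y - D p (Y p) X"
proof -
  note t = amb.field_near_tangent[OF _ p]
  obtain X' U where X': "section_near A UNIV p X'" "open U" "p \<in> U" "\<And>q. q \<in> M \<inter> U \<Longrightarrow> X q = X' q"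
    by (rule amb.section_near_lift[OF X[THEN amb.field_near_section]]) blast
  obtain Y' V where Y': "section_near A UNIV p Y'" "open V" "p \<in> V" "\<And>q. q \<in> M \<inter> V \<Longrightarrow> Y q = Y' q"
    by (rule amb.section_near_lift[OF Y[THEN amb.field_near_section]]) blast
  have pp: "X' p = X p" "Y' p = Y p" using X' Y' p by auto
  note ff = X'(1)[folded amb.field_near_UNIV] Y'(1)[folded amb.field_near_UNIV]
  have eq: "dir_deriv A M p (X p) (\<lambda>q. dir_deriv A M q (Y q) f) =
      dir_deriv A UNIV p (X p) (\<lambda>q. dir_deriv A UNIV q (Y' q) f)"
    if X: "field_near A M p X" and Y: "field_near A M p Y" and Y': "section_near A UNIV p Y'"
      and V: "open V" "p \<in> V" "\<And>q. q \<in> M \<inter> V \<Longrightarrow> Y q = Y' q" and f: "function_near A UNIV p f"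
    for X Y Y' V f
  proof -
    obtain U1 where U1: "open U1" "p \<in> U1" "\<forall>q\<in>U1. function_near A UNIV q f"
      using amb.function_near_open[OF f] by blast
    obtain U2 where U2: "open U2" "p \<in> U2" "\<forall>q\<in>U2. field_near A M q Y"
      using amb.field_near_open[OF Y] by blast
    show ?thesis
    proof (rule ambient_dir_deriv[OF t[OF X] amb.function_near_dir_deriv[OF f]])
      show "field_near A UNIV p Y'" using Y' by (simp add: amb.field_near_UNIV)
      show "open (U1 \<inter> U2 \<inter> V)" "p \<in> U1 \<inter> U2 \<inter> V" using U1 U2 V by auto
      fix q assume q: "q \<in> M \<inter> (U1 \<inter> U2 \<inter> V)"
      then have "Y q \<in> T q" using U2(3) amb.field_near_tangent by blast
      then have "dir_deriv A M q (Y q) f = dir_deriv A UNIV q (Y q) f"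
        by (rule ambient_dir_deriv[of _ _ _ UNIV]) (use U1(3) q in auto)
      then show "dir_deriv A M q (Y q) f = dir_deriv A UNIV q (Y' q) f" using V(3) q by auto
    qed
  qed
  have "Dt p (X p) Y' - Dt p (Y p) X' = D p (X p) Y - D p (Y p) X"
  proof (rule amb.dir_deriv_separates[of _ UNIV p])
    fix f assume f: "function_near A UNIV p f"
    note fM = amb.function_near_restrict[OF f, of M]
    have "dir_deriv A UNIV p (Dt p (X p) Y' - Dt p (Y p) X') f = dir_deriv A M p (D p (X p) Y - D p (Y p) X) f"
      using amb.bracket_dir_deriv[OF UNIV_I ff f] ind.bracket_dir_deriv[OF p X Y fM]
        eq[OF X Y Y' f] eq[OF Y X X' f] pp by simp
    also have "\<dots> = dir_deriv A UNIV p (D p (X p) Y - D p (Y p) X) f"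
      by (rule ambient_dir_deriv[OF ind.bracket_tangent[OF p X Y] f open_UNIV UNIV_I]) simp
    finally show "dir_deriv A UNIV p (Dt p (X p) Y' - Dt p (Y p) X') f =
        dir_deriv A UNIV p (D p (X p) Y - D p (Y p) X) f" .
  qed (auto simp: amb.tangent_space_UNIV)
  then show ?thesis using along_eq[OF p t[OF X] Y'] along_eq[OF p t[OF Y] X'] by simp
qed

text \<open>The definition of the ambient curvature uses arbitrary extensions of the three vectors. As it is
  tensorial, extensions of given fields along \<open>M\<close> may be used instead.\<close>

lemma curvature_along:
  assumes p: "p \<in> M" and X: "field_near A M p X" and Y: "field_near A M p Y" and \<xi>: "section_near A M p \<xi>"
  shows "curvature A UNIV Dt p (X p) (Y p) (\<xi> p) =
    Dalong p (X p) (\<lambda>q. Dalong q (Y q) \<xi>) - Dalong p (Y p) (\<lambda>q. Dalong q (X q) \<xi>) - Dalong p (D p (X p) Y - D p (Y p) X) \<xi>"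
proof -
  note t = amb.field_near_tangent[OF _ p]
  obtain X' U where X': "section_near A UNIV p X'" "open U" "p \<in> U" "\<And>q. q \<in> M \<inter> U \<Longrightarrow> X q = X' q"
    by (rule amb.section_near_lift[OF X[THEN amb.field_near_section]]) blast
  obtain Y' V where Y': "section_near A UNIV p Y'" "open V" "p \<in> V" "\<And>q. q \<in> M \<inter> V \<Longrightarrow> Y q = Y' q"
    by (rule amb.section_near_lift[OF Y[THEN amb.field_near_section]]) blast
  obtain \<xi>' V' where \<xi>': "section_near A UNIV p \<xi>'" "open V'" "p \<in> V'" "\<And>q. q \<in> M \<inter> V' \<Longrightarrow> \<xi> q = \<xi>' q"
    by (rule amb.section_near_lift[OF \<xi>]) blast
  have pp: "X' p = X p" "Y' p = Y p" "\<xi>' p = \<xi> p" using X' Y' \<xi>' p by auto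
  note ff = X'(1)[folded amb.field_near_UNIV] Y'(1)[folded amb.field_near_UNIV] \<xi>'(1)[folded amb.field_near_UNIV]
  have e: "field_near A UNIV p (extend A UNIV p v)" "extend A UNIV p v p = v" for v
    using amb.extend_field[of p v] by (auto simp: amb.tangent_space_UNIV)
  have "curvature A UNIV Dt p (X p) (Y p) (\<xi> p) = amb.riemann X' Y' \<xi>' p"
    using amb.curvature_riemann[of p "X p" "Y p" "\<xi> p"]
      amb.riemann_tensorial[OF UNIV_I e(1) ff(1) _ e(1) ff(2) _ e(1) ff(3), of "X p" "Y p" "\<xi> p"] pp e(2)
    by (simp add: amb.tangent_space_UNIV)
  moreover have "Dt p (X p) Y' - Dt p (Y p) X' = D p (X p) Y - D p (Y p) X"
    using along_bracket[OF p X Y] along_eq[OF p t[OF X] Y'] along_eq[OF p t[OF Y] X'] by simp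
  moreover have "Dalong p (D p (X p) Y - D p (Y p) X) \<xi> = Dt p (D p (X p) Y - D p (Y p) X) \<xi>'"
    by (rule along_eq[OF p ind.bracket_tangent[OF p X Y] \<xi>'])
  moreover have "Dalong p (X p) (\<lambda>q. Dalong q (Y q) \<xi>) = Dt p (X p) (\<lambda>q. Dt q (Y' q) \<xi>')"
    if X: "field_near A M p X" and Y: "field_near A M p Y" and Y': "section_near A UNIV p Y'" "open V" "p \<in> V"
      "\<And>q. q \<in> M \<inter> V \<Longrightarrow> Y q = Y' q" for X Y Y' V
  proof -
    obtain W where W: "open W" "p \<in> W" "\<forall>q\<in>M \<inter> W. Dalong q (Y q) \<xi> = Dt q (Y' q) \<xi>'"
      by (rule along_lift[OF Y \<xi> Y' \<xi>'])
    have "section_near A UNIV p (\<lambda>q. Dt q (Y' q) \<xi>')"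
      using amb.D_field[of p Y' \<xi>'] Y'(1) ff(3) by (simp add: amb.field_near_UNIV)
    then show ?thesis by (rule along_eq[OF p t[OF X] _ W(1,2) bspec[OF W(3)]])
  qed
  from this[OF X Y Y'] this[OF Y X X'] calculation show ?thesis
    unfolding amb.riemann_def by (simp add: pp)
qed

text \<open>The tangential part of the ambient derivative is metric and torsion free, like \<open>D\<close>. Their
  difference, paired with a third vector, is symmetric in the first two and skew in the last two
  arguments, hence zero.\<close>

lemma Gauss_orthogonal:
  assumes p: "p \<in> M" "x \<in> T p" and Y: "field_near A M p Y" and w: "w \<in> T p"
  shows "g p (Dalong p x Y - D p x Y) w = 0"
proof -
  define b where "b X Y Z = g p (Dalong p (X p) Y - D p (X p) Y) (Z p)" for X Y Z
  let ?P = "field_near A M p"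
  note t = amb.field_near_tangent[OF _ p(1)] and s = amb.field_near_section
  have sym: "b X Y Z = b Y X Z" if "?P X" "?P Y" for X Y Z
  proof -
    have "Dalong p (X p) Y - D p (X p) Y = Dalong p (Y p) X - D p (Y p) X"
      using along_bracket[OF p(1) that] by (simp add: algebra_simps)
    then show ?thesis unfolding b_def by simp
  qed
  have skew: "b X Y Z = - b X Z Y" if "?P X" "?P Y" "?P Z" for X Y Z
    using along_metric[OF p(1) t[OF that(1)] s[OF that(2)] s[OF that(3)]] ind.D_metric[OF p(1) that(2,3) t[OF that(1)]]
      amb.g_sym[of p "Y p"] unfolding b_def by (simp add: amb.g_simps)
  define X where "X = extend A M p x"
  define Z where "Z = extend A M p w"
  have X: "?P X" "X p = x" and Z: "?P Z" "Z p = w"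
    unfolding X_def Z_def using ind.extend_field[OF p(1)] p(2) w by auto
  have "b X Y Z = 0"
    using sym[OF X(1) Y, of Z] sym[OF Z(1) Y, of X] sym[OF Z(1) X(1), of Y]
      skew[OF X(1) Y Z(1)] skew[OF Z(1) X(1) Y] skew[OF Y X(1) Z(1)] by simp
  then show ?thesis unfolding b_def X Z .
qed

text \<open>The covariant derivative of a skew endomorphism field is tensorial, so that in its definition any
  section with the given value may be inserted.\<close>

lemma along_endo:
  assumes J: "smooth_endo A N J" "open N" "\<And>q v w. q \<in> N \<Longrightarrow> g q (J q v) w = - g q v (J q w)"
    and p: "p \<in> M" "p \<in> N" "x \<in> T p" and \<xi>: "section_near A M p \<xi>"
  shows "Dalong p x (\<lambda>q. J q (\<xi> q)) = J p (Dalong p x \<xi>) + cov_deriv_endo A UNIV Dt J p x (\<xi> p)"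
proof -
  have TU: "v \<in> amb.T q" for q v by (simp add: amb.tangent_space_UNIV)
  have JS: "section_near A UNIV p (\<lambda>q. J q (X q))" if "section_near A UNIV p X" for X
    using amb.section_near_endo[OF J(1,2) p(2) that] .
  \<comment> \<open>\<open>Dt (J X) - J (Dt X)\<close>, paired with a section, involves \<open>X\<close> only through its value at \<open>p\<close>\<close>
  have pairing: "g p (Dt p x (\<lambda>q. J q (X q)) - J p (Dt p x X)) (W p) =
      - g p (J p (X p)) (Dt p x W) - g p (X p) (Dt p x (\<lambda>q. J q (W q)))"
    if X: "section_near A UNIV p X" and W: "section_near A UNIV p W" for X W
  proof -
    note n = amb.function_near_metric
    have "dir_deriv A UNIV p x (\<lambda>q. g q (J q (X q)) (W q)) + dir_deriv A UNIV p x (\<lambda>q. g q (X q) (J q (W q))) =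
        dir_deriv A UNIV p x (\<lambda>q. g q (J q (X q)) (W q) + g q (X q) (J q (W q)))"
      by (rule amb.dir_deriv_add[symmetric]; intro TU n JS X W)
    also have "\<dots> = dir_deriv A UNIV p x (\<lambda>q. 0)"
      by (rule amb.dir_deriv_cong[OF TU TU order_refl amb.function_near_const J(2) p(2)]) (use J(3) in auto)
    also have "\<dots> = 0" by (rule amb.dir_deriv_const[OF TU])
    finally show ?thesis
      using amb.D_metric[of p "\<lambda>q. J q (X q)" W x] amb.D_metric[of p X "\<lambda>q. J q (W q)" x] X W JS
        J(3)[OF p(2), of "Dt p x X" "W p"] TU
      by (simp add: amb.field_near_UNIV amb.g_simps)
  qed
  obtain X U where X: "section_near A UNIV p X" "open U" "p \<in> U" "\<And>q. q \<in> M \<inter> U \<Longrightarrow> \<xi> q = X q"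
    by (rule amb.section_near_lift[OF \<xi>]) blast
  define Z where "Z = extend A UNIV p (\<xi> p)"
  have Z: "section_near A UNIV p Z" "Z p = \<xi> p"
    unfolding Z_def using amb.extend_field[OF UNIV_I TU, of p] by (auto simp: amb.field_near_UNIV)
  have "Dt p x (\<lambda>q. J q (X q)) - J p (Dt p x X) = Dt p x (\<lambda>q. J q (Z q)) - J p (Dt p x Z)"
  proof (rule amb.tangent_eqI[OF UNIV_I TU TU])
    fix w
    define W where "W = extend A UNIV p w"
    have W: "section_near A UNIV p W" "W p = w"
      unfolding W_def using amb.extend_field[OF UNIV_I TU, of p] by (auto simp: amb.field_near_UNIV)
    show "g p (Dt p x (\<lambda>q. J q (X q)) - J p (Dt p x X)) w = g p (Dt p x (\<lambda>q. J q (Z q)) - J p (Dt p x Z)) w"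
      using pairing[OF X(1) W(1)] pairing[OF Z(1) W(1)] X(3,4) p(1) Z(2) W(2) by simp
  qed
  moreover have "Dalong p x (\<lambda>q. J q (\<xi> q)) = Dt p x (\<lambda>q. J q (X q))"
    by (rule along_eq[OF p(1,3) JS[OF X(1)] X(2,3)]) (use X(4) in auto)
  moreover have "Dalong p x \<xi> = Dt p x X" by (rule along_eq[OF p(1,3) X])
  ultimately show ?thesis unfolding cov_deriv_endo_def Let_def Z_def[symmetric] by (simp add: algebra_simps)
qed

end

section \<open>Maximal totally complex submanifolds\<close>

text \<open>Permuting the arguments of \<open>s\<close> around a hexagon of transpositions gives \<open>k \<and> F = 0\<close>. As \<open>F\<close> is
  non-degenerate and \<open>dim T \<ge> 3\<close>, the complement of \<open>x\<close> with respect to \<open>F\<close> contains \<open>y\<close> and \<open>z\<close> with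
  \<open>F y z \<noteq> 0\<close>, and evaluating on \<open>x\<close>, \<open>y\<close>, \<open>z\<close> yields \<open>k x = 0\<close>. Applied to the shape tensor, this
  makes two of the three connection forms vanish.\<close>

lemma symmetry_defect_vanishes:
  fixes F :: "'a::euclidean_space \<Rightarrow> 'a \<Rightarrow> real"
  assumes T: "subspace T" "dim T \<ge> 3"
    and F: "bilinear F" "\<And>y z. F y z = - F z y" "\<And>y. y \<in> T \<Longrightarrow> \<forall>z\<in>T. F y z = 0 \<Longrightarrow> y = 0"
    and sym: "\<And>x y z. x \<in> T \<Longrightarrow> y \<in> T \<Longrightarrow> z \<in> T \<Longrightarrow> s x y z = s y x z"
    and defect: "\<And>x y z. x \<in> T \<Longrightarrow> y \<in> T \<Longrightarrow> z \<in> T \<Longrightarrow> s x y z - s x z y = k x * F y z"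
    and x: "x \<in> T"
  shows "k x = 0"
proof -
  note bl = bilinear_ladd[OF F(1)] bilinear_radd[OF F(1)] bilinear_lsub[OF F(1)] bilinear_rsub[OF F(1)]
    bilinear_lmul[OF F(1)] bilinear_rmul[OF F(1)] bilinear_lzero[OF F(1)] bilinear_rzero[OF F(1)]
  have alt: "F y y = 0" for y using F(2)[of y y] by simp
  have cyc: "k x * F y z + k y * F z x + k z * F x y = 0" if "x \<in> T" "y \<in> T" "z \<in> T" for x y z
    using sym[OF that] sym[OF that(2,3,1)] sym[OF that(3,1,2)]
      defect[OF that] defect[OF that(2,3,1)] defect[OF that(3,1,2)] F(2)[of z x]
    by simp
  have "\<exists>y\<in>T. \<exists>z\<in>T. F x y = 0 \<and> F x z = 0 \<and> F y z \<noteq> 0"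
  proof (cases "x = 0")
    case True
    have "\<exists>y\<in>T. y \<noteq> 0"
    proof (rule ccontr)
      assume "\<not> ?thesis"
      then have "T \<subseteq> {0}" by blast
      then have "dim T = 0" by (simp add: dim_eq_0)
      then show False using T(2) by linarith
    qed
    then obtain y where y: "y \<in> T" "y \<noteq> 0" by blast
    then obtain z where "z \<in> T" "F y z \<noteq> 0" using F(3) by blast
    then show ?thesis using y True by (auto simp: bl)
  next
    case False
    then obtain w where w: "w \<in> T" "F x w \<noteq> 0" using F(3)[OF x] by blast
    define x' where "x' = (1 / F x w) *\<^sub>R w"
    have x': "x' \<in> T" "F x x' = 1" unfolding x'_def using w T(1) by (auto simp: subspace_scale bl)
    have x'x: "F x' x = - 1" using F(2)[of x' x] x'(2) by simp
    \<comment> \<open>\<open>P\<close> is the projection to the \<open>F\<close>-complement of the hyperbolic plane spanned by \<open>x\<close> and \<open>x'\<close>\<close>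
    define P where "P u = u - F u x' *\<^sub>R x - F x u *\<^sub>R x'" for u
    have PT: "P u \<in> T" if "u \<in> T" for u
      unfolding P_def using that x x' T(1) by (intro subspace_diff subspace_scale)
    have Px: "F x (P u) = 0" "F (P u) x' = 0" "F (P u) x = 0" for u
    proof -
      show a: "F x (P u) = 0" unfolding P_def by (simp add: bl alt x'(2))
      show "F (P u) x' = 0" unfolding P_def by (simp add: bl alt x'(2))
      show "F (P u) x = 0" using a F(2)[of x "P u"] by simp
    qed
    have "dim (span {x, x'}) \<le> card {x, x'}" by (simp add: dim_le_card')
    also have "\<dots> \<le> 2" by (simp add: card_insert_if)
    finally have "\<not> T \<subseteq> span {x, x'}" using T(2) dim_subset[of T "span {x, x'}"] by linarith
    then obtain u where u: "u \<in> T" "u \<notin> span {x, x'}" by blast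
    have "P u \<noteq> 0"
    proof
      assume "P u = 0"
      then have "u = F u x' *\<^sub>R x + F x u *\<^sub>R x'" unfolding P_def by (simp add: algebra_simps)
      then show False using u(2) by (metis span_add span_base span_scale insertI1 insert_commute)
    qed
    then obtain z where z: "z \<in> T" "F (P u) z \<noteq> 0" using F(3)[OF PT[OF u(1)]] by blast
    have "F (P u) (P z) = F (P u) z" using Px[of u] by (simp add: P_def[of z] bl)
    then show ?thesis using PT[OF u(1)] PT[OF z(1)] Px z(2) by metis
  qed
  then obtain y z where yz: "y \<in> T" "z \<in> T" "F x y = 0" "F x z = 0" "F y z \<noteq> 0" by blast
  have "F z x = 0" using F(2)[of z x] yz(4) by simp
  then have "k x * F y z = 0" using cyc[OF x yz(1,2)] yz(3) by simp
  then show ?thesis using yz(5) by simp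
qed

text \<open>The pointwise and differential consequences of the hypotheses on the adapted basis that the
  structure equations rest on. On a surface, the vanishing of \<open>\<omega>\<^sub>2\<close> and \<open>\<omega>\<^sub>3\<close> on \<open>M\<close> is a hypothesis; in
  higher dimension it is proved below.\<close>

locale totally_complex_submanifold = riemannian_submanifold A k M g Dt D
  for A :: "('p::topological_space, 'e::euclidean_space) chart set"
    and k M and g :: "('p, 'e) metric" and Dt D :: "('p, 'e) connection" +
  fixes \<epsilon> :: real and N :: "'p set" and J :: "nat \<Rightarrow> 'p \<Rightarrow> 'e \<Rightarrow> 'e" and \<omega> :: "nat \<Rightarrow> 'p \<Rightarrow> 'e \<Rightarrow> real"
  assumes eps: "\<epsilon> * \<epsilon> = 1"
    and N: "open N" "M \<subseteq> N"
    and J_smooth: "\<alpha> \<in> {1, 2, 3} \<Longrightarrow> smooth_endo A N (J \<alpha>)"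
    and J1_sq: "q \<in> N \<Longrightarrow> J 1 q (J 1 q v) = \<epsilon> *\<^sub>R v"
    and J2_sq: "q \<in> N \<Longrightarrow> J 2 q (J 2 q v) = v"
    and J_anti: "q \<in> N \<Longrightarrow> J 1 q (J 2 q v) = - J 2 q (J 1 q v)"
    and J3: "q \<in> N \<Longrightarrow> J 3 q v = J 1 q (J 2 q v)"
    and J_skew: "\<alpha> \<in> {1, 2, 3} \<Longrightarrow> q \<in> N \<Longrightarrow> g q (J \<alpha> q v) w = - g q v (J \<alpha> q w)"
    and J1_tangent: "p \<in> M \<Longrightarrow> v \<in> T p \<Longrightarrow> J 1 p v \<in> T p"
    and J2_normal: "p \<in> M \<Longrightarrow> v \<in> T p \<Longrightarrow> w \<in> T p \<Longrightarrow> g p (J 2 p v) w = 0"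
    and maximal: "2 * k = DIM('e)"
    and forms: "connection_forms A Dt \<epsilon> N J \<omega>"
    and surface: "k < 3 \<Longrightarrow> p \<in> M \<Longrightarrow> x \<in> T p \<Longrightarrow> \<omega> 2 p x = 0 \<and> \<omega> 3 p x = 0"
begin

\<comment> \<open>otherwise the index in \<open>J 1\<close> is rewritten to \<open>Suc 0\<close>\<close>
declare One_nat_def [simp del]

lemma M_in_N: "p \<in> M \<Longrightarrow> p \<in> N" using N(2) by blast

lemma J_linear:
  assumes "\<alpha> \<in> {1, 2, 3}" "q \<in> N"
  shows "linear (J \<alpha> q)"
  using J_smooth[OF assms(1)] assms(2) unfolding smooth_endo_def by blast

lemma J_simps:
  assumes "\<alpha> \<in> {1, 2, 3}" "q \<in> N"
  shows "J \<alpha> q (v + w) = J \<alpha> q v + J \<alpha> q w" "J \<alpha> q (v - w) = J \<alpha> q v - J \<alpha> q w"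
    "J \<alpha> q (a *\<^sub>R v) = a *\<^sub>R J \<alpha> q v" "J \<alpha> q (- v) = - J \<alpha> q v" "J \<alpha> q 0 = 0"
  using J_linear[OF assms] by (simp_all add: linear_add linear_diff linear_cmul linear_neg linear_0)

lemmas J1_simps = J_simps[of 1, simplified] and J2_simps = J_simps[of 2, simplified]

lemma J3_eq: "q \<in> N \<Longrightarrow> J 3 q v = - J 2 q (J 1 q v)"
  using J3 J_anti by simp

lemma section_near_J: "\<alpha> \<in> {1, 2, 3} \<Longrightarrow> p \<in> M \<Longrightarrow> section_near A M p X \<Longrightarrow> section_near A M p (\<lambda>q. J \<alpha> q (X q))"
  using amb.section_near_endo[OF J_smooth N(1) M_in_N] by blast

lemma field_near_J1:
  assumes "p \<in> M" "field_near A M p X"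
  shows "field_near A M p (\<lambda>q. J 1 q (X q))"
proof -
  obtain U where U: "open U" "p \<in> U" "\<forall>q\<in>U. field_near A M q X" using amb.field_near_open[OF assms(2)] by blast
  show ?thesis
    by (rule amb.field_nearI[OF section_near_J U(1,2)])
      (use assms U(3) J1_tangent amb.field_near_tangent amb.field_near_section in auto)
qed

text \<open>\<open>J\<^sub>2 T\<close> is orthogonal to \<open>T\<close>, on which the metric is non-degenerate.\<close>

lemma tangent_normal_Int: "p \<in> M \<Longrightarrow> a \<in> T p \<Longrightarrow> b \<in> T p \<Longrightarrow> a + J 2 p b = 0 \<Longrightarrow> a = 0 \<and> b = 0"
proof -
  assume p: "p \<in> M" and a: "a \<in> T p" and b: "b \<in> T p" and z: "a + J 2 p b = 0"
  have "a = 0"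
  proof (rule ind.tangent_eqI[OF p a ind.T_closed(5)[OF p]])
    fix w assume w: "w \<in> T p"
    have "g p (a + J 2 p b) w = 0" unfolding z by (simp add: amb.g_simps)
    then show "g p a w = g p 0 w" using J2_normal[OF p b w] by (simp add: amb.g_simps)
  qed
  moreover have "b = 0"
  proof -
    have "J 2 p b = 0" using z \<open>a = 0\<close> by simp
    then have "J 2 p (J 2 p b) = 0" using J2_simps(5) M_in_N[OF p] by simp
    then show ?thesis using J2_sq M_in_N[OF p] by simp
  qed
  ultimately show ?thesis ..
qed

lemma decomposition_unique:
  assumes "p \<in> M" "a \<in> T p" "b \<in> T p" "a' \<in> T p" "b' \<in> T p" "a + J 2 p b = a' + J 2 p b'"
  shows "a = a'" "b = b'"
proof -
  have "(a - a') + J 2 p (b - b') = 0"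
    using assms(6) by (simp add: J2_simps(2)[OF M_in_N[OF assms(1)]] algebra_simps)
  then have "a - a' = 0 \<and> b - b' = 0"
    by (rule tangent_normal_Int[OF assms(1) ind.T_closed(2)[OF assms(1,2,4)] ind.T_closed(2)[OF assms(1,3,5)]])
  then show "a = a'" "b = b'" by auto
qed

text \<open>As \<open>J\<^sub>2\<close> is injective and \<open>T\<close> has half the dimension, \<open>T\<close> and \<open>J\<^sub>2 T\<close> span. Thus \<open>J\<^sub>2 T\<close> is the normal
  space, and the normal bundle is a copy of the tangent bundle.\<close>

lemma decomposition:
  assumes p: "p \<in> M"
  obtains a b where "a \<in> T p" "b \<in> T p" "v = a + J 2 p b"
proof -
  have q: "p \<in> N" using M_in_N[OF p] .
  have l: "linear (J 2 p)" using J_linear q by simp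
  have inj: "inj_on (J 2 p) (span (T p))" using J2_sq[OF q] by (metis inj_onI)
  note T = ind.T_subspace[OF p]
  have d: "dim (T p) = k" using amb.tangent_space_subspace(2)[OF ind.sub p] .
  have J: "subspace (J 2 p ` T p)" "dim (J 2 p ` T p) = k"
    using linear_subspace_image[OF l T] dim_image_eq[OF l inj] d by auto
  have "T p \<inter> J 2 p ` T p \<subseteq> {0}"
  proof
    fix u assume "u \<in> T p \<inter> J 2 p ` T p"
    then obtain b where "u \<in> T p" "b \<in> T p" "u = J 2 p b" by blast
    then have "- u = 0 \<and> b = 0" by (intro tangent_normal_Int[OF p] ind.T_closed p) auto
    then show "u \<in> {0}" by simp
  qed
  then have "dim (T p \<inter> J 2 p ` T p) = 0" by (simp add: dim_eq_0)
  moreover define W where "W = {x + y |x y. x \<in> T p \<and> y \<in> J 2 p ` T p}"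
  ultimately have "dim W = DIM('e)"
    using dim_sums_Int[OF T J(1), folded W_def] d J(2) maximal by linarith
  then have "span W = UNIV" using dim_eq_full by blast
  moreover have "subspace W" unfolding W_def using subspace_sums[OF T J(1)] .
  then have "span W = W" by (rule span_eq_iff[THEN iffD2])
  ultimately have "v \<in> W" by simp
  then show ?thesis unfolding W_def using that by blast
qed

lemma orthogonal_J2:
  assumes p: "p \<in> M" and v: "\<And>w. w \<in> T p \<Longrightarrow> g p v w = 0"
  shows "J 2 p v \<in> T p"
proof -
  obtain a b where ab: "a \<in> T p" "b \<in> T p" "v = a + J 2 p b" by (rule decomposition[OF p])
  have "a = 0"
    by (rule ind.tangent_eqI[OF p ab(1) ind.T_closed(5)[OF p]])
      (use v J2_normal[OF p ab(2)] ab(3) in \<open>auto simp: amb.g_simps\<close>)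
  then show ?thesis using ab J2_sq M_in_N[OF p] by simp
qed

lemma tan_part_sum: "p \<in> M \<Longrightarrow> a \<in> T p \<Longrightarrow> b \<in> T p \<Longrightarrow> tan_part A g M p (a + J 2 p b) = a"
  unfolding tan_part_def
proof (rule the_equality)
  assume p: "p \<in> M" and a: "a \<in> T p" and b: "b \<in> T p"
  show "a \<in> T p \<and> (\<forall>w\<in>T p. g p (a + J 2 p b - a) w = 0)" using a J2_normal[OF p b] by simp
  fix u assume u: "u \<in> T p \<and> (\<forall>w\<in>T p. g p (a + J 2 p b - u) w = 0)"
  show "u = a"
    by (rule ind.tangent_eqI[OF p _ a]) (use u J2_normal[OF p b] in \<open>auto simp: amb.g_simps\<close>)
qed

lemma nor_part_sum: "p \<in> M \<Longrightarrow> a \<in> T p \<Longrightarrow> b \<in> T p \<Longrightarrow> nor_part A g M p (a + J 2 p b) = J 2 p b"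
  unfolding nor_part_def using tan_part_sum by simp

abbreviation C where "C \<equiv> shape_tensor A g Dt M J"

text \<open>The normal part of the derivative of \<open>Z\<close> is symmetric in \<open>x\<close> and \<open>Z\<close> by torsion freeness. Therefore
  it depends on \<open>Z\<close> through its value only, and the particular extension of \<open>Z p\<close> in the definition of the
  shape tensor is immaterial.\<close>

lemma Gauss:
  assumes p: "p \<in> M" "x \<in> T p" and Z: "field_near A M p Z"
  shows "C p x (Z p) \<in> T p" "Dalong p x Z = D p x Z + J 2 p (C p x (Z p))"
proof -
  let ?u = "\<lambda>Z. Dalong p x Z - D p x Z"
  note t = amb.field_near_tangent[OF _ p(1)]
  have perp: "J 2 p (?u Z) \<in> T p" if "field_near A M p Z" for Z
    by (rule orthogonal_J2[OF p(1)]) (use Gauss_orthogonal[OF p that] in simp)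
  define E where "E = extend A M p (Z p)"
  define X where "X = extend A M p x"
  have E: "field_near A M p E" "E p = Z p" and X: "field_near A M p X" "X p = x"
    unfolding E_def X_def using ind.extend_field[OF p(1)] t[OF Z] p(2) by auto
  have u: "?u W = Dalong p (W p) X - D p (W p) X" if "field_near A M p W" for W
    using along_bracket[OF p(1) X(1) that] X(2) by (simp add: algebra_simps)
  have uE: "?u E = ?u Z" using u[OF E(1)] u[OF Z] E(2) by simp
  have "Dalong p x E = D p x E + J 2 p (J 2 p (?u E))" using J2_sq[OF M_in_N[OF p(1)]] by simp
  then have "nor_part A g M p (Dalong p x E) = J 2 p (J 2 p (?u E))"
    using nor_part_sum[OF p(1) ind.connection[OF p(1) E(1) p(2)] perp[OF E(1)]] by simp
  then have C: "C p x (Z p) = J 2 p (?u Z)"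
    unfolding shape_tensor_def second_fundamental_form_def E_def[symmetric]
    using J2_sq[OF M_in_N[OF p(1)]] uE by simp
  show "C p x (Z p) \<in> T p" unfolding C by (rule perp[OF Z])
  show "Dalong p x Z = D p x Z + J 2 p (C p x (Z p))"
    unfolding C using J2_sq[OF M_in_N[OF p(1)]] by simp
qed

lemma C_tangent: "p \<in> M \<Longrightarrow> x \<in> T p \<Longrightarrow> y \<in> T p \<Longrightarrow> C p x y \<in> T p"
  using Gauss(1) ind.extend_field by metis

lemma C_along:
  assumes "p \<in> M" "x \<in> T p" "field_near A M p Z"
  shows "C p x (Z p) = J 2 p (Dalong p x Z - D p x Z)"
  using Gauss(2)[OF assms] J2_sq[OF M_in_N[OF assms(1)]] by simp

lemma C_sym:
  assumes p: "p \<in> M" and x: "x \<in> T p" and y: "y \<in> T p"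
  shows "C p x y = C p y x"
proof -
  define X where "X = extend A M p x"
  define Y where "Y = extend A M p y"
  have X: "field_near A M p X" "X p = x" and Y: "field_near A M p Y" "Y p = y"
    unfolding X_def Y_def using ind.extend_field[OF p] x y by auto
  have "Dalong p x Y - D p x Y = Dalong p y X - D p y X"
    using along_bracket[OF p X(1) Y(1)] X(2) Y(2) by (simp add: algebra_simps)
  then show ?thesis using C_along[OF p x Y(1)] C_along[OF p y X(1)] X(2) Y(2) by simp
qed

lemma C_linear_left:
  assumes p: "p \<in> M" and x: "x \<in> T p" "x' \<in> T p" and y: "y \<in> T p"
  shows "C p (a *\<^sub>R x + b *\<^sub>R x') y = a *\<^sub>R C p x y + b *\<^sub>R C p x' y"
proof -
  define Y where "Y = extend A M p y"
  have Y: "field_near A M p Y" "Y p = y" unfolding Y_def using ind.extend_field[OF p y] by auto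
  have "a *\<^sub>R x + b *\<^sub>R x' \<in> T p" by (intro ind.T_closed p x)
  then show ?thesis
    using C_along[OF p _ Y(1)] x Y(2) along_linear[OF p x Y(1)[THEN amb.field_near_section]]
      ind.D_linear[OF p Y(1) x] by (simp add: J2_simps[OF M_in_N[OF p]] scaleR_diff_right)
qed

lemma C_field:
  assumes p: "p \<in> M" and Y: "field_near A M p Y" and Z: "field_near A M p Z"
  shows "field_near A M p (\<lambda>q. C q (Y q) (Z q))"
proof -
  obtain U1 where U1: "open U1" "p \<in> U1" "\<forall>q\<in>U1. field_near A M q Y" using amb.field_near_open[OF Y] by blast
  obtain U2 where U2: "open U2" "p \<in> U2" "\<forall>q\<in>U2. field_near A M q Z" using amb.field_near_open[OF Z] by blast
  have o: "open (U1 \<inter> U2)" "p \<in> U1 \<inter> U2" using U1 U2 by auto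
  have "section_near A M p (\<lambda>q. J 2 q (Dalong q (Y q) Z - D q (Y q) Z))"
    using p Y Z by (intro section_near_J amb.section_near_diff along_section amb.field_near_section ind.D_field) auto
  then have "section_near A M p (\<lambda>q. C q (Y q) (Z q))"
    using o by (rule amb.section_near_cong)
      (use U1(3) U2(3) C_along amb.field_near_tangent in \<open>auto simp: Ball_def\<close>)
  then show ?thesis
    using o
  proof (rule amb.field_nearI)
    fix q assume "q \<in> M" "q \<in> U1 \<inter> U2"
    then show "C q (Y q) (Z q) \<in> T q"
      using U1(3) U2(3) by (intro C_tangent amb.field_near_tangent) auto
  qed
qed

text \<open>The covariant derivatives of the adapted basis, applied to sections along \<open>M\<close>.\<close>

lemma along_J:
  assumes p: "p \<in> M" "x \<in> T p" and \<xi>: "section_near A M p \<xi>"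
  shows "Dalong p x (\<lambda>q. J 1 q (\<xi> q)) = J 1 p (Dalong p x \<xi>) - \<omega> 3 p x *\<^sub>R J 2 p (\<xi> p) - (\<epsilon> * \<omega> 2 p x) *\<^sub>R J 3 p (\<xi> p)"
    and "Dalong p x (\<lambda>q. J 2 q (\<xi> q)) = J 2 p (Dalong p x \<xi>) + (\<epsilon> * \<omega> 1 p x) *\<^sub>R J 3 p (\<xi> p) + (\<epsilon> * \<omega> 3 p x) *\<^sub>R J 1 p (\<xi> p)"
proof -
  have c: "cov_deriv_endo A UNIV Dt (J 1) p x z = - (\<omega> 3 p x) *\<^sub>R J 2 p z + (- \<epsilon> * \<omega> 2 p x) *\<^sub>R J 3 p z"
    "cov_deriv_endo A UNIV Dt (J 2) p x z = - (- \<epsilon> * \<omega> 1 p x) *\<^sub>R J 3 p z + (\<epsilon> * \<omega> 3 p x) *\<^sub>R J 1 p z" for z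
    using forms M_in_N[OF p(1)] unfolding connection_forms_def by (simp_all add: adapted_sign_def)
  note e = along_endo[OF J_smooth N(1) J_skew p(1) M_in_N[OF p(1)] p(2) \<xi>]
  show "Dalong p x (\<lambda>q. J 1 q (\<xi> q)) = J 1 p (Dalong p x \<xi>) - \<omega> 3 p x *\<^sub>R J 2 p (\<xi> p) - (\<epsilon> * \<omega> 2 p x) *\<^sub>R J 3 p (\<xi> p)"
    using e[of 1] c(1) by simp
  show "Dalong p x (\<lambda>q. J 2 q (\<xi> q)) = J 2 p (Dalong p x \<xi>) + (\<epsilon> * \<omega> 1 p x) *\<^sub>R J 3 p (\<xi> p) + (\<epsilon> * \<omega> 3 p x) *\<^sub>R J 1 p (\<xi> p)"
    using e[of 2] c(2) by simp
qed

lemma J2_isometry: "p \<in> M \<Longrightarrow> g p (J 2 p v) (J 2 p w) = - g p v w"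
  using J_skew[of 2 p v "J 2 p w"] J2_sq[OF M_in_N] M_in_N by simp

text \<open>Differentiate \<open>g (J\<^sub>2 Y) Z = 0\<close> along \<open>x\<close>. The term \<open>\<omega>\<^sub>1 \<otimes> J\<^sub>3\<close> of the derivative of \<open>J\<^sub>2\<close> maps to normal
  vectors and disappears, the term \<open>\<omega>\<^sub>3 \<otimes> J\<^sub>1\<close> remains.\<close>

lemma C_adjoint_defect:
  assumes p: "p \<in> M" and x: "x \<in> T p" and y: "y \<in> T p" and z: "z \<in> T p"
  shows "g p (C p x y) z - g p (C p x z) y = - (\<epsilon> * \<omega> 3 p x) * g p (J 1 p y) z"
proof -
  define Y where "Y = extend A M p y"
  define Z where "Z = extend A M p z"
  have Y: "field_near A M p Y" "Y p = y" and Z: "field_near A M p Z" "Z p = z"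
    unfolding Y_def Z_def using ind.extend_field[OF p] y z by auto
  note s = amb.field_near_section
  obtain U1 where U1: "open U1" "p \<in> U1" "\<forall>q\<in>U1. field_near A M q Y" using amb.field_near_open[OF Y(1)] by blast
  obtain U2 where U2: "open U2" "p \<in> U2" "\<forall>q\<in>U2. field_near A M q Z" using amb.field_near_open[OF Z(1)] by blast
  have "dir_deriv A M p x (\<lambda>q. g q (J 2 q (Y q)) (Z q)) = dir_deriv A M p x (\<lambda>q. 0)"
  proof (rule amb.dir_deriv_cong[OF x x order_refl amb.function_near_const])
    show "open (U1 \<inter> U2)" "p \<in> U1 \<inter> U2" using U1 U2 by auto
    show "g q (J 2 q (Y q)) (Z q) = 0" if "q \<in> M \<inter> (U1 \<inter> U2)" for q
      using that U1(3) U2(3) J2_normal amb.field_near_tangent by blast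
  qed
  also have "\<dots> = 0" using amb.dir_deriv_const[OF x] .
  finally have "g p (Dalong p x (\<lambda>q. J 2 q (Y q))) z + g p (J 2 p y) (Dalong p x Z) = 0"
    using along_metric[OF p x section_near_J[OF _ p s[OF Y(1)]] s[OF Z(1)], of 2] Y(2) Z(2) by simp
  moreover have "Dalong p x (\<lambda>q. J 2 q (Y q)) = J 2 p (D p x Y) + C p x y - (\<epsilon> * \<omega> 1 p x) *\<^sub>R J 2 p (J 1 p y)
      + (\<epsilon> * \<omega> 3 p x) *\<^sub>R J 1 p y"
    using along_J(2)[OF p x s[OF Y(1)]] Gauss(2)[OF p x Y(1)] Y(2) J2_sq[OF M_in_N[OF p]]
      J2_simps[OF M_in_N[OF p]] J3_eq[OF M_in_N[OF p]] by simp
  moreover have "g p (J 2 p (D p x Y)) z = 0" "g p (J 2 p (J 1 p y)) z = 0"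
    by (intro J2_normal p ind.connection Y x z J1_tangent y)+
  moreover have "g p (J 2 p y) (Dalong p x Z) = - g p y (C p x z)"
    using Gauss(2)[OF p x Z(1)] Z(2) J2_normal[OF p y ind.connection[OF p Z(1) x]] J2_isometry[OF p]
    by (simp add: amb.g_simps)
  ultimately show ?thesis using amb.g_sym[of p y] by (simp add: amb.g_simps)
qed

lemma kaehler_form_nondegenerate:
  assumes p: "p \<in> M" and y: "y \<in> T p" and z: "\<forall>z\<in>T p. g p (J 1 p y) z = 0"
  shows "y = 0"
proof -
  have "J 1 p y = 0"
    by (rule ind.tangent_eqI[OF p J1_tangent[OF p y] ind.T_closed(5)[OF p]]) (use z in \<open>simp add: amb.g_simps\<close>)
  then have "\<epsilon> *\<^sub>R y = 0" using J1_sq[OF M_in_N[OF p], of y] J1_simps(5)[OF M_in_N[OF p]] by simp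
  then show ?thesis using eps by auto
qed

lemma kaehler_form_bilinear: "p \<in> M \<Longrightarrow> bilinear (\<lambda>y z. g p (J 1 p y) z)"
  unfolding bilinear_def
  by (auto intro!: linearI simp: amb.g_simps J1_simps[OF M_in_N])

lemma kaehler_form_skew: "p \<in> M \<Longrightarrow> g p (J 1 p y) z = - g p (J 1 p z) y"
  using J_skew[of 1 p y z] amb.g_sym[of p y] M_in_N by simp

text \<open>\<open>g (C\<^sub>x y) z\<close> is symmetric in \<open>x\<close> and \<open>y\<close>, and fails to be symmetric in \<open>y\<close> and \<open>z\<close> by a multiple of
  \<open>\<omega>\<^sub>3 \<otimes> F\<close>, where \<open>F y z = g (J\<^sub>1 y) z\<close>.\<close>

lemma omega3_zero:
  assumes p: "p \<in> M" and x: "x \<in> T p"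
  shows "\<omega> 3 p x = 0"
proof (cases "k < 3")
  case True
  then show ?thesis using surface p x by blast
next
  case False
  have "- (\<epsilon> * \<omega> 3 p x) = 0"
  proof (rule symmetry_defect_vanishes[OF ind.T_subspace[OF p] _ kaehler_form_bilinear[OF p] kaehler_form_skew[OF p] kaehler_form_nondegenerate[OF p], where s = "\<lambda>x y z. g p (C p x y) z"])
    show "dim (T p) \<ge> 3" using False amb.tangent_space_subspace(2)[OF ind.sub p] by simp
    show "g p (C p x y) z - g p (C p x z) y = - (\<epsilon> * \<omega> 3 p x) * g p (J 1 p y) z"
      if "x \<in> T p" "y \<in> T p" "z \<in> T p" for x y z using C_adjoint_defect[OF p that] .
    show "g p (C p x y) z = g p (C p y x) z" if "x \<in> T p" "y \<in> T p" "z \<in> T p" for x y z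
      using C_sym[OF p that(1,2)] by simp
  qed (use x in auto)
  then show ?thesis using eps by auto
qed

lemma C_adjoint: "p \<in> M \<Longrightarrow> x \<in> T p \<Longrightarrow> y \<in> T p \<Longrightarrow> z \<in> T p \<Longrightarrow> g p (C p x y) z = g p y (C p x z)"
  using C_adjoint_defect[of p x y z] omega3_zero amb.g_sym[of p y] by simp

text \<open>Tangential and normal part of the derivative of \<open>J\<^sub>1 Z\<close>: the covariant derivative of \<open>J\<^sub>1\<close> is a
  combination of \<open>J\<^sub>2\<close> and \<open>J\<^sub>3\<close>, which map to normal vectors.\<close>

lemma J1_parallel_defect:
  assumes p: "p \<in> M" and x: "x \<in> T p" and Z: "field_near A M p Z"
  shows "D p x (\<lambda>q. J 1 q (Z q)) = J 1 p (D p x Z)"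
    "C p x (J 1 p (Z p)) = - J 1 p (C p x (Z p)) + (\<epsilon> * \<omega> 2 p x) *\<^sub>R J 1 p (Z p)"
proof -
  note q = M_in_N[OF p]
  note JZ = field_near_J1[OF p Z]
  note z = amb.field_near_tangent[OF Z p]
  have "D p x (\<lambda>q. J 1 q (Z q)) + J 2 p (C p x (J 1 p (Z p))) = Dalong p x (\<lambda>q. J 1 q (Z q))"
    using Gauss(2)[OF p x JZ] by simp
  also have "\<dots> = J 1 p (D p x Z) + J 2 p (- J 1 p (C p x (Z p)) + (\<epsilon> * \<omega> 2 p x) *\<^sub>R J 1 p (Z p))"
    using along_J(1)[OF p x amb.field_near_section[OF Z]] Gauss(2)[OF p x Z] omega3_zero[OF p x]
    by (simp add: J1_simps[OF q] J2_simps[OF q] J_anti[OF q] J3_eq[OF q])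
  finally have e: "D p x (\<lambda>q. J 1 q (Z q)) + J 2 p (C p x (J 1 p (Z p))) =
      J 1 p (D p x Z) + J 2 p (- J 1 p (C p x (Z p)) + (\<epsilon> * \<omega> 2 p x) *\<^sub>R J 1 p (Z p))" .
  have m: "D p x (\<lambda>q. J 1 q (Z q)) \<in> T p" "C p x (J 1 p (Z p)) \<in> T p" "J 1 p (D p x Z) \<in> T p"
    "- J 1 p (C p x (Z p)) + (\<epsilon> * \<omega> 2 p x) *\<^sub>R J 1 p (Z p) \<in> T p"
    by (intro ind.T_closed ind.connection C_tangent J1_tangent p x JZ Z z)+
  show "D p x (\<lambda>q. J 1 q (Z q)) = J 1 p (D p x Z)"
    "C p x (J 1 p (Z p)) = - J 1 p (C p x (Z p)) + (\<epsilon> * \<omega> 2 p x) *\<^sub>R J 1 p (Z p)"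
    using decomposition_unique[OF p m e] by auto
qed

lemma C_J1_defect:
  assumes "p \<in> M" "x \<in> T p" "z \<in> T p"
  shows "C p x (J 1 p z) = - J 1 p (C p x z) + (\<epsilon> * \<omega> 2 p x) *\<^sub>R J 1 p z"
  using J1_parallel_defect(2)[OF assms(1,2), of "extend A M p z"] ind.extend_field[OF assms(1,3)] by simp

text \<open>The argument for \<open>\<omega>\<^sub>3\<close> is repeated with \<open>g (J\<^sub>1 (C\<^sub>x y)) z\<close>, where the failure of symmetry is now
  measured by \<open>\<omega>\<^sub>2\<close>.\<close>

lemma omega2_zero:
  assumes p: "p \<in> M" and x: "x \<in> T p"
  shows "\<omega> 2 p x = 0"
proof (cases "k < 3")
  case True
  then show ?thesis using surface p x by blast
next
  case False
  have "\<epsilon> * \<omega> 2 p x = 0"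
  proof (rule symmetry_defect_vanishes[OF ind.T_subspace[OF p] _ kaehler_form_bilinear[OF p] kaehler_form_skew[OF p] kaehler_form_nondegenerate[OF p], where s = "\<lambda>x y z. g p (J 1 p (C p x y)) z"])
    show "dim (T p) \<ge> 3" using False amb.tangent_space_subspace(2)[OF ind.sub p] by simp
    show "g p (J 1 p (C p x y)) z - g p (J 1 p (C p x z)) y = \<epsilon> * \<omega> 2 p x * g p (J 1 p y) z"
      if "x \<in> T p" "y \<in> T p" "z \<in> T p" for x y z
    proof -
      have "g p (J 1 p (C p x z)) y = - g p z (C p x (J 1 p y))"
        using J_skew[of 1 p "C p x z" y] M_in_N[OF p] C_adjoint[OF p that(1,3) J1_tangent[OF p that(2)]] by simp
      then show ?thesis using C_J1_defect[OF p that(1,2)] amb.g_sym[of p z] by (simp add: amb.g_simps)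
    qed
    show "g p (J 1 p (C p x y)) z = g p (J 1 p (C p y x)) z" if "x \<in> T p" "y \<in> T p" "z \<in> T p" for x y z
      using C_sym[OF p that(1,2)] by simp
  qed (use x in auto)
  then show ?thesis using eps by auto
qed

lemma C_J1: "p \<in> M \<Longrightarrow> x \<in> T p \<Longrightarrow> z \<in> T p \<Longrightarrow> C p x (J 1 p z) = - J 1 p (C p x z)"
  using C_J1_defect omega2_zero by simp

lemma J1_parallel:
  assumes "p \<in> M" "x \<in> T p" "field_near A M p Z"
  shows "D p x (\<lambda>q. J 1 q (Z q)) = J 1 p (D p x Z)"
  using J1_parallel_defect(1)[OF assms] .

end

section \<open>The Gauss, Codazzi and Ricci equations\<close>

context totally_complex_submanifold
begin

abbreviation DN where "DN \<equiv> N_connection A g Dt M J"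

text \<open>The normal connection, transported to the tangent bundle by \<open>J\<^sub>2\<close>, differs from \<open>D\<close> by the term
  \<open>\<omega>\<^sub>1 \<otimes> J\<^sub>3 = - \<omega>\<^sub>1 \<otimes> J\<^sub>2 J\<^sub>1\<close> of the derivative of \<open>J\<^sub>2\<close>. The tangential part, up to sign the Weingarten
  map of the normal section \<open>J\<^sub>2 Z\<close>, is again given by the shape tensor.\<close>

lemma normal_derivative:
  assumes p: "p \<in> M" and x: "x \<in> T p" and Z: "field_near A M p Z"
  shows "DN p x Z = D p x Z - (\<epsilon> * \<omega> 1 p x) *\<^sub>R J 1 p (Z p)"
    and "Dalong p x (\<lambda>q. J 2 q (Z q)) = C p x (Z p) + J 2 p (DN p x Z)"
    and "DN p x Z \<in> T p"
proof -
  note q = M_in_N[OF p]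
  note z = amb.field_near_tangent[OF Z p]
  let ?b = "D p x Z - (\<epsilon> * \<omega> 1 p x) *\<^sub>R J 1 p (Z p)"
  have e: "Dalong p x (\<lambda>q. J 2 q (Z q)) = C p x (Z p) + J 2 p ?b"
    using along_J(2)[OF p x amb.field_near_section[OF Z]] Gauss(2)[OF p x Z] omega3_zero[OF p x]
    by (simp add: J2_simps[OF q] J3_eq[OF q] J2_sq[OF q])
  have b: "?b \<in> T p" by (intro ind.T_closed ind.connection J1_tangent p x Z z)
  show DN: "DN p x Z = ?b"
    unfolding N_connection_def normal_connection_def e nor_part_sum[OF p C_tangent[OF p x z] b] J2_sq[OF q] ..
  show "Dalong p x (\<lambda>q. J 2 q (Z q)) = C p x (Z p) + J 2 p (DN p x Z)" unfolding DN e ..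
  show "DN p x Z \<in> T p" unfolding DN using b .
qed

lemma common_neighbourhood:
  assumes "field_near A M p Y" "field_near A M p Z"
  obtains U where "open U" "p \<in> U" "\<forall>q\<in>U. field_near A M q Y \<and> field_near A M q Z"
proof -
  obtain U1 where U1: "open U1" "p \<in> U1" "\<forall>q\<in>U1. field_near A M q Y"
    using amb.field_near_open[OF assms(1)] by blast
  obtain U2 where U2: "open U2" "p \<in> U2" "\<forall>q\<in>U2. field_near A M q Z"
    using amb.field_near_open[OF assms(2)] by blast
  show ?thesis by (rule that[of "U1 \<inter> U2"]) (use U1 U2 in auto)
qed

lemma normal_derivative_field:
  assumes p: "p \<in> M" and Y: "field_near A M p Y" and Z: "field_near A M p Z"
  shows "field_near A M p (\<lambda>q. DN q (Y q) Z)"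
proof -
  obtain U where U: "open U" "p \<in> U" "\<forall>q\<in>U. field_near A M q Y \<and> field_near A M q Z"
    by (rule common_neighbourhood[OF Y Z])
  note s = amb.field_near_section
  have "section_near A M p (\<lambda>q. J 2 q (Dalong q (Y q) (\<lambda>r. J 2 r (Z r)) - C q (Y q) (Z q)))"
    using p Y Z by (intro section_near_J amb.section_near_diff along_section s[OF C_field] s[OF Z]) auto
  then have "section_near A M p (\<lambda>q. DN q (Y q) Z)"
    using U(1,2)
  proof (rule amb.section_near_cong)
    fix q assume q: "q \<in> M \<inter> U"
    then show "J 2 q (Dalong q (Y q) (\<lambda>r. J 2 r (Z r)) - C q (Y q) (Z q)) = DN q (Y q) Z"
      using normal_derivative(2)[of q "Y q" Z] U(3) amb.field_near_tangent[of M q Y] J2_sq[OF M_in_N[of q]] by simp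
  qed
  then show ?thesis
    using U(1,2) by (rule amb.field_nearI) (use U(3) normal_derivative(3) amb.field_near_tangent in blast)
qed

text \<open>In the splitting of the ambient bundle along \<open>M\<close> as \<open>T \<oplus> J\<^sub>2 T\<close>, the ambient connection is the
  block matrix with diagonal \<open>D\<close>, \<open>DN\<close> and both off-diagonal entries equal to \<open>C\<close>.\<close>

lemma along_split:
  assumes p: "p \<in> M" and x: "x \<in> T p" and V: "field_near A M p V" and W: "field_near A M p W"
  shows "Dalong p x (\<lambda>q. V q + J 2 q (W q)) = (D p x V + C p x (W p)) + J 2 p (C p x (V p) + DN p x W)"
proof -
  have "Dalong p x (\<lambda>q. V q + J 2 q (W q)) = Dalong p x V + Dalong p x (\<lambda>q. J 2 q (W q))"
    using p V W by (intro along_add x section_near_J amb.field_near_section) auto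
  then show ?thesis
    using Gauss(2)[OF p x V] normal_derivative(2)[OF p x W] by (simp add: J2_simps[OF M_in_N[OF p]] algebra_simps)
qed

lemma second_derivative:
  assumes p: "p \<in> M" and x: "x \<in> T p" and Y: "field_near A M p Y" and Z: "field_near A M p Z"
  shows "Dalong p x (\<lambda>q. Dalong q (Y q) Z) = (D p x (\<lambda>q. D q (Y q) Z) + C p x (C p (Y p) (Z p)))
      + J 2 p (C p x (D p (Y p) Z) + DN p x (\<lambda>q. C q (Y q) (Z q)))"
    and "Dalong p x (\<lambda>q. Dalong q (Y q) (\<lambda>r. J 2 r (Z r))) = (D p x (\<lambda>q. C q (Y q) (Z q)) + C p x (DN p (Y p) Z))
      + J 2 p (C p x (C p (Y p) (Z p)) + DN p x (\<lambda>q. DN q (Y q) Z))"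
proof -
  obtain U where U: "open U" "p \<in> U" "\<forall>q\<in>U. field_near A M q Y \<and> field_near A M q Z"
    by (rule common_neighbourhood[OF Y Z])
  note s = amb.field_near_section
  have "Dalong p x (\<lambda>q. Dalong q (Y q) Z) = Dalong p x (\<lambda>q. D q (Y q) Z + J 2 q (C q (Y q) (Z q)))"
    by (rule along_cong[OF p x along_section[OF Y s[OF Z]] U(1,2)])
      (use U(3) Gauss(2) amb.field_near_tangent in blast)
  also have "\<dots> = (D p x (\<lambda>q. D q (Y q) Z) + C p x (C p (Y p) (Z p)))
      + J 2 p (C p x (D p (Y p) Z) + DN p x (\<lambda>q. C q (Y q) (Z q)))"
    by (rule along_split[OF p x ind.D_field[OF p Y Z] C_field[OF p Y Z]])
  finally show "Dalong p x (\<lambda>q. Dalong q (Y q) Z) = (D p x (\<lambda>q. D q (Y q) Z) + C p x (C p (Y p) (Z p)))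
      + J 2 p (C p x (D p (Y p) Z) + DN p x (\<lambda>q. C q (Y q) (Z q)))" .
  have J2Z: "section_near A M p (\<lambda>r. J 2 r (Z r))" using section_near_J[OF _ p s[OF Z]] by simp
  have "Dalong p x (\<lambda>q. Dalong q (Y q) (\<lambda>r. J 2 r (Z r))) = Dalong p x (\<lambda>q. C q (Y q) (Z q) + J 2 q (DN q (Y q) Z))"
    by (rule along_cong[OF p x along_section[OF Y J2Z] U(1,2)])
      (use U(3) normal_derivative(2) amb.field_near_tangent in blast)
  also have "\<dots> = (D p x (\<lambda>q. C q (Y q) (Z q)) + C p x (DN p (Y p) Z))
      + J 2 p (C p x (C p (Y p) (Z p)) + DN p x (\<lambda>q. DN q (Y q) Z))"
    by (rule along_split[OF p x C_field[OF p Y Z] normal_derivative_field[OF p Y Z]])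
  finally show "Dalong p x (\<lambda>q. Dalong q (Y q) (\<lambda>r. J 2 r (Z r))) = (D p x (\<lambda>q. C q (Y q) (Z q)) + C p x (DN p (Y p) Z))
      + J 2 p (C p x (C p (Y p) (Z p)) + DN p x (\<lambda>q. DN q (Y q) Z))" .
qed

text \<open>The curvature of \<open>DN\<close>. The bracket of \<open>X\<close> and \<open>Y\<close> is expressed by the torsion free connection \<open>D\<close>.\<close>

definition normal_riemann :: "('p \<Rightarrow> 'e) \<Rightarrow> ('p \<Rightarrow> 'e) \<Rightarrow> ('p \<Rightarrow> 'e) \<Rightarrow> 'p \<Rightarrow> 'e" where
  "normal_riemann X Y Z p = DN p (X p) (\<lambda>q. DN q (Y q) Z) - DN p (Y p) (\<lambda>q. DN q (X q) Z)
     - DN p (D p (X p) Y - D p (Y p) X) Z"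

text \<open>The values of the shape tensor represent normal vectors, so that \<open>DN\<close> is applied to them, and \<open>D\<close>
  to the arguments. Since \<open>DN\<close> and \<open>D\<close> differ by a multiple of \<open>J\<^sub>1\<close>, this is the tensor \<open>P\<close>
  (\<open>P_tensor_eq\<close>).\<close>

definition twisted_derivative :: "'e \<Rightarrow> ('p \<Rightarrow> 'e) \<Rightarrow> ('p \<Rightarrow> 'e) \<Rightarrow> 'p \<Rightarrow> 'e" where
  "twisted_derivative x Y Z p =
     DN p x (\<lambda>q. C q (Y q) (Z q)) - C p (D p x Y) (Z p) - C p (Y p) (D p x Z)"

lemma twisted_derivative_tangent:
  assumes "p \<in> M" "x \<in> T p" "field_near A M p Y" "field_near A M p Z"
  shows "twisted_derivative x Y Z p \<in> T p"
  unfolding twisted_derivative_def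
  by (intro ind.T_closed normal_derivative(3) C_field C_tangent ind.connection assms amb.field_near_tangent)

lemma normal_riemann_tangent:
  assumes "p \<in> M" "field_near A M p X" "field_near A M p Y" "field_near A M p Z"
  shows "normal_riemann X Y Z p \<in> T p"
  unfolding normal_riemann_def
  by (intro ind.T_closed normal_derivative(3) normal_derivative_field ind.bracket_tangent assms amb.field_near_tangent)

text \<open>The tangential component is the Gauss equation, the normal component the Codazzi equation.\<close>

lemma curvature_tangent_section:
  assumes p: "p \<in> M" and X: "field_near A M p X" and Y: "field_near A M p Y" and Z: "field_near A M p Z"
  shows "curvature A UNIV Dt p (X p) (Y p) (Z p) =
    (ind.riemann X Y Z p + (C p (X p) (C p (Y p) (Z p)) - C p (Y p) (C p (X p) (Z p))))
    + J 2 p (twisted_derivative (X p) Y Z p - twisted_derivative (Y p) X Z p)"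
proof -
  note x = amb.field_near_tangent[OF X p] and y = amb.field_near_tangent[OF Y p] and z = amb.field_near_tangent[OF Z p]
  have "C p (D p (X p) Y - D p (Y p) X) (Z p) = C p (D p (X p) Y) (Z p) - C p (D p (Y p) X) (Z p)"
    using C_linear_left[OF p ind.connection[OF p Y x] ind.connection[OF p X y] z, of 1 "-1"] by simp
  then show ?thesis
    using curvature_along[OF p X Y amb.field_near_section[OF Z]] second_derivative(1)[OF p x Y Z]
      second_derivative(1)[OF p y X Z] Gauss(2)[OF p ind.bracket_tangent[OF p X Y] Z]
    unfolding ind.riemann_def twisted_derivative_def by (simp add: J2_simps[OF M_in_N[OF p]])
qed

text \<open>The normal component is the Ricci equation. The tangential component \<open>a\<close> carries the same
  information as the Codazzi equation, by skew-symmetry of the curvature.\<close>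

lemma curvature_normal_section:
  assumes p: "p \<in> M" and X: "field_near A M p X" and Y: "field_near A M p Y" and Z: "field_near A M p Z"
  obtains a where "a \<in> T p" "curvature A UNIV Dt p (X p) (Y p) (J 2 p (Z p)) =
    a + J 2 p (normal_riemann X Y Z p + (C p (X p) (C p (Y p) (Z p)) - C p (Y p) (C p (X p) (Z p))))"
proof -
  note x = amb.field_near_tangent[OF X p] and y = amb.field_near_tangent[OF Y p] and z = amb.field_near_tangent[OF Z p]
  note b = ind.bracket_tangent[OF p X Y]
  let ?a = "(D p (X p) (\<lambda>q. C q (Y q) (Z q)) + C p (X p) (DN p (Y p) Z))
    - (D p (Y p) (\<lambda>q. C q (X q) (Z q)) + C p (Y p) (DN p (X p) Z)) - C p (D p (X p) Y - D p (Y p) X) (Z p)"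
  have "?a \<in> T p"
    by (intro ind.T_closed(1,2) ind.connection C_tangent C_field normal_derivative(3) b p x y z X Y Z)
  moreover have "section_near A M p (\<lambda>r. J 2 r (Z r))"
    using section_near_J[OF _ p amb.field_near_section[OF Z]] by simp
  then have "curvature A UNIV Dt p (X p) (Y p) (J 2 p (Z p)) =
    ?a + J 2 p (normal_riemann X Y Z p + (C p (X p) (C p (Y p) (Z p)) - C p (Y p) (C p (X p) (Z p))))"
    using curvature_along[OF p X Y, of "\<lambda>r. J 2 r (Z r)"] second_derivative(2)[OF p x Y Z]
      second_derivative(2)[OF p y X Z] normal_derivative(2)[OF p b Z]
    unfolding normal_riemann_def by (simp add: J2_simps[OF M_in_N[OF p]])
  ultimately show ?thesis by (rule that)
qed

text \<open>\<open>\<omega>(Y) J\<^sub>1 Z = \<epsilon> (D\<^sub>Y Z - DN\<^sub>Y Z)\<close> is smooth, and dividing out a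
  non-vanishing component of \<open>J\<^sub>1 Z\<close> shows that \<open>\<omega>(Y)\<close> is.\<close>

lemma omega1_smooth:
  assumes p: "p \<in> M" and Y: "field_near A M p Y"
  shows "function_near A M p (\<lambda>q. \<omega> 1 q (Y q))"
proof -
  have "dim (T p) \<noteq> 0" using amb.tangent_space_subspace(2)[OF ind.sub p] maximal DIM_positive[where 'a = 'e] by linarith
  then have "\<not> T p \<subseteq> {0}" by (simp add: dim_eq_0)
  then obtain z where z: "z \<in> T p" "z \<noteq> 0" by blast
  then obtain w where w: "w \<in> T p" "g p (J 1 p z) w \<noteq> 0" using kaehler_form_nondegenerate[OF p] by blast
  define Z where "Z = extend A M p z"
  define W where "W = extend A M p w"
  have Z: "field_near A M p Z" "Z p = z" and W: "field_near A M p W" "W p = w"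
    unfolding Z_def W_def using ind.extend_field[OF p] z w by auto
  note s = amb.field_near_section
  let ?h = "\<lambda>q. g q (J 1 q (Z q)) (W q)"
  let ?f = "\<lambda>q. \<epsilon> * g q (D q (Y q) Z - DN q (Y q) Z) (W q)"
  have h: "function_near A M p ?h"
    by (intro amb.function_near_metric s field_near_J1 p Z W)
  have f: "function_near A M p ?f"
    by (intro amb.function_near_mult amb.function_near_const amb.function_near_metric s ind.field_near_diff
        ind.D_field normal_derivative_field p Y Z W)
  have hp: "?h p \<noteq> 0" using w Z(2) W(2) by simp
  obtain V H where V: "open V" "p \<in> V" "\<forall>q\<in>M \<inter> V. ?h q = H q" "\<forall>q\<in>V. H q \<noteq> 0"
    by (rule amb.function_near_nonzero[OF h hp p])
  obtain U where U: "open U" "p \<in> U" "\<forall>q\<in>U. field_near A M q Y \<and> field_near A M q Z"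
    by (rule common_neighbourhood[OF Y Z(1)])
  have "function_near A M p (\<lambda>q. ?f q * inverse (?h q))"
    by (intro amb.function_near_mult f amb.function_near_inverse h hp p)
  then show ?thesis
  proof (rule amb.function_near_cong)
    show "open (U \<inter> V)" "p \<in> U \<inter> V" using U V by auto
    fix q assume q: "q \<in> M \<inter> (U \<inter> V)"
    then have "D q (Y q) Z - DN q (Y q) Z = (\<epsilon> * \<omega> 1 q (Y q)) *\<^sub>R J 1 q (Z q)"
      using normal_derivative(1)[of q "Y q" Z] U(3) amb.field_near_tangent[of M q Y] by simp
    then have "?f q = (\<epsilon> * \<epsilon>) * \<omega> 1 q (Y q) * ?h q" by (simp add: amb.g_simps)
    moreover have "?h q \<noteq> 0" using V(3,4) q by auto
    ultimately show "?f q * inverse (?h q) = \<omega> 1 q (Y q)" using eps by simp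
  qed
qed

lemma second_normal_derivative:
  assumes p: "p \<in> M" and x: "x \<in> T p" and Y: "field_near A M p Y" and Z: "field_near A M p Z"
  shows "DN p x (\<lambda>q. DN q (Y q) Z) = D p x (\<lambda>q. D q (Y q) Z)
    - (\<epsilon> * dir_deriv A M p x (\<lambda>q. \<omega> 1 q (Y q))) *\<^sub>R J 1 p (Z p)
    - (\<epsilon> * \<omega> 1 p (Y p)) *\<^sub>R J 1 p (D p x Z) - (\<epsilon> * \<omega> 1 p x) *\<^sub>R J 1 p (D p (Y p) Z)
    + (\<epsilon> * \<omega> 1 p x * \<omega> 1 p (Y p)) *\<^sub>R Z p"
proof -
  note q = M_in_N[OF p]
  note y = amb.field_near_tangent[OF Y p] and JZ = field_near_J1[OF p Z]
  obtain U where U: "open U" "p \<in> U" "\<forall>q\<in>U. field_near A M q Y \<and> field_near A M q Z"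
    by (rule common_neighbourhood[OF Y Z])
  let ?w = "\<lambda>q. \<omega> 1 q (Y q) *\<^sub>R J 1 q (Z q)"
  have w: "field_near A M p ?w" by (rule ind.field_near_scaleR[OF omega1_smooth[OF p Y] JZ])
  have ew: "field_near A M p (\<lambda>q. \<epsilon> *\<^sub>R ?w q)"
    by (rule ind.field_near_scaleR[OF amb.function_near_const w])
  have "D p x (\<lambda>q. DN q (Y q) Z) = D p x (\<lambda>q. D q (Y q) Z - \<epsilon> *\<^sub>R ?w q)"
    by (rule ind.D_cong[OF p x normal_derivative_field[OF p Y Z] U(1,2)])
      (use U(3) normal_derivative(1) amb.field_near_tangent in auto)
  also have "\<dots> = D p x (\<lambda>q. D q (Y q) Z) - D p x (\<lambda>q. \<epsilon> *\<^sub>R ?w q)"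
    by (rule ind.D_diff[OF p ind.D_field[OF p Y Z] ew x])
  also have "D p x (\<lambda>q. \<epsilon> *\<^sub>R ?w q) = \<epsilon> *\<^sub>R D p x ?w" by (rule ind.D_scaleR[OF p w x])
  also have "D p x ?w = dir_deriv A M p x (\<lambda>q. \<omega> 1 q (Y q)) *\<^sub>R J 1 p (Z p) + \<omega> 1 p (Y p) *\<^sub>R J 1 p (D p x Z)"
    using ind.D_Leibniz[OF p omega1_smooth[OF p Y] JZ x] J1_parallel[OF p x Z] by simp
  finally have e: "D p x (\<lambda>q. DN q (Y q) Z) = D p x (\<lambda>q. D q (Y q) Z)
      - \<epsilon> *\<^sub>R (dir_deriv A M p x (\<lambda>q. \<omega> 1 q (Y q)) *\<^sub>R J 1 p (Z p) + \<omega> 1 p (Y p) *\<^sub>R J 1 p (D p x Z))" .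
  have J: "J 1 p (DN p (Y p) Z) = J 1 p (D p (Y p) Z) - \<omega> 1 p (Y p) *\<^sub>R Z p"
    using normal_derivative(1)[OF p y Z] eps by (simp add: J1_simps[OF q] J1_sq[OF q] mult.assoc mult.left_commute)
  show ?thesis
    unfolding normal_derivative(1)[OF p x normal_derivative_field[OF p Y Z]] e J by (simp add: algebra_simps)
qed

text \<open>\<open>DN\<close> arises from \<open>D\<close> by adding the form \<open>- \<epsilon> \<omega>\<^sub>1\<close> with values in the multiples of the parallel
  endomorphism \<open>J\<^sub>1\<close>. These commute, so that the curvature changes by the exterior derivative alone.\<close>

lemma normal_riemann_eq:
  assumes p: "p \<in> M" and X: "field_near A M p X" and Y: "field_near A M p Y" and Z: "field_near A M p Z"
  shows "normal_riemann X Y Z p = ind.riemann X Y Z p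
    - (\<epsilon> * (dir_deriv A M p (X p) (\<lambda>q. \<omega> 1 q (Y q)) - dir_deriv A M p (Y p) (\<lambda>q. \<omega> 1 q (X q))
        - \<omega> 1 p (D p (X p) Y - D p (Y p) X))) *\<^sub>R J 1 p (Z p)"
  unfolding normal_riemann_def ind.riemann_def
    second_normal_derivative[OF p amb.field_near_tangent[OF X p] Y Z]
    second_normal_derivative[OF p amb.field_near_tangent[OF Y p] X Z]
    normal_derivative(1)[OF p ind.bracket_tangent[OF p X Y] Z]
  by (simp add: algebra_simps)

text \<open>Self-adjointness of \<open>C\<close> differentiates to that of its derivative. In particular the derivative,
  applied to \<open>Z\<close>, depends only on the value of \<open>Z\<close>.\<close>

lemma twisted_derivative_adjoint:
  assumes p: "p \<in> M" and x: "x \<in> T p" and Y: "field_near A M p Y" and Z: "field_near A M p Z"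
    and W: "field_near A M p W"
  shows "g p (twisted_derivative x Y Z p) (W p) = g p (Z p) (twisted_derivative x Y W p)"
proof -
  note q = M_in_N[OF p]
  note y = amb.field_near_tangent[OF Y p] and z = amb.field_near_tangent[OF Z p] and w = amb.field_near_tangent[OF W p]
  note CZ = C_field[OF p Y Z] and CW = C_field[OF p Y W] and s = amb.field_near_section
  obtain U where U: "open U" "p \<in> U" "\<forall>q\<in>U. field_near A M q Y \<and> field_near A M q Z"
    by (rule common_neighbourhood[OF Y Z])
  obtain V where V: "open V" "p \<in> V" "\<forall>q\<in>V. field_near A M q W"
    using amb.field_near_open[OF W] by blast
  have "dir_deriv A M p x (\<lambda>q. g q (C q (Y q) (Z q)) (W q)) = dir_deriv A M p x (\<lambda>q. g q (Z q) (C q (Y q) (W q)))"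
  proof (rule amb.dir_deriv_cong[OF x x order_refl amb.function_near_metric[OF s[OF Z] s[OF CW]]])
    show "open (U \<inter> V)" "p \<in> U \<inter> V" using U V by auto
    show "g q (C q (Y q) (Z q)) (W q) = g q (Z q) (C q (Y q) (W q))" if "q \<in> M \<inter> (U \<inter> V)" for q
      using that U(3) V(3) C_adjoint amb.field_near_tangent by auto
  qed
  then have "g p (D p x (\<lambda>q. C q (Y q) (Z q))) (W p) + g p (C p (Y p) (Z p)) (D p x W) =
      g p (D p x Z) (C p (Y p) (W p)) + g p (Z p) (D p x (\<lambda>q. C q (Y q) (W q)))"
    using ind.D_metric[OF p CZ W x] ind.D_metric[OF p Z CW x] by simp
  moreover have "g p (C p (Y p) (Z p)) (D p x W) = g p (Z p) (C p (Y p) (D p x W))"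
    "g p (D p x Z) (C p (Y p) (W p)) = g p (C p (Y p) (D p x Z)) (W p)"
    "g p (C p (D p x Y) (Z p)) (W p) = g p (Z p) (C p (D p x Y) (W p))"
    using C_adjoint[OF p] y z w ind.connection[OF p _ x] Y Z W by auto
  moreover have "g p (J 1 p (C p (Y p) (Z p))) (W p) = g p (Z p) (J 1 p (C p (Y p) (W p)))"
    using J_skew[of 1 p "C p (Y p) (Z p)" "W p"] q C_adjoint[OF p y z J1_tangent[OF p w]] C_J1[OF p y w]
    by (simp add: amb.g_simps)
  ultimately show ?thesis
    unfolding twisted_derivative_def
    using normal_derivative(1)[OF p x CZ] normal_derivative(1)[OF p x CW] by (simp add: amb.g_simps)
qed

lemma twisted_derivative_cong:
  assumes p: "p \<in> M" and x: "x \<in> T p" and Y: "field_near A M p Y" and Z: "field_near A M p Z"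
    and Z': "field_near A M p Z'" "Z p = Z' p"
  shows "twisted_derivative x Y Z p = twisted_derivative x Y Z' p"
proof (rule ind.tangent_eqI[OF p twisted_derivative_tangent[OF p x Y Z] twisted_derivative_tangent[OF p x Y Z'(1)]])
  fix w assume "w \<in> T p"
  then show "g p (twisted_derivative x Y Z p) w = g p (twisted_derivative x Y Z' p) w"
    using twisted_derivative_adjoint[OF p x Y Z, of "extend A M p w"]
      twisted_derivative_adjoint[OF p x Y Z'(1), of "extend A M p w"] ind.extend_field[OF p] Z'(2) by simp
qed

text \<open>Both connections commute with \<open>J\<^sub>1\<close>, with which \<open>C\<close> anticommutes.\<close>

lemma twisted_derivative_J1:
  assumes p: "p \<in> M" and x: "x \<in> T p" and Y: "field_near A M p Y" and Z: "field_near A M p Z"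
  shows "twisted_derivative x Y (\<lambda>q. J 1 q (Z q)) p = - J 1 p (twisted_derivative x Y Z p)"
proof -
  note q = M_in_N[OF p]
  note y = amb.field_near_tangent[OF Y p] and z = amb.field_near_tangent[OF Z p]
  note CZ = C_field[OF p Y Z] and JZ = field_near_J1[OF p Z]
  note JCZ = field_near_J1[OF p CZ]
  obtain U where U: "open U" "p \<in> U" "\<forall>q\<in>U. field_near A M q Y \<and> field_near A M q Z"
    by (rule common_neighbourhood[OF Y Z])
  have CJ: "C p v (J 1 p w) = - J 1 p (C p v w)" if "v \<in> T p" "w \<in> T p" for v w
    using C_J1[OF p that] .
  have "D p x (\<lambda>q. C q (Y q) (J 1 q (Z q))) = D p x (\<lambda>q. (-1) *\<^sub>R J 1 q (C q (Y q) (Z q)))"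
    by (rule ind.D_cong[OF p x C_field[OF p Y JZ] U(1,2)])
      (use U(3) C_J1 amb.field_near_tangent in auto)
  also have "\<dots> = - J 1 p (D p x (\<lambda>q. C q (Y q) (Z q)))"
    using ind.D_scaleR[OF p JCZ x, of "-1"] J1_parallel[OF p x CZ] by simp
  finally show ?thesis
    unfolding twisted_derivative_def
    using normal_derivative(1)[OF p x CZ] normal_derivative(1)[OF p x C_field[OF p Y JZ]]
      CJ[OF ind.connection[OF p Y x] z] CJ[OF y ind.connection[OF p Z x]] CJ[OF y z] J1_parallel[OF p x Z]
    by (simp add: J1_simps[OF q])
qed

lemma P_tensor_eq:
  assumes p: "p \<in> M" and x: "x \<in> T p" and y: "y \<in> T p" and z: "z \<in> T p"
  shows "P_tensor A D \<epsilon> M J \<omega> C p x y z = twisted_derivative x (extend A M p y) (extend A M p z) p"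
proof -
  define Y where "Y = extend A M p y"
  define Z where "Z = extend A M p z"
  have Y: "field_near A M p Y" "Y p = y" and Z: "field_near A M p Z" "Z p = z"
    unfolding Y_def Z_def using ind.extend_field[OF p] y z by auto
  show ?thesis
    unfolding P_tensor_def cov_deriv_bilinear_def twisted_derivative_def Let_def Y_def[symmetric] Z_def[symmetric]
    using normal_derivative(1)[OF p x C_field[OF p Y(1) Z(1)]] Y(2) Z(2) by simp
qed

text \<open>Linearity comes with self-adjointness, because \<open>g (L v) w = g v (L w)\<close> is linear in \<open>v\<close> and \<open>g\<close> is
  non-degenerate on \<open>T\<close>.\<close>

lemma twisted_derivative_S_J:
  assumes p: "p \<in> M" and x: "x \<in> T p" and Y: "field_near A M p Y"
    and L: "\<And>z. z \<in> T p \<Longrightarrow> L z = twisted_derivative x Y (extend A M p z) p"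
    and J1: "Jeps p = J 1 p"
  shows "L \<in> S_J A g M Jeps p"
proof -
  note e = ind.extend_field[OF p]
  have LT: "L z \<in> T p" if "z \<in> T p" for z
    using L[OF that] twisted_derivative_tangent[OF p x Y e(1)[OF that]] by simp
  have adj: "g p (L v) w = g p v (L w)" if "v \<in> T p" "w \<in> T p" for v w
    using twisted_derivative_adjoint[OF p x Y e(1)[OF that(1)] e(1)[OF that(2)]] L that e(2) by simp
  have "L (a *\<^sub>R v + b *\<^sub>R w) = a *\<^sub>R L v + b *\<^sub>R L w" if v: "v \<in> T p" and w: "w \<in> T p" for v w a b
  proof -
    have m: "a *\<^sub>R v + b *\<^sub>R w \<in> T p" by (intro ind.T_closed p v w)
    show ?thesis
    proof (rule ind.tangent_eqI[OF p LT[OF m]])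
      show "a *\<^sub>R L v + b *\<^sub>R L w \<in> T p" by (intro ind.T_closed p LT v w)
      show "g p (L (a *\<^sub>R v + b *\<^sub>R w)) u = g p (a *\<^sub>R L v + b *\<^sub>R L w) u" if u: "u \<in> T p" for u
        using adj[OF m u] adj[OF v u] adj[OF w u] by (simp add: amb.g_simps)
    qed
  qed
  moreover have "L (J 1 p v) + J 1 p (L v) = 0" if v: "v \<in> T p" for v
  proof -
    have "L (J 1 p v) = twisted_derivative x Y (\<lambda>q. J 1 q (extend A M p v q)) p"
      unfolding L[OF J1_tangent[OF p v]]
      by (rule twisted_derivative_cong[OF p x Y e(1)[OF J1_tangent[OF p v]] field_near_J1[OF p e(1)[OF v]]])
        (simp add: e(2) J1_tangent p v)
    then show ?thesis using twisted_derivative_J1[OF p x Y e(1)[OF v]] L[OF v] by simp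
  qed
  ultimately show ?thesis unfolding S_J_def Let_def J1 using LT adj by blast
qed

end

section \<open>Submanifolds of para-quaternionic Kaehler manifolds\<close>

text \<open>Pairing \<open>u = v + w\<close> with \<open>v\<close> and with \<open>w\<close> gives \<open>b v v = b w w\<close>, where one side is non-negative and
  the other non-positive.\<close>

lemma neutral_metric_nondegenerate:
  fixes b :: "'e::euclidean_space \<Rightarrow> 'e \<Rightarrow> real"
  assumes b: "bilinear b" and sym: "\<And>v w. b v w = b w v"
    and V: "subspace V" "2 * dim V = DIM('e)" "\<forall>v\<in>V - {0}. b v v > 0"
    and W: "subspace W" "2 * dim W = DIM('e)" "\<forall>w\<in>W - {0}. b w w < 0"
  shows "nondegenerate_on b UNIV"
  unfolding nondegenerate_on_def
proof (intro ballI impI)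
  fix u :: 'e assume u: "\<forall>w\<in>UNIV. b u w = 0"
  have "V \<inter> W \<subseteq> {0}"
  proof
    fix v assume v: "v \<in> V \<inter> W"
    show "v \<in> {0}"
    proof (rule ccontr)
      assume "v \<notin> {0}"
      then have "b v v > 0" "b v v < 0" using v V(3) W(3) by auto
      then show False by simp
    qed
  qed
  then have d0: "dim (V \<inter> W) = 0" by (simp add: dim_eq_0)
  define S where "S = {x + y |x y. x \<in> V \<and> y \<in> W}"
  have "dim S = DIM('e)"
    using dim_sums_Int[OF V(1) W(1), folded S_def] d0 V(2) W(2) by linarith
  then have "span S = UNIV" using dim_eq_full by blast
  moreover have "subspace S" unfolding S_def using subspace_sums[OF V(1) W(1)] .
  then have "span S = S" by (rule span_eq_iff[THEN iffD2])
  ultimately have "u \<in> S" by simp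
  then obtain v w where vw: "v \<in> V" "w \<in> W" "u = v + w" unfolding S_def by blast
  have "b v v + b v w = 0" "b v w + b w w = 0"
    using u[rule_format, of v] u[rule_format, of w] sym[of w v] vw(3) by (auto simp: bilinear_ladd[OF b])
  then have eq: "b v v = b w w" by simp
  have "v = 0"
  proof (rule ccontr)
    assume "v \<noteq> 0"
    then have "b v v > 0" using V(3) vw(1) by blast
    then have "b w w > 0" using eq by simp
    then have "w \<noteq> 0" using bilinear_lzero[OF b] by auto
    then show False using W(3) vw(2) \<open>b w w > 0\<close> by force
  qed
  moreover have "w = 0"
  proof (rule ccontr)
    assume "w \<noteq> 0"
    then have "b w w < 0" using W(3) vw(2) by auto
    then show False using eq \<open>v = 0\<close> bilinear_lzero[OF b] by auto
  qed
  ultimately show "u = 0" using vw(3) by simp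
qed

lemma pq_basis_mem:
  assumes "pq_basis Qp e J" "\<alpha> \<in> {1, 2, 3}"
  shows "J \<alpha> \<in> Qp"
proof -
  have "J \<alpha> = (\<lambda>v. \<Sum>\<beta>\<in>{1, 2, 3}. (if \<beta> = \<alpha> then 1 else 0) *\<^sub>R J \<beta> v)"
    using assms(2) by (auto simp: fun_eq_iff)
  then have "J \<alpha> \<in> {L. \<exists>c :: nat \<Rightarrow> real. L = (\<lambda>v. \<Sum>\<alpha>\<in>{1, 2, 3}. c \<alpha> *\<^sub>R J \<alpha> v)}"
    by (intro CollectI exI)
  moreover have "Qp = {L. \<exists>c :: nat \<Rightarrow> real. L = (\<lambda>v. \<Sum>\<alpha>\<in>{1, 2, 3}. c \<alpha> *\<^sub>R J \<alpha> v)}"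
    using assms(1) unfolding pq_basis_def by (elim conjE)
  ultimately show ?thesis by simp
qed

theorem proposition5p5:
  fixes A :: "('p::{t2_space, second_countable_topology}, 'e::euclidean_space) chart set"
    and n :: nat
    and Q :: "'p \<Rightarrow> ('e \<Rightarrow> 'e) set"
    and g :: "('p, 'e) metric"
    and Dt D :: "('p, 'e) connection"
    and \<epsilon> :: real
    and M N :: "'p set"
    and Jeps :: "'p \<Rightarrow> 'e \<Rightarrow> 'e"
    and J :: "nat \<Rightarrow> 'p \<Rightarrow> 'e \<Rightarrow> 'e"
    and \<omega> :: "nat \<Rightarrow> 'p \<Rightarrow> 'e \<Rightarrow> real"
  assumes "\<epsilon> \<in> {-1, 1}"
    and "para_quaternionic_kaehler A n Q g Dt"
    and "\<forall>p. reduced_scalar_curvature A n g Dt p \<noteq> 0"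
    and "almost_eps_hermitian A (2 * n) Q g \<epsilon> M Jeps"
    and "adapted_basis A Q \<epsilon> M Jeps N J"
    and "totally_eps_complex A g M J"
    and "connection_forms A Dt \<epsilon> N J \<omega>"
    and "n = 1 \<longrightarrow> (\<forall>p\<in>M. \<forall>x\<in>tangent_space A M p. \<omega> 2 p x = 0 \<and> \<omega> 3 p x = 0)"
    and "levi_civita A M g D"
  shows "\<forall>p\<in>M. \<forall>x\<in>tangent_space A M p. \<forall>y\<in>tangent_space A M p.
    (let T = tangent_space A M p;
         tanp = tan_part A g M p;
         norp = nor_part A g M p;
         Rt = curvature A UNIV Dt p;
         R = curvature A M D p;
         RN = curvature A M (N_connection A g Dt M J) p;
         C = shape_tensor A g Dt M J;
         P = P_tensor A D \<epsilon> M J \<omega> C p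
     in P x y \<in> S_J A g M Jeps p \<and>
        (\<forall>z\<in>T. tanp (Rt x y z) = R x y z + (C p x (C p y z) - C p y (C p x z))) \<and>
        (\<forall>z\<in>T. J 2 p (norp (Rt x y (J 2 p z))) = RN x y z + (C p x (C p y z) - C p y (C p x z)) \<and>
               RN x y z + (C p x (C p y z) - C p y (C p x z)) =
               R x y z + (C p x (C p y z) - C p y (C p x z))
                 - (\<epsilon> * ext_deriv1 A M (\<omega> 1) p x y) *\<^sub>R Jeps p z) \<and>
        (\<forall>z\<in>T. J 2 p (norp (Rt x y z)) = P x y z - P y x z))"
proof -
  note pqk = assms(2)[unfolded para_quaternionic_kaehler_def]
    and herm = assms(4)[unfolded almost_eps_hermitian_def]
    and adap = assms(5)[unfolded adapted_basis_def]
  have n: "n \<ge> 1" using pqk by (elim conjE)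
  have dim: "DIM('e) = 4 * n" using pqk by (elim conjE)
  have neutral: "neutral_metric A g" using pqk by (elim conjE)
  have lcU: "levi_civita A UNIV g Dt" using pqk by (elim conjE)
  have "\<forall>p. \<forall>L\<in>Q p. \<forall>v w. g p (L v) w = - g p v (L w)" using pqk by (elim conjE)
  then have skew: "g p (L v) w = - g p v (L w)" if "L \<in> Q p" for p L v w using that by blast
  have "smooth_atlas A" using pqk by (elim conjE)
  then interpret smooth_manifold A by unfold_locales
  have metric: "bilinear (g p)" "g p v w = g p w v" for p v w
    using neutral[unfolded neutral_metric_def, THEN conjunct1, rule_format, of p] by blast+
  have smooth: "smooth_function A U (\<lambda>q. g q (X q) (Y q))"
    if "open U" "smooth_field A U X" "smooth_field A U Y" for U X Y
    using neutral[unfolded neutral_metric_def, THEN conjunct2, rule_format, OF that] .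
  have nd: "nondegenerate_on (g p) UNIV" for p
  proof -
    obtain V W where "subspace V" "subspace W" "2 * dim V = DIM('e)" "2 * dim W = DIM('e)"
      "\<forall>v\<in>V - {0}. g p v v > 0" "\<forall>w\<in>W - {0}. g p w w < 0"
      using neutral[unfolded neutral_metric_def, THEN conjunct1, rule_format, of p] by blast
    then show ?thesis by (intro neutral_metric_nondegenerate[OF metric, where V = V and W = W])
  qed
  have sub: "submanifold A (2 * n) M" using herm by (elim conjE)
  have nondeg: "\<forall>p\<in>M. nondegenerate_on (g p) (tangent_space A M p)" using herm by (elim conjE)
  have "\<forall>p\<in>M. Jeps p \<in> Q p \<and> Jeps p ` tangent_space A M p = tangent_space A M p \<and>
      (\<forall>v. Jeps p (Jeps p v) = \<epsilon> *\<^sub>R v)" using herm by (elim conjE)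
  then have JT: "Jeps p ` tangent_space A M p = tangent_space A M p" if "p \<in> M" for p using that by simp
  have N: "open N" "M \<subseteq> N" using adap by simp_all
  have Jsm: "\<forall>\<alpha>\<in>{1, 2, 3}. smooth_endo A N (J \<alpha>)" using adap by (elim conjE)
  have bas: "\<forall>q\<in>N. pq_basis (Q q) (adapted_sign \<epsilon>) (\<lambda>\<alpha>. J \<alpha> q)" using adap by (elim conjE)
  have J1: "\<forall>q\<in>M. J 1 q = Jeps q" using adap by (elim conjE)
  interpret amb: levi_civita_manifold A "DIM('e)" UNIV g Dt
    by unfold_locales (use submanifold_UNIV metric smooth nd lcU in \<open>auto simp: tangent_space_UNIV\<close>)
  interpret ind: levi_civita_manifold A "2 * n" M g D
    by unfold_locales (use sub nondeg metric smooth assms(9) in auto)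
  have basis: "pq_basis (Q q) (adapted_sign \<epsilon>) (\<lambda>\<alpha>. J \<alpha> q)" if "q \<in> N" for q
    using bas that by simp
  have JQ: "J \<alpha> q \<in> Q q" if "\<alpha> \<in> {1, 2, 3}" "q \<in> N" for \<alpha> q
    by (rule pq_basis_mem[OF basis[OF that(2)] that(1)])
  have rel: "J 1 q (J 1 q v) = \<epsilon> *\<^sub>R v" "J 2 q (J 2 q v) = v" "J 1 q (J 2 q v) = - J 2 q (J 1 q v)"
    "J 3 q v = J 1 q (J 2 q v)" if "q \<in> N" for q v
  proof -
    note b = basis[OF that, unfolded pq_basis_def]
    have sq: "\<forall>\<alpha>\<in>{1, 2, 3}. linear (J \<alpha> q) \<and> (\<forall>v. J \<alpha> q (J \<alpha> q v) = adapted_sign \<epsilon> \<alpha> *\<^sub>R v)"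
      using b by (elim conjE)
    show "J 1 q (J 1 q v) = \<epsilon> *\<^sub>R v" using bspec[OF sq, of 1] by (simp add: adapted_sign_def)
    show "J 2 q (J 2 q v) = v" using bspec[OF sq, of 2] by (simp add: adapted_sign_def)
    have anti: "\<forall>\<alpha>\<in>{1, 2, 3}. \<forall>\<beta>\<in>{1, 2, 3}. \<alpha> \<noteq> \<beta> \<longrightarrow> (\<forall>v. J \<alpha> q (J \<beta> q v) = - J \<beta> q (J \<alpha> q v))"
      using b by (elim conjE)
    show "J 1 q (J 2 q v) = - J 2 q (J 1 q v)" using bspec[OF bspec[OF anti, of 1], of 2] by simp
    have "\<forall>v. J 3 q v = J 1 q (J 2 q v)" using b by (elim conjE)
    then show "J 3 q v = J 1 q (J 2 q v)" by (rule spec)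
  qed
  interpret totally_complex_submanifold A "2 * n" M g Dt D \<epsilon> N J \<omega>
  proof unfold_locales
    show "\<epsilon> * \<epsilon> = 1" using assms(1) by auto
    show "open N" "M \<subseteq> N" using N .
    show "smooth_endo A N (J \<alpha>)" if "\<alpha> \<in> {1, 2, 3}" for \<alpha> using bspec[OF Jsm that] .
    show "J 1 q (J 1 q v) = \<epsilon> *\<^sub>R v" "J 2 q (J 2 q v) = v" "J 1 q (J 2 q v) = - J 2 q (J 1 q v)"
      "J 3 q v = J 1 q (J 2 q v)" if "q \<in> N" for q v using rel[OF that] by auto
    show "g q (J \<alpha> q v) w = - g q v (J \<alpha> q w)" if "\<alpha> \<in> {1, 2, 3}" "q \<in> N" for \<alpha> q v w
      using skew[OF JQ[OF that]] .
    show "J 1 p v \<in> tangent_space A M p" if "p \<in> M" "v \<in> tangent_space A M p" for p v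
    proof -
      have "J 1 p = Jeps p" using J1 that(1) by (rule bspec)
      then show ?thesis using imageI[OF that(2), of "Jeps p"] unfolding JT[OF that(1)] by simp
    qed
    show "g p (J 2 p v) w = 0" if "p \<in> M" "v \<in> tangent_space A M p" "w \<in> tangent_space A M p" for p v w
      using assms(6) that unfolding totally_eps_complex_def by blast
    show "2 * (2 * n) = DIM('e)" using dim by simp
    show "connection_forms A Dt \<epsilon> N J \<omega>" by (rule assms(7))
    show "\<omega> 2 p x = 0 \<and> \<omega> 3 p x = 0" if "2 * n < 3" "p \<in> M" "x \<in> tangent_space A M p" for p x
      using assms(8) that n by auto
  qed
  show ?thesis
    unfolding Let_def
  proof (intro ballI conjI)
    fix p x y assume p: "p \<in> M" and x: "x \<in> T p" and y: "y \<in> T p"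
    have Je: "Jeps p = J 1 p" using J1 p by (auto dest: bspec)
    note q = M_in_N[OF p]
    define X where "X = extend A M p x"
    define Y where "Y = extend A M p y"
    have X: "field_near A M p X" "X p = x" and Y: "field_near A M p Y" "Y p = y"
      unfolding X_def Y_def using ind.extend_field[OF p] x y by auto
    show "P_tensor A D \<epsilon> M J \<omega> C p x y \<in> S_J A g M Jeps p"
    proof (rule twisted_derivative_S_J[OF p x Y(1)])
      show "P_tensor A D \<epsilon> M J \<omega> C p x y z = twisted_derivative x Y (extend A M p z) p" if "z \<in> T p" for z
        using P_tensor_eq[OF p x y that] unfolding Y_def .
    qed (rule Je)
    fix z assume z: "z \<in> T p"
    define Z where "Z = extend A M p z"
    have Z: "field_near A M p Z" "Z p = z" unfolding Z_def using ind.extend_field[OF p z] by auto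
    have R: "curvature A M D p x y z = ind.riemann X Y Z p"
      using ind.curvature_riemann[OF p x y] unfolding X_def Y_def Z_def .
    have br: "lie_bracket A M X Y p = D p (X p) Y - D p (Y p) X"
      by (rule ind.lie_bracket_eq[OF p X(1) Y(1)])
    have RN: "curvature A M DN p x y z = normal_riemann X Y Z p"
      unfolding curvature_def normal_riemann_def Let_def X_def[symmetric] Y_def[symmetric] Z_def[symmetric] br
      using X(2) Y(2) by simp
    have m: "C p x (C p y z) - C p y (C p x z) \<in> T p"
      by (intro ind.T_closed C_tangent p x y z)
    have P: "P_tensor A D \<epsilon> M J \<omega> C p x y z - P_tensor A D \<epsilon> M J \<omega> C p y x z =
        twisted_derivative x Y Z p - twisted_derivative y X Z p"
      using P_tensor_eq[OF p x y z] P_tensor_eq[OF p y x z] unfolding X_def Y_def Z_def by simp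
    have Pm: "twisted_derivative x Y Z p - twisted_derivative y X Z p \<in> T p"
      by (intro ind.T_closed twisted_derivative_tangent p x y X Y Z)
    have Rm: "ind.riemann X Y Z p + (C p x (C p y z) - C p y (C p x z)) \<in> T p"
      by (intro ind.T_closed(1) ind.riemann_tangent m p X Y Z)
    have Rt: "curvature A UNIV Dt p x y z = (ind.riemann X Y Z p + (C p x (C p y z) - C p y (C p x z)))
        + J 2 p (twisted_derivative x Y Z p - twisted_derivative y X Z p)"
      using curvature_tangent_section[OF p X(1) Y(1) Z(1)] X(2) Y(2) Z(2) by simp
    show "tan_part A g M p (curvature A UNIV Dt p x y z) =
        curvature A M D p x y z + (C p x (C p y z) - C p y (C p x z))"
      unfolding Rt R by (rule tan_part_sum[OF p Rm Pm])
    show "J 2 p (nor_part A g M p (curvature A UNIV Dt p x y z)) =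
        P_tensor A D \<epsilon> M J \<omega> C p x y z - P_tensor A D \<epsilon> M J \<omega> C p y x z"
      unfolding Rt P nor_part_sum[OF p Rm Pm] by (rule J2_sq[OF q])
    have RNm: "normal_riemann X Y Z p + (C p x (C p y z) - C p y (C p x z)) \<in> T p"
      by (intro ind.T_closed(1) normal_riemann_tangent m p X Y Z)
    obtain a where a: "a \<in> T p" "curvature A UNIV Dt p x y (J 2 p z) =
        a + J 2 p (normal_riemann X Y Z p + (C p x (C p y z) - C p y (C p x z)))"
      by (rule curvature_normal_section[OF p X(1) Y(1) Z(1), unfolded X(2) Y(2) Z(2)])
    show "J 2 p (nor_part A g M p (curvature A UNIV Dt p x y (J 2 p z))) =
        curvature A M DN p x y z + (C p x (C p y z) - C p y (C p x z))"
      unfolding a(2) RN nor_part_sum[OF p a(1) RNm] by (rule J2_sq[OF q])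
    have "ext_deriv1 A M (\<omega> 1) p x y = dir_deriv A M p (X p) (\<lambda>q. \<omega> 1 q (Y q)) -
        dir_deriv A M p (Y p) (\<lambda>q. \<omega> 1 q (X q)) - \<omega> 1 p (D p (X p) Y - D p (Y p) X)"
      unfolding ext_deriv1_def Let_def X_def[symmetric] Y_def[symmetric] br X(2) Y(2) ..
    then show "curvature A M DN p x y z + (C p x (C p y z) - C p y (C p x z)) =
        curvature A M D p x y z + (C p x (C p y z) - C p y (C p x z))
          - (\<epsilon> * ext_deriv1 A M (\<omega> 1) p x y) *\<^sub>R Jeps p z"
      unfolding R RN Je using normal_riemann_eq[OF p X(1) Y(1) Z(1)] Z(2) by simp
  qed
qed

end
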